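(* Let $\Lambda:\mathcal D\to\mathbb R^m$ be an admissible Lagrange multiplier function, let $\Delta t>0$, and let $\Psi_{\Delta t}$, $A$, $B$ and $\Psi_{\Delta t}^{\rm rev}$ be the associated maps and sets defined in the context; let $B^c=T^*\mathcal M\setminus B$. Then the map $\Psi_{\Delta t}^{\rm rev}:T^*\mathcal M\to T^*\mathcal M$ is globally well defined and satisfies $$\Psi_{\Delta t}^{\rm rev}\circ\Psi_{\Delta t}^{\rm rev}=\mathrm{Id}.$$ Moreover, both $\Psi_{\Delta t}^{\rm rev}:B\to B$ and $\Psi_{\Delta t}^{\rm rev}:B^c\to B^c$ are $C^1$-diffeomorphisms which preserve the measure $\sigma_{T^*\mathcal M}(dq\,dp)$. As a consequence, $\Psi_{\Delta t}^{\rm rev}:T^*\mathcal M\to T^*\mathcal M$ globally preserves the measure $\sigma_{T^*\mathcal M}(dq\,dp)$, i.e. $\sigma_{T^*\mathcal M}\big((\Psi_{\Delta t}^{\rm rev})^{-1}(S)\big)=\sigma_{T^*\mathcal M}(S)$ for every measurable $S\subset T^*\mathcal M$.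
   Context: **Geometric setting.** Let $1\le m<d$ be integers, $M\in\mathbb R^{d\times d}$ a fixed symmetric positive definite matrix, and $\xi=(\xi_1,\dots,\xi_m):\mathbb R^d\to\mathbb R^m$ a smooth function. $\nabla\xi(q)\in\mathbb R^{d\times m}$ is the matrix whose columns are the gradients $\nabla\xi_i(q)$. Set $\mathcal M=\{q\in\mathbb R^d:\xi(q)=0\}$, and assume that $G_M(q)=[\nabla\xi(q)]^TM^{-1}\nabla\xi(q)\in\mathbb R^{m\times m}$ is invertible for all $q$ in a neighborhood of $\mathcal M$ (so $\mathcal M$ is a smooth submanifold of codimension $m$). Let $V:\mathbb R^d\to\mathbb R$ be smooth. Put $T_q^*\mathcal M=\{p\in\mathbb R^d:[\nabla\xi(q)]^TM^{-1}p=0\}$ and $T^*\mathcal M=\{(q,p)\in\mathbb R^d\times\mathbb R^d:\xi(q)=0,\ [\nabla\xi(q)]^TM^{-1}p=0\}$. The phase-space Liouville measure on $T^*\mathcal M$ is $\sigma_{T^*\mathcal M}(dq\,dp)=\sigma^M_{\mathcal M}(dq)\,\sigma^{M^{-1}}_{T_q^*\mathcal M}(dp)$, where $\sigma^M_{\mathcal M}$ is the Riemannian measure on $\mathcal M$ induced by the scalar product $q^TM\tilde q$ on $\mathbb R^d$ and $\sigma^{M^{-1}}_{T_q^*\mathcal M}$ is the Lebesgue measure on $T_q^*\mathcal M$ induced by the scalar product $p^TM^{-1}\tilde p$. **Admissible Lagrange multiplier function.** A $C^1$ function $\Lambda:\mathcal D\to\mathbb R^m$ defined on an open set $\mathcal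 D$ of $\mathcal M\times\mathbb R^d$ such that for all $(q,\tilde q)\in\mathcal D$: (projection) $\tilde q+M^{-1}\nabla\xi(q)\Lambda(q,\tilde q)\in\mathcal M$; and (non-tangential projection) the $m\times m$ matrix $\left[\nabla\xi\big(\tilde q+M^{-1}\nabla\xi(q)\Lambda(q,\tilde q)\big)\right]^TM^{-1}\nabla\xi(q)$ is invertible. **RATTLE map.** Given $\Lambda$ and a timestep $\Delta t>0$, let $$A=\Big\{(q,p)\in T^*\mathcal M:\ \big(q,\,q+\Delta t\,M^{-1}[p-\tfrac{\Delta t}{2}\nabla V(q)]\big)\in\mathcal D\Big\},$$ an open subset of $T^*\mathcal M$. For $(q,p)\in A$, set $\Psi_{\Delta t}(q,p)=(q^1,-p^1)\in T^*\mathcal M$, where $\lambda^{1/2}=\frac1{\Delta t}\Lambda\big(q,q+\Delta tM^{-1}[p-\frac{\Delta t}2\nabla V(q)]\big)$, $p^{1/2}=p-\frac{\Delta t}2\nabla V(q)+\nabla\xi(q)\lambda^{1/2}$, $q^1=q+\Delta t\,M^{-1}p^{1/2}$, $p^1=p^{1/2}-\frac{\Delta t}2\nabla V(q^1)+\nabla\xi(q^1)\lambda^1$, with $\lambda^1\in\mathbb R^m$ the unique vector such that $[\nabla\xi(q^1)]^TM^{-1}p^1=0$. **Map with reverse projection check.** Let $$B=\big\{(q,p)\in A:\ \Psi_{\Delta t}(q,p)\in A\ \text{ and }\ (\Psi_{\Delta t}\circ\Psi_{\Delta t})(q,p)=(q,p)\big\},$$ and for $(q,p)\in T^*\mathcal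 M$ let $\Psi_{\Delta t}^{\rm rev}(q,p)=\Psi_{\Delta t}(q,p)$ if $(q,p)\in B$ and $\Psi_{\Delta t}^{\rm rev}(q,p)=(q,p)$ if $(q,p)\notin B$. *)

theory Defs
  imports "HOL-Analysis.Analysis"
begin

section \<open>Differentiability classes\<close>

text \<open>\<open>C_k_on n f U\<close> is meant for open \<open>U\<close>. As the domain is finite dimensional, continuity of
  all iterated directional derivatives is the usual notion of being of class C^n.\<close>

primrec C_k_on :: "nat \<Rightarrow> ('a::euclidean_space \<Rightarrow> 'b::real_normed_vector) \<Rightarrow> 'a set \<Rightarrow> bool" where
  "C_k_on 0 f U \<longleftrightarrow> continuous_on U f"
| "C_k_on (Suc n) f U \<longleftrightarrow>
     (\<forall>x\<in>U. f differentiable (at x)) \<and>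
     (\<forall>v. C_k_on n (\<lambda>x. frechet_derivative f (at x) v) U)"

definition smooth :: "('a::euclidean_space \<Rightarrow> 'b::real_normed_vector) \<Rightarrow> bool" where
  "smooth f \<longleftrightarrow> (\<forall>n. C_k_on n f UNIV)"

text \<open>Maps on a subset \<open>S\<close> of a Euclidean space that need not be open (a submanifold, or an arbitrary
  subset of one) are of class C1 if near each point of \<open>S\<close> they are restrictions of
  C1 maps on open subsets of the ambient space. On submanifolds this agrees with the
  notion in local coordinates.\<close>

definition C1_on :: "('a::euclidean_space \<Rightarrow> 'b::real_normed_vector) \<Rightarrow> 'a set \<Rightarrow> bool" where
  "C1_on f S \<longleftrightarrow>
     (\<forall>x\<in>S. \<exists>U F. open U \<and> x \<in> U \<and> C_k_on 1 F U \<and> (\<forall>y\<in>S \<inter> U. F y = f y))"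

definition C1_diffeomorphism ::
    "('a::euclidean_space \<Rightarrow> 'b::euclidean_space) \<Rightarrow> 'a set \<Rightarrow> 'b set \<Rightarrow> bool" where
  "C1_diffeomorphism f S T \<longleftrightarrow>
     bij_betw f S T \<and> C1_on f S \<and> C1_on (inv_into S f) T"


section \<open>Measures\<close>

definition measure_preserving_on :: "'a measure \<Rightarrow> ('a \<Rightarrow> 'a) \<Rightarrow> 'a set \<Rightarrow> bool" where
  "measure_preserving_on \<mu> f S \<longleftrightarrow>
     S \<in> sets \<mu> \<and>
     f \<in> measurable (restrict_space \<mu> S) (restrict_space \<mu> S) \<and>
     (\<forall>E\<in>sets \<mu>. E \<subseteq> S \<longrightarrow> emeasure \<mu> (f -` E \<inter> S) = emeasure \<mu> E)"

definition spd :: "real^'d^'d \<Rightarrow> bool" where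
  "spd N \<longleftrightarrow> transpose N = N \<and> (\<forall>x. x \<noteq> 0 \<longrightarrow> 0 < x \<bullet> (N *v x))"

text \<open>In the next two definitions the first argument is the type \<open>'k\<close> whose cardinality is the
  dimension of the subspace or submanifold, and \<open>N\<close> is the Gram matrix of the ambient
  scalar product.

  The Lebesgue measure on a linear subspace \<open>W\<close> is the image of the Lebesgue measure under any
  linear isometry from the standard Euclidean space; the columns of \<open>E\<close> are a basis of \<open>W\<close> that is
  orthonormal for \<open>N\<close>, and the choice of that basis does not matter. It is regarded as a Borel
  measure on the ambient space, carried by \<open>W\<close>.\<close>

definition subspace_lebesgue ::
    "'k::finite itself \<Rightarrow> real^'d^'d \<Rightarrow> (real^'d) set \<Rightarrow> (real^'d) measure" where
  "subspace_lebesgue k N W =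
     (let E = (SOME E::real^'k^'d. transpose E ** N ** E = mat 1 \<and> range ((*v) E) = W)
      in distr lborel borel ((*v) E))"

definition local_parametrization ::
    "(real^'d) set \<Rightarrow> (real^'k) set \<Rightarrow> (real^'k \<Rightarrow> real^'d) \<Rightarrow> bool" where
  "local_parametrization S W \<phi> \<longleftrightarrow>
     open W \<and> C_k_on 1 \<phi> W \<and> (\<forall>x\<in>W. inj (frechet_derivative \<phi> (at x))) \<and>
     openin (top_of_set S) (\<phi> ` W) \<and> (\<exists>\<psi>. homeomorphism W (\<phi> ` W) \<phi> \<psi>)"

text \<open>The Riemannian measure of a submanifold \<open>S\<close>, for the metric induced by the scalar product
  \<open>N\<close>, is the unique Borel measure on \<open>S\<close> whose density in each local parametrization is the square
  root of the determinant of the metric tensor.\<close>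

definition riemannian_measure ::
    "'k::finite itself \<Rightarrow> real^'d^'d \<Rightarrow> (real^'d) set \<Rightarrow> (real^'d) measure" where
  "riemannian_measure k N S =
     (THE \<mu>. space \<mu> = S \<and> sets \<mu> = sets (restrict_space borel S) \<and>
        (\<forall>W (\<phi> :: real^'k \<Rightarrow> real^'d). local_parametrization S W \<phi> \<longrightarrow>
           (\<forall>E\<in>sets borel. E \<subseteq> W \<longrightarrow>
              emeasure \<mu> (\<phi> ` E) =
              (\<integral>\<^sup>+x\<in>E. ennreal (sqrt (det
                 (transpose (matrix (frechet_derivative \<phi> (at x))) ** N **
                  matrix (frechet_derivative \<phi> (at x))))) \<partial>lborel))))"


section \<open>The constraint manifold and its cotangent bundle\<close>

definition gradient :: "(real^'d \<Rightarrow> real) \<Rightarrow> real^'d \<Rightarrow> real^'d" where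
  "gradient f q = (\<chi> i. frechet_derivative f (at q) (axis i 1))"

definition grads :: "(real^'d \<Rightarrow> real^'m) \<Rightarrow> real^'d \<Rightarrow> real^'m^'d" where
  "grads \<xi> q = (\<chi> i j. gradient (\<lambda>x. \<xi> x $ j) q $ i)"

definition constraint_set :: "(real^'d \<Rightarrow> real^'m) \<Rightarrow> (real^'d) set" where
  "constraint_set \<xi> = {q. \<xi> q = 0}"

definition gram :: "real^'d^'d \<Rightarrow> (real^'d \<Rightarrow> real^'m) \<Rightarrow> real^'d \<Rightarrow> real^'m^'m" where
  "gram M \<xi> q = transpose (grads \<xi> q) ** matrix_inv M ** grads \<xi> q"

definition cotangent_space ::
    "real^'d^'d \<Rightarrow> (real^'d \<Rightarrow> real^'m) \<Rightarrow> real^'d \<Rightarrow> (real^'d) set" where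
  "cotangent_space M \<xi> q = {p. transpose (grads \<xi> q) *v (matrix_inv M *v p) = 0}"

definition cotangent_bundle ::
    "real^'d^'d \<Rightarrow> (real^'d \<Rightarrow> real^'m) \<Rightarrow> ((real^'d) \<times> (real^'d)) set" where
  "cotangent_bundle M \<xi> = {(q, p). q \<in> constraint_set \<xi> \<and> p \<in> cotangent_space M \<xi> q}"

definition liouville_measure ::
    "'k::finite itself \<Rightarrow> real^'d^'d \<Rightarrow> (real^'d \<Rightarrow> real^'m) \<Rightarrow> ((real^'d) \<times> (real^'d)) measure" where
  "liouville_measure k M \<xi> =
     measure_of (cotangent_bundle M \<xi>) (sets (restrict_space borel (cotangent_bundle M \<xi>)))
       (\<lambda>S. \<integral>\<^sup>+q. emeasure (subspace_lebesgue k (matrix_inv M) (cotangent_space M \<xi> q))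
                       {p. (q, p) \<in> S}
             \<partial>riemannian_measure k M (constraint_set \<xi>))"


section \<open>RATTLE with reverse projection check\<close>

text \<open>The functions below are total; \<open>\<Lambda>\<close> matters only on \<open>D\<close>, and \<open>rattle\<close> only on
  \<open>rattle_domain\<close>.\<close>

definition admissible_multiplier ::
    "real^'d^'d \<Rightarrow> (real^'d \<Rightarrow> real^'m) \<Rightarrow> ((real^'d) \<times> (real^'d)) set
      \<Rightarrow> ((real^'d) \<times> (real^'d) \<Rightarrow> real^'m) \<Rightarrow> bool" where
  "admissible_multiplier M \<xi> D \<Lambda> \<longleftrightarrow>
     openin (top_of_set (constraint_set \<xi> \<times> UNIV)) D \<and> C1_on \<Lambda> D \<and>
     (\<forall>(q, q')\<in>D.
        q' + matrix_inv M *v (grads \<xi> q *v \<Lambda> (q, q')) \<in> constraint_set \<xi> \<and>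
        invertible (transpose (grads \<xi> (q' + matrix_inv M *v (grads \<xi> q *v \<Lambda> (q, q'))))
                    ** matrix_inv M ** grads \<xi> q))"

definition free_step ::
    "real^'d^'d \<Rightarrow> (real^'d \<Rightarrow> real) \<Rightarrow> real \<Rightarrow> (real^'d) \<times> (real^'d) \<Rightarrow> real^'d" where
  "free_step M V dt = (\<lambda>(q, p). q + dt *\<^sub>R (matrix_inv M *v (p - (dt / 2) *\<^sub>R gradient V q)))"

definition rattle_domain ::
    "real^'d^'d \<Rightarrow> (real^'d \<Rightarrow> real^'m) \<Rightarrow> (real^'d \<Rightarrow> real) \<Rightarrow> ((real^'d) \<times> (real^'d)) set \<Rightarrow> real
      \<Rightarrow> ((real^'d) \<times> (real^'d)) set" where
  "rattle_domain M \<xi> V D dt =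
     {(q, p). (q, p) \<in> cotangent_bundle M \<xi> \<and> (q, free_step M V dt (q, p)) \<in> D}"

definition rattle_p_half ::
    "real^'d^'d \<Rightarrow> (real^'d \<Rightarrow> real^'m) \<Rightarrow> (real^'d \<Rightarrow> real)
      \<Rightarrow> ((real^'d) \<times> (real^'d) \<Rightarrow> real^'m) \<Rightarrow> real \<Rightarrow> (real^'d) \<times> (real^'d) \<Rightarrow> real^'d" where
  "rattle_p_half M \<xi> V \<Lambda> dt = (\<lambda>(q, p).
     let lhalf = (1 / dt) *\<^sub>R \<Lambda> (q, free_step M V dt (q, p))
     in p - (dt / 2) *\<^sub>R gradient V q + grads \<xi> q *v lhalf)"

definition rattle_q1 ::
    "real^'d^'d \<Rightarrow> (real^'d \<Rightarrow> real^'m) \<Rightarrow> (real^'d \<Rightarrow> real)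
      \<Rightarrow> ((real^'d) \<times> (real^'d) \<Rightarrow> real^'m) \<Rightarrow> real \<Rightarrow> (real^'d) \<times> (real^'d) \<Rightarrow> real^'d" where
  "rattle_q1 M \<xi> V \<Lambda> dt = (\<lambda>(q, p).
     q + dt *\<^sub>R (matrix_inv M *v rattle_p_half M \<xi> V \<Lambda> dt (q, p)))"

text \<open>The final momentum as a function of the candidate multiplier \<open>l\<close>.\<close>

definition rattle_p1 ::
    "real^'d^'d \<Rightarrow> (real^'d \<Rightarrow> real^'m) \<Rightarrow> (real^'d \<Rightarrow> real)
      \<Rightarrow> ((real^'d) \<times> (real^'d) \<Rightarrow> real^'m) \<Rightarrow> real \<Rightarrow> (real^'d) \<times> (real^'d) \<Rightarrow> real^'m \<Rightarrow> real^'d" where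
  "rattle_p1 M \<xi> V \<Lambda> dt x l =
     (let q1 = rattle_q1 M \<xi> V \<Lambda> dt x
      in rattle_p_half M \<xi> V \<Lambda> dt x - (dt / 2) *\<^sub>R gradient V q1 + grads \<xi> q1 *v l)"

definition rattle_multiplier ::
    "real^'d^'d \<Rightarrow> (real^'d \<Rightarrow> real^'m) \<Rightarrow> (real^'d \<Rightarrow> real)
      \<Rightarrow> ((real^'d) \<times> (real^'d) \<Rightarrow> real^'m) \<Rightarrow> real \<Rightarrow> (real^'d) \<times> (real^'d) \<Rightarrow> real^'m \<Rightarrow> bool" where
  "rattle_multiplier M \<xi> V \<Lambda> dt x l \<longleftrightarrow>
     transpose (grads \<xi> (rattle_q1 M \<xi> V \<Lambda> dt x)) *v
       (matrix_inv M *v rattle_p1 M \<xi> V \<Lambda> dt x l) = 0"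

definition rattle ::
    "real^'d^'d \<Rightarrow> (real^'d \<Rightarrow> real^'m) \<Rightarrow> (real^'d \<Rightarrow> real)
      \<Rightarrow> ((real^'d) \<times> (real^'d) \<Rightarrow> real^'m) \<Rightarrow> real \<Rightarrow> (real^'d) \<times> (real^'d) \<Rightarrow> (real^'d) \<times> (real^'d)" where
  "rattle M \<xi> V \<Lambda> dt x =
     (rattle_q1 M \<xi> V \<Lambda> dt x,
      - rattle_p1 M \<xi> V \<Lambda> dt x (THE l. rattle_multiplier M \<xi> V \<Lambda> dt x l))"

definition reversible_set ::
    "real^'d^'d \<Rightarrow> (real^'d \<Rightarrow> real^'m) \<Rightarrow> (real^'d \<Rightarrow> real) \<Rightarrow> ((real^'d) \<times> (real^'d)) set
      \<Rightarrow> ((real^'d) \<times> (real^'d) \<Rightarrow> real^'m) \<Rightarrow> real \<Rightarrow> ((real^'d) \<times> (real^'d)) set" where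
  "reversible_set M \<xi> V D \<Lambda> dt =
     {x \<in> rattle_domain M \<xi> V D dt.
        rattle M \<xi> V \<Lambda> dt x \<in> rattle_domain M \<xi> V D dt \<and>
        rattle M \<xi> V \<Lambda> dt (rattle M \<xi> V \<Lambda> dt x) = x}"

definition rattle_rev ::
    "real^'d^'d \<Rightarrow> (real^'d \<Rightarrow> real^'m) \<Rightarrow> (real^'d \<Rightarrow> real) \<Rightarrow> ((real^'d) \<times> (real^'d)) set
      \<Rightarrow> ((real^'d) \<times> (real^'d) \<Rightarrow> real^'m) \<Rightarrow> real \<Rightarrow> (real^'d) \<times> (real^'d) \<Rightarrow> (real^'d) \<times> (real^'d)" where
  "rattle_rev M \<xi> V D \<Lambda> dt x =
     (if x \<in> reversible_set M \<xi> V D \<Lambda> dt then rattle M \<xi> V \<Lambda> dt x else x)"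

end

theory Submission
  imports Defs
begin

text \<open>
RATTLE preserves the Liouville measure because it is symplectic. The proof below does not use the
symplectic form, though: it describes a point of phase space by two positions, as in discrete Lagrangian
mechanics.

If RATTLE takes \<open>(q, p)\<close> to the position \<open>q'\<close>, then \<open>p\<close> can be read off the two positions: it is
\<open>P(q, q')\<close>, the projection onto the cotangent space at \<open>q\<close>, along the columns of \<open>grads \<xi> q\<close>, of
\<open>(1 / dt) M (q' - q) + (dt / 2) grad V(q)\<close>. The Lagrange multiplier has disappeared, since the projection
removes it. By the symmetry of the scheme the outgoing momentum, with its sign reversed, is \<open>P(q', q)\<close>
(lemmas \<open>momentum_step\<close> and \<open>rattle_eq\<close>). So on the reversible set, where \<open>(q, p)\<close> is determined by \<open>(q, q')\<close> and
conversely, RATTLE is the exchange \<open>(q, q') \<mapsto> (q', q)\<close>.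

It remains to write the Liouville measure in these coordinates. At a fixed \<open>q\<close>, let \<open>F\<close> be a frame of the
cotangent space that is orthonormal for the scalar product given by the inverse of \<open>M\<close>. The coordinates of
\<open>P(q, q')\<close> in this frame do not see the projection and are an affine function of \<open>q'\<close> with linear part
\<open>(1 / dt) transpose F\<close>. The area formula for this function (lemma \<open>lborel_affine_image\<close>), integrated over \<open>q\<close>, shows
that a set of reversible points has as its measure the integral over the corresponding pairs of positions,
in charts \<open>\<phi>\<close> and \<open>\<psi>\<close> with respect to \<open>dx dy\<close>, of
\<open>\<bar>det ((1 / dt) transpose (D\<phi>(x)) M D\<psi>(y))\<bar>\<close> (lemma \<open>emeasure_position_pairs\<close>). Exchanging the two positions
transposes the matrix and leaves the density unchanged; Tonelli's theorem then gives invariance on the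
reversible set. On the complement the map is the identity.

The other claims follow from the same description. The map is an involution by construction, so its
inverse on each of the two parts is the map itself, and it is continuously differentiable because \<open>P\<close> and
the new position are.

The measures require the differential geometry of the constraint set. Charts come from the
inverse function theorem, and the Riemannian measure is defined by a uniqueness condition over all
charts: its existence is shown by gluing the densities of a countable atlas, with the change of variables
formula comparing any further chart with the atlas.
\<close>
section \<open>Change of variables for finite index types\<close>

text \<open>A copy of a finite type with the order of an enumeration. Neither the determinant nor the Lebesgue
measure on \<open>real^'k\<close> sees an order of the coordinates, so a statement about ordered index types
passes to all finite ones by renumbering the coordinates.\<close>
typedef ('k::finite) wo = "UNIV :: 'k set" by blast

instance wo :: (finite) finite
proof
  have "(UNIV :: 'a wo set) = range Abs_wo"
    by (metis Rep_wo_inverse surjI)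
  then show "finite (UNIV :: 'a wo set)" by (metis finite_imageI finite)
qed

instantiation wo :: (finite) wellorder
begin
definition less_eq_wo :: "'a wo \<Rightarrow> 'a wo \<Rightarrow> bool" where
  "x \<le> y \<longleftrightarrow> to_nat (Rep_wo x) \<le> to_nat (Rep_wo y)"
definition less_wo :: "'a wo \<Rightarrow> 'a wo \<Rightarrow> bool" where
  "x < y \<longleftrightarrow> to_nat (Rep_wo x) < to_nat (Rep_wo y)"
instance
proof
  fix P :: "'a wo \<Rightarrow> bool" and a :: "'a wo"
  assume *: "\<And>x. (\<And>y. y < x \<Longrightarrow> P y) \<Longrightarrow> P x"
  show "P a"
    by (induction "to_nat (Rep_wo a)" arbitrary: a rule: less_induct)
       (metis * less_wo_def)
qed (auto simp: less_eq_wo_def less_wo_def Rep_wo_inject)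
end

definition to_wo :: "real^'k \<Rightarrow> real^('k::finite wo)" where
  "to_wo x = (\<chi> i. x $ Rep_wo i)"
definition of_wo :: "real^('k::finite wo) \<Rightarrow> real^'k" where
  "of_wo x = (\<chi> i. x $ Abs_wo i)"

lemma of_to_wo [simp]: "of_wo (to_wo x) = x"
  by (simp add: of_wo_def to_wo_def vec_eq_iff Abs_wo_inverse)
lemma to_of_wo [simp]: "to_wo (of_wo x) = x"
  by (simp add: of_wo_def to_wo_def vec_eq_iff Rep_wo_inverse)
lemma linear_of_wo: "linear of_wo"
  by (auto intro!: linearI simp: of_wo_def vec_eq_iff)
lemma linear_to_wo: "linear to_wo"
  by (auto intro!: linearI simp: to_wo_def vec_eq_iff)
lemma bij_Abs_wo: "bij Abs_wo"
  by (metis Abs_wo_inverse Rep_wo_inverse UNIV_I bijI' )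
lemma bij_of_wo: "bij of_wo"
  by (metis of_to_wo to_of_wo bijI' )
lemma measurable_of_wo [measurable]: "of_wo \<in> borel_measurable borel"
  by (intro borel_measurable_continuous_onI linear_continuous_on linear_conv_bounded_linear[THEN iffD1] linear_of_wo)

lemma prod_Basis_vec: "(\<Prod>b\<in>(Basis::(real^'n) set). f b) = (\<Prod>i\<in>UNIV. f (axis i (1::real)))"
proof -
  have B: "(Basis::(real^'n) set) = range (\<lambda>i. axis i 1)" by (auto simp: Basis_vec_def)
  show ?thesis unfolding B
    by (subst prod.reindex) (auto simp: inj_on_def axis_eq_axis)
qed

lemma box_vec_iff: "x \<in> box l u \<longleftrightarrow> (\<forall>i. l $ i < x $ i \<and> x $ i < (u::real^'n) $ i)"
  by (auto simp: mem_box Basis_vec_def inner_axis)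

lemma distr_of_wo: "distr lborel borel (of_wo :: real^('k::finite wo) \<Rightarrow> real^'k) = lborel"
proof (rule lborel_eqI[symmetric])
  fix l u :: "real^'k" assume le: "\<And>b. b \<in> Basis \<Longrightarrow> l \<bullet> b \<le> u \<bullet> b"
  have le': "l $ i \<le> u $ i" for i
    using le[of "axis i 1"] by (simp add: inner_axis)
  have "of_wo -` box l u = box (to_wo l) (to_wo u)"
    by (auto simp: box_vec_iff of_wo_def to_wo_def) (metis Rep_wo_inverse Abs_wo_inverse UNIV_I)+
  then have "emeasure (distr lborel borel of_wo) (box l u) = emeasure lborel (box (to_wo l) (to_wo u))"
    by (subst emeasure_distr) auto
  also have "\<dots> = ennreal (\<Prod>b\<in>Basis. (to_wo u - to_wo l) \<bullet> b)"
    by (rule emeasure_lborel_box) (auto simp: Basis_vec_def inner_axis to_wo_def le')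
  also have "(\<Prod>b\<in>Basis. (to_wo u - to_wo l) \<bullet> b) = (\<Prod>i\<in>UNIV. u $ Rep_wo i - l $ Rep_wo i)"
    by (simp add: prod_Basis_vec inner_axis to_wo_def)
  also have "\<dots> = (\<Prod>i\<in>UNIV. u $ i - l $ i)"
    by (rule prod.reindex_bij_betw) (metis Rep_wo_inverse Abs_wo_inverse UNIV_I bijI')
  also have "\<dots> = (\<Prod>b\<in>Basis. (u - l) \<bullet> b)"
    by (simp add: prod_Basis_vec inner_axis)
  finally show "emeasure (distr lborel borel of_wo) (box l u) = (\<Prod>b\<in>Basis. (u - l) \<bullet> b)" .
qed simp

text \<open>Conjugation by the renumbering permutes the terms of the Leibniz formula and preserves signs.\<close>
lemma det_wo:
  fixes A :: "real^'k::finite^'k"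
  shows "det (\<chi> i j. A $ Rep_wo i $ Rep_wo j) = det A"
proof -
  let ?m = "map_permutation UNIV (Rep_wo :: 'k wo \<Rightarrow> 'k)"
  have bR: "bij (Rep_wo :: 'k wo \<Rightarrow> 'k)"
    by (metis Rep_wo_inverse Abs_wo_inverse UNIV_I bijI')
  have bA: "bij_betw (Abs_wo :: 'k \<Rightarrow> 'k wo) UNIV UNIV" by (rule bij_Abs_wo)
  have inj: "inj (Rep_wo :: 'k wo \<Rightarrow> 'k)" using bR by (simp add: bij_def)
  have bij: "bij_betw ?m {p. p permutes UNIV} {p. p permutes UNIV}"
    by (rule bij_betwI[where g="map_permutation UNIV Abs_wo"])
       (use bA bR in \<open>auto intro!: map_permutation_permutes map_permutation_compose_inv
           simp: Rep_wo_inverse Abs_wo_inverse\<close>)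
  have "det (\<chi> i j. A $ Rep_wo i $ Rep_wo j) =
      (\<Sum>p | p permutes (UNIV::'k wo set). of_int (sign p) * (\<Prod>i\<in>UNIV. A $ Rep_wo i $ Rep_wo (p i)))"
    by (simp add: det_def)
  also have "\<dots> = (\<Sum>p | p permutes (UNIV::'k wo set). of_int (sign (?m p)) * (\<Prod>i\<in>UNIV. A $ i $ (?m p) i))"
  proof (rule sum.cong[OF refl], clarify)
    fix p assume p: "p permutes (UNIV::'k wo set)"
    have "(\<Prod>i\<in>UNIV. A $ Rep_wo i $ Rep_wo (p i)) = (\<Prod>i\<in>UNIV. A $ Rep_wo i $ ?m p (Rep_wo i))"
      by (intro prod.cong refl) (simp add: map_permutation_apply inj)
    also have "\<dots> = (\<Prod>i\<in>UNIV. A $ i $ (?m p) i)"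
      by (rule prod.reindex_bij_betw[OF bR])
    finally show "of_int (sign p) * (\<Prod>i\<in>UNIV. A $ Rep_wo i $ Rep_wo (p i)) =
      of_int (sign (?m p)) * (\<Prod>i\<in>UNIV. A $ i $ (?m p) i)"
      by (simp add: sign_map_permutation[OF inj p])
  qed
  also have "\<dots> = (\<Sum>p | p permutes (UNIV::'k set). of_int (sign p) * (\<Prod>i\<in>UNIV. A $ i $ p i))"
    by (rule sum.reindex_bij_betw[OF bij])
  finally show ?thesis by (simp add: det_def)
qed

text \<open>For nonnegative functions integrability is finiteness of the integral, so an equivalence between
integrability of both sides also covers the case in which both integrals are infinite.\<close>
lemma nn_integral_change_of_variables_wellorder:
  fixes g :: "real^'n::{finite,wellorder} \<Rightarrow> real^'n::_" and f :: "real^'n::_ \<Rightarrow> real"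
  assumes S: "S \<in> sets lebesgue"
    and der_g: "\<And>x. x \<in> S \<Longrightarrow> (g has_derivative g' x) (at x within S)"
    and inj: "inj_on g S" and f0: "\<And>x. 0 \<le> f x"
    and F: "(\<lambda>x. indicator (g ` S) x * f x) \<in> borel_measurable borel"
    and G: "(\<lambda>x. indicator S x * (\<bar>det (matrix (g' x))\<bar> * f (g x))) \<in> borel_measurable borel"
  shows "(\<integral>\<^sup>+x. ennreal (indicator (g ` S) x * f x) \<partial>lborel) =
         (\<integral>\<^sup>+x. ennreal (indicator S x * (\<bar>det (matrix (g' x))\<bar> * f (g x))) \<partial>lborel)"
    (is "?l = ?r")
proof -
  define h where "h x = \<bar>det (matrix (g' x))\<bar> * f (g x)" for x
  have *: "h absolutely_integrable_on S \<and> integral S h = b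
     \<longleftrightarrow> f absolutely_integrable_on (g ` S) \<and> integral (g ` S) f = b" for b
    using has_absolute_integral_change_of_variables [OF S der_g inj, of "\<lambda>x. vec (f x) :: real^1" "vec b"]
    by (simp add: absolutely_integrable_on_1_iff integral_on_1_eq h_def[abs_def] o_def
       absolutely_integrable_on_def integrable_on_1_iff)
  have ii: "u absolutely_integrable_on T \<longleftrightarrow> (\<integral>\<^sup>+x. ennreal (indicator T x * u x) \<partial>lborel) < \<infinity>"
    if "(\<lambda>x. indicator T x * u x) \<in> borel_measurable borel" "\<And>x. 0 \<le> u x" for u :: "real^'n::_ \<Rightarrow> real" and T
  proof -
    have "integrable lebesgue (\<lambda>x. indicator T x * u x) \<longleftrightarrow> integrable lborel (\<lambda>x. indicator T x * u x)"
      by (rule integrable_completion) (use that in auto)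
    also have "\<dots> \<longleftrightarrow> (\<integral>\<^sup>+x. ennreal (indicator T x * u x) \<partial>lborel) < \<infinity>"
      using that by (simp add: integrable_iff_bounded)
    finally show ?thesis by (simp add: set_integrable_def)
  qed
  have vv: "(\<integral>\<^sup>+x. ennreal (indicator T x * u x) \<partial>lborel) = ennreal (integral T u)"
    if "(\<lambda>x. indicator T x * u x) \<in> borel_measurable borel" "\<And>x. 0 \<le> u x"
      "u absolutely_integrable_on T" for u :: "real^'n::_ \<Rightarrow> real" and T
  proof -
    have "integrable lborel (\<lambda>x. indicator T x * u x)"
      using that integrable_completion[of "\<lambda>x. indicator T x * u x" lborel] by (simp add: set_integrable_def)
    then have "(\<integral>\<^sup>+x. ennreal (indicator T x * u x) \<partial>lborel) = ennreal (integral\<^sup>L lborel (\<lambda>x. indicator T x * u x))"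
      by (rule nn_integral_eq_integral) (use that in auto)
    also have "integral\<^sup>L lborel (\<lambda>x. indicator T x * u x) = integral\<^sup>L lebesgue (\<lambda>x. indicator T x * u x)"
      by (rule integral_completion[symmetric]) (use that in auto)
    also have "\<dots> = integral T u"
      using set_lebesgue_integral_eq_integral(2)[OF that(3)] by (simp add: set_lebesgue_integral_def)
    finally show ?thesis .
  qed
  have h0: "0 \<le> h x" for x using f0 by (simp add: h_def)
  have G': "(\<lambda>x. indicator S x * h x) \<in> borel_measurable borel" using G by (simp add: h_def)
  show ?thesis
  proof (cases "f absolutely_integrable_on (g ` S)")
    case True
    with * have "h absolutely_integrable_on S" "integral S h = integral (g ` S) f" by blast+
    then show ?thesis using vv[OF F f0 True] vv[OF G' h0] unfolding h_def[symmetric] by simp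
  next
    case False
    with * have "\<not> h absolutely_integrable_on S" by blast
    then show ?thesis using False ii[OF F f0] ii[OF G' h0]
      by (simp add: h_def less_top[symmetric])
  qed
qed

text \<open>Measurability is asked of the two integrands rather than of the Jacobian. The derivatives \<open>g'\<close> can then be
chosen point by point, as they are for the transition maps between charts, where only the product of
Jacobian and volume density has a known continuous form.\<close>
lemma nn_integral_change_of_variables:
  fixes g :: "real^'k::finite \<Rightarrow> real^'k" and f :: "real^'k \<Rightarrow> real"
  assumes S: "S \<in> sets borel"
    and der_g: "\<And>x. x \<in> S \<Longrightarrow> (g has_derivative g' x) (at x within S)"
    and inj: "inj_on g S" and f0: "\<And>x. 0 \<le> f x"
    and F: "(\<lambda>x. indicator (g ` S) x * f x) \<in> borel_measurable borel"
    and G: "(\<lambda>x. indicator S x * (\<bar>det (matrix (g' x))\<bar> * f (g x))) \<in> borel_measurable borel"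
  shows "(\<integral>\<^sup>+x. ennreal (indicator (g ` S) x * f x) \<partial>lborel) =
         (\<integral>\<^sup>+x. ennreal (indicator S x * (\<bar>det (matrix (g' x))\<bar> * f (g x))) \<partial>lborel)"
proof -
  have tr: "(\<integral>\<^sup>+x. u x \<partial>lborel) = (\<integral>\<^sup>+x. u (of_wo x) \<partial>lborel)"
    if "u \<in> borel_measurable borel" for u :: "real^'k \<Rightarrow> ennreal"
    by (subst distr_of_wo[symmetric], subst nn_integral_distr) (use that in auto)
  let ?S = "of_wo -` S" let ?g = "\<lambda>x. to_wo (g (of_wo x))"
  let ?g' = "\<lambda>x v. to_wo (g' (of_wo x) (of_wo v))"
  have S': "?S \<in> sets borel"
    using measurable_sets[OF measurable_of_wo S] by simp
  have SS: "of_wo ` ?S = S" by (metis bij_of_wo bij_is_surj surj_image_vimage_eq)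
  have gS: "?g ` ?S = of_wo -` (g ` S)"
  proof -
    have "?g ` ?S = to_wo ` g ` S"
      using SS by (metis (no_types) image_image)
    also have "\<dots> = of_wo -` (g ` S)"
      by (auto, metis to_of_wo imageI)
    finally show ?thesis .
  qed
  have lm: "det (matrix (?g' x)) = det (matrix (g' (of_wo x)))" if "x \<in> ?S" for x
  proof -
    have lin: "linear (g' (of_wo x))" using der_g[of "of_wo x"] that
      by (auto dest: has_derivative_linear)
    have ax: "of_wo (axis i 1) = (axis (Rep_wo i) (1::real) :: real^'k)" for i
      by (auto simp: of_wo_def vec_eq_iff axis_def Abs_wo_inverse Rep_wo_inverse)
    have "matrix (?g' x) = (\<chi> i j. matrix (g' (of_wo x)) $ Rep_wo i $ Rep_wo j)"
      by (simp add: matrix_def vec_eq_iff ax to_wo_def)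
    then show ?thesis by (simp add: det_wo)
  qed
  have der: "(?g has_derivative ?g' x) (at x within ?S)" if "x \<in> ?S" for x
  proof -
    have 1: "(of_wo has_derivative of_wo) (at x within ?S)"
      by (rule bounded_linear_imp_has_derivative[OF linear_of_wo[unfolded linear_conv_bounded_linear]])
    have 2: "((\<lambda>x. g (of_wo x)) has_derivative (\<lambda>v. g' (of_wo x) (of_wo v))) (at x within ?S)"
      using has_derivative_in_compose[OF 1, of g "g' (of_wo x)"] der_g[of "of_wo x"] that SS by simp
    show ?thesis
      using has_derivative_in_compose[OF 2 bounded_linear_imp_has_derivative[OF linear_to_wo[unfolded linear_conv_bounded_linear]]] by simp
  qed
  have inj': "inj_on ?g ?S"
    using inj unfolding inj_on_def by (metis of_to_wo to_of_wo vimageE)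
  have ind: "indicator (?g ` ?S) x * f (of_wo x) = (indicator (g ` S) (of_wo x) * f (of_wo x) :: real)" for x
    unfolding gS by (simp add: indicator_def)
  have F': "(\<lambda>x. indicator (?g ` ?S) x * f (of_wo x)) \<in> borel_measurable borel"
    unfolding ind using measurable_compose[OF measurable_of_wo F] by simp
  have indG: "indicator ?S x * (\<bar>det (matrix (?g' x))\<bar> * f (of_wo (?g x))) =
     indicator S (of_wo x) * (\<bar>det (matrix (g' (of_wo x)))\<bar> * f (g (of_wo x)))" for x
    using lm[of x] by (simp add: indicator_def)
  have G': "(\<lambda>x. indicator ?S x * (\<bar>det (matrix (?g' x))\<bar> * f (of_wo (?g x)))) \<in> borel_measurable borel"
    unfolding indG using measurable_compose[OF measurable_of_wo G] by simp
  have "(\<integral>\<^sup>+x. ennreal (indicator (g ` S) x * f x) \<partial>lborel) =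
     (\<integral>\<^sup>+x. ennreal (indicator (?g ` ?S) x * f (of_wo x)) \<partial>lborel)"
    unfolding ind by (rule tr) (use F in measurable)
  also have "\<dots> = (\<integral>\<^sup>+x. ennreal (indicator ?S x * (\<bar>det (matrix (?g' x))\<bar> * f (of_wo (?g x)))) \<partial>lborel)"
    by (rule nn_integral_change_of_variables_wellorder) (use S' der inj' f0 F' G' in auto)
  also have "\<dots> = (\<integral>\<^sup>+x. ennreal (indicator S x * (\<bar>det (matrix (g' x))\<bar> * f (g x))) \<partial>lborel)"
    unfolding indG by (rule tr[symmetric]) (use G in measurable)
  finally show ?thesis .
qed

section \<open>Continuously differentiable maps\<close>

lemma C1_derivativeI:
  assumes "\<And>x. x \<in> U \<Longrightarrow> (f has_derivative f' x) (at x)" "\<And>v. continuous_on U (\<lambda>x. f' x v)"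
  shows "C_k_on 1 f U"
proof -
  have "frechet_derivative f (at x) = f' x" if "x \<in> U" for x
    using frechet_derivative_at[OF assms(1)[OF that]] by simp
  then show ?thesis using assms
    by (auto simp: differentiable_def cong: continuous_on_cong)
qed

text \<open>In finite dimension continuity of all directional derivatives is continuity of the derivative in the
operator norm. The operator form is what the chain rule and the inverse function theorem need; the
directional form is easier to establish.\<close>
lemma C1_blinfunE:
  assumes "C_k_on 1 f U"
  obtains f' where "\<And>x. x \<in> U \<Longrightarrow> (f has_derivative blinfun_apply (f' x)) (at x)" "continuous_on U f'"
proof
  let ?f' = "\<lambda>x. Blinfun (frechet_derivative f (at x))"
  have d: "(f has_derivative frechet_derivative f (at x)) (at x)" if "x \<in> U" for x
    using assms that by (auto simp: frechet_derivative_works[symmetric])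
  then have b: "blinfun_apply (?f' x) = frechet_derivative f (at x)" if "x \<in> U" for x
    using that by (intro bounded_linear_Blinfun_apply) (auto dest: has_derivative_bounded_linear)
  show "(f has_derivative blinfun_apply (?f' x)) (at x)" if "x \<in> U" for x
    using d b that by simp
  show "continuous_on U ?f'"
  proof (rule continuous_on_blinfun_componentwise)
    fix i :: 'a
    have "continuous_on U (\<lambda>x. frechet_derivative f (at x) i)" using assms by auto
    then show "continuous_on U (\<lambda>x. blinfun_apply (?f' x) i)"
      by (rule continuous_on_eq) (use b in auto)
  qed
qed

lemma C1_derivativeE:
  assumes "C_k_on 1 f U"
  obtains f' where "\<And>x. x \<in> U \<Longrightarrow> (f has_derivative f' x) (at x)" "\<And>v. continuous_on U (\<lambda>x. f' x v)"
proof -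
  from C1_blinfunE[OF assms] obtain f' where f': "\<And>x. x \<in> U \<Longrightarrow> (f has_derivative blinfun_apply (f' x)) (at x)"
    "continuous_on U f'" by blast
  show ?thesis by (rule that[of "\<lambda>x. blinfun_apply (f' x)"]) (use f' in \<open>auto intro!: continuous_intros\<close>)
qed

lemma C1_imp_continuous_on: "C_k_on 1 f U \<Longrightarrow> continuous_on U f"
  by (auto intro!: continuous_at_imp_continuous_on differentiable_imp_continuous_within)

lemma C1_subset: "C_k_on 1 f U \<Longrightarrow> V \<subseteq> U \<Longrightarrow> C_k_on 1 f V"
  by (auto intro: continuous_on_subset)

lemma C1_cong:
  assumes "C_k_on 1 f U" "open U" "\<And>x. x \<in> U \<Longrightarrow> g x = f x"
  shows "C_k_on 1 g U"
proof -
  from C1_derivativeE[OF assms(1)] obtain f' where f': "\<And>x. x \<in> U \<Longrightarrow> (f has_derivative f' x) (at x)"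
    "\<And>v. continuous_on U (\<lambda>x. f' x v)" by blast
  have "(g has_derivative f' x) (at x)" if "x \<in> U" for x
    using has_derivative_transform_within_open[OF f'(1)[OF that] assms(2) that] assms(3) by simp
  then show ?thesis by (rule C1_derivativeI[OF _ f'(2)])
qed

lemma C1_linear: "bounded_linear f \<Longrightarrow> C_k_on 1 f U"
  by (rule C1_derivativeI[of _ _ "\<lambda>_. f"]) (auto intro: bounded_linear_imp_has_derivative)

lemma C1_const: "C_k_on 1 (\<lambda>x. c) U"
  by (rule C1_derivativeI[of _ _ "\<lambda>_ _. 0"]) auto

lemma C1_add:
  assumes "C_k_on 1 f U" "C_k_on 1 g U" shows "C_k_on 1 (\<lambda>x. f x + g x) U"
proof -
  from C1_derivativeE[OF assms(1)] C1_derivativeE[OF assms(2)] obtain f' g' where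
    "\<And>x. x \<in> U \<Longrightarrow> (f has_derivative f' x) (at x)" "\<And>v. continuous_on U (\<lambda>x. f' x v)"
    "\<And>x. x \<in> U \<Longrightarrow> (g has_derivative g' x) (at x)" "\<And>v. continuous_on U (\<lambda>x. g' x v)" by metis
  then show ?thesis by (intro C1_derivativeI[of _ _ "\<lambda>x v. f' x v + g' x v"]) (auto intro!: derivative_intros continuous_intros)
qed

lemma C1_bilinear:
  assumes "bounded_bilinear b" "C_k_on 1 f U" "C_k_on 1 g U" shows "C_k_on 1 (\<lambda>x. b (f x) (g x)) U"
proof -
  from C1_derivativeE[OF assms(2)] C1_derivativeE[OF assms(3)] obtain f' g' where
    *: "\<And>x. x \<in> U \<Longrightarrow> (f has_derivative f' x) (at x)" "\<And>v. continuous_on U (\<lambda>x. f' x v)"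
    "\<And>x. x \<in> U \<Longrightarrow> (g has_derivative g' x) (at x)" "\<And>v. continuous_on U (\<lambda>x. g' x v)" by metis
  have "continuous_on U f" "continuous_on U g" using assms C1_imp_continuous_on by auto
  with * show ?thesis
    by (intro C1_derivativeI[of _ _ "\<lambda>x v. b (f x) (g' x v) + b (f' x v) (g x)"])
       (auto intro!: bounded_bilinear.FDERIV[OF assms(1)] bounded_bilinear.continuous_on[OF assms(1)] continuous_intros)
qed

lemma C1_compose:
  assumes "C_k_on 1 f U" "C_k_on 1 g V" "f ` U \<subseteq> V" shows "C_k_on 1 (\<lambda>x. g (f x)) U"
proof -
  from C1_blinfunE[OF assms(1)] obtain f' where
    f: "\<And>x. x \<in> U \<Longrightarrow> (f has_derivative blinfun_apply (f' x)) (at x)" "continuous_on U f'" by blast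
  from C1_blinfunE[OF assms(2)] obtain g' where
    g: "\<And>x. x \<in> V \<Longrightarrow> (g has_derivative blinfun_apply (g' x)) (at x)" "continuous_on V g'" by blast
  have c: "continuous_on U (\<lambda>x. g' (f x))"
    by (rule continuous_on_compose2[OF g(2) C1_imp_continuous_on[OF assms(1)] assms(3)])
  show ?thesis
  proof (rule C1_derivativeI[of _ _ "\<lambda>x v. g' (f x) (f' x v)"])
    show "((\<lambda>x. g (f x)) has_derivative (\<lambda>v. g' (f x) (f' x v))) (at x)" if "x \<in> U" for x
      using has_derivative_compose[OF f(1)[OF that] g(1)] assms(3) that by auto
  qed (intro continuous_intros c f)
qed

lemma C1_linear_compose:
  assumes "bounded_linear g" "C_k_on 1 f U" shows "C_k_on 1 (\<lambda>x. g (f x)) U"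
proof -
  from C1_derivativeE[OF assms(2)] obtain f' where f': "\<And>x. x \<in> U \<Longrightarrow> (f has_derivative f' x) (at x)"
    "\<And>v. continuous_on U (\<lambda>x. f' x v)" by blast
  show ?thesis
    by (rule C1_derivativeI, rule bounded_linear.has_derivative[OF assms(1) f'(1)], assumption)
       (rule bounded_linear.continuous_on[OF assms(1) f'(2)])
qed

lemma C1_Pair:
  assumes "C_k_on 1 f U" "C_k_on 1 g U" shows "C_k_on 1 (\<lambda>x. (f x, g x)) U"
proof -
  from C1_derivativeE[OF assms(1)] C1_derivativeE[OF assms(2)] obtain f' g' where
    "\<And>x. x \<in> U \<Longrightarrow> (f has_derivative f' x) (at x)" "\<And>v. continuous_on U (\<lambda>x. f' x v)"
    "\<And>x. x \<in> U \<Longrightarrow> (g has_derivative g' x) (at x)" "\<And>v. continuous_on U (\<lambda>x. g' x v)" by metis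
  then show ?thesis by (intro C1_derivativeI[of _ _ "\<lambda>x v. (f' x v, g' x v)"]) (auto intro!: has_derivative_Pair continuous_intros)
qed

lemma C1_scaleR_const: "C_k_on 1 f U \<Longrightarrow> C_k_on 1 (\<lambda>x. c *\<^sub>R f x) U"
  by (rule C1_linear_compose[OF bounded_linear_scaleR_right])
lemma C1_minus: "C_k_on 1 f U \<Longrightarrow> C_k_on 1 (\<lambda>x. - f x) U"
  by (rule C1_linear_compose[OF bounded_linear_minus[OF bounded_linear_ident]])
lemma C1_diff: "C_k_on 1 f U \<Longrightarrow> C_k_on 1 g U \<Longrightarrow> C_k_on 1 (\<lambda>x. f x - g x) U"
  using C1_add[OF _ C1_minus, of f U g] by simp

lemma C1_sum: "(\<And>i. i \<in> I \<Longrightarrow> C_k_on 1 (f i) U) \<Longrightarrow> C_k_on 1 (\<lambda>x. \<Sum>i\<in>I. f i x) U"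
proof (induction I rule: infinite_finite_induct)
  case (insert i I)
  show ?case unfolding sum.insert[OF insert(1,2)]
    by (rule C1_add) (use insert in \<open>blast+\<close>)
qed (simp_all only: sum.infinite sum.empty C1_const not_False_eq_True)

lemma C1_mult: "C_k_on 1 f U \<Longrightarrow> C_k_on 1 g U \<Longrightarrow> C_k_on 1 (\<lambda>x. f x * g x :: real) U"
  by (rule C1_bilinear[OF bounded_bilinear_mult])

lemma C1_prod: "(\<And>i. i \<in> I \<Longrightarrow> C_k_on 1 (f i) U) \<Longrightarrow> C_k_on 1 (\<lambda>x. \<Prod>i\<in>I. f i x :: real) U"
proof (induction I rule: infinite_finite_induct)
  case (insert i I)
  show ?case unfolding prod.insert[OF insert(1,2)]
    by (rule C1_mult) (use insert in \<open>blast+\<close>)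
qed (simp_all only: prod.infinite prod.empty C1_const not_False_eq_True)

lemma C1_inverse:
  assumes "C_k_on 1 f U" "\<And>x. x \<in> U \<Longrightarrow> f x \<noteq> (0::real)"
  shows "C_k_on 1 (\<lambda>x. inverse (f x)) U"
proof (rule C1_compose[OF assms(1), of _ "- {0}"])
  show "C_k_on 1 inverse (- {0::real})"
    by (rule C1_derivativeI[of _ _ "\<lambda>x v. - (inverse x * v * inverse x)"])
       (auto intro!: has_derivative_inverse' continuous_intros)
qed (use assms in auto)

lemma C1_vecI:
  assumes "\<And>i. C_k_on 1 (\<lambda>x. f x $ i) U" shows "C_k_on 1 (f :: _ \<Rightarrow> 'b::euclidean_space ^'n) U"
proof -
  have "bounded_linear (\<lambda>v::'b. axis i v :: 'b^'n)" for i
    by (rule linear_conv_bounded_linear[THEN iffD1]) (auto intro!: linearI simp: vec_eq_iff axis_def)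
  then have "C_k_on 1 (\<lambda>x. \<Sum>i\<in>UNIV. axis i (f x $ i)) U"
    by (intro C1_sum C1_linear_compose[of "axis _"] assms)
  moreover have "(\<Sum>i\<in>UNIV. axis i (f x $ i)) = f x" for x
    by (auto simp: vec_eq_iff axis_def)
  ultimately show ?thesis by simp
qed

lemma C1_nth: "C_k_on 1 f U \<Longrightarrow> C_k_on 1 (\<lambda>x. f x $ i) U"
  by (rule C1_linear_compose[OF bounded_linear_vec_nth])

lemma C1_det:
  fixes A :: "_ \<Rightarrow> real^'n^'n"
  shows "C_k_on 1 A U \<Longrightarrow> C_k_on 1 (\<lambda>x. det (A x)) U"
  unfolding det_def by (intro C1_sum C1_mult C1_const C1_prod C1_nth)

lemma C1_matrix_vector_mult:
  fixes A :: "_ \<Rightarrow> real^'n^'m"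
  assumes "C_k_on 1 A U" "C_k_on 1 b U" shows "C_k_on 1 (\<lambda>x. A x *v b x) U"
  by (rule C1_vecI) (auto simp only: matrix_vector_mult_def vec_lambda_beta intro!: C1_sum C1_mult C1_nth assms)

lemma C1_matrix_mult:
  fixes A :: "_ \<Rightarrow> real^'n^'m" and B :: "_ \<Rightarrow> real^'l^'n"
  assumes "C_k_on 1 A U" "C_k_on 1 B U" shows "C_k_on 1 (\<lambda>x. A x ** B x) U"
  by (rule C1_vecI, rule C1_vecI) (auto simp only: matrix_matrix_mult_def vec_lambda_beta intro!: C1_sum C1_mult C1_nth assms)

lemma C1_transpose:
  fixes A :: "_ \<Rightarrow> real^'n^'m"
  assumes "C_k_on 1 A U" shows "C_k_on 1 (\<lambda>x. transpose (A x)) U"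
  by (rule C1_vecI, rule C1_vecI) (auto simp only: transpose_def vec_lambda_beta intro!: C1_nth assms)

lemma matrix_inv_mult_right: "invertible A \<Longrightarrow> A ** matrix_inv A = mat 1"
  and matrix_inv_mult_left: "invertible A \<Longrightarrow> matrix_inv A ** A = mat 1"
  unfolding invertible_def matrix_inv_def by (metis (mono_tags, lifting) someI_ex)+

text \<open>Cramer's rule expresses the solution of a linear system by determinants, which are polynomials.\<close>
lemma C1_matrix_inv_vector:
  fixes A :: "_ \<Rightarrow> real^'n^'n"
  assumes "C_k_on 1 A U" "C_k_on 1 b U" "\<And>x. x \<in> U \<Longrightarrow> invertible (A x)" "open U"
  shows "C_k_on 1 (\<lambda>x. matrix_inv (A x) *v b x) U"
proof (rule C1_cong[OF _ \<open>open U\<close>])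
  show "C_k_on 1 (\<lambda>x. \<chi> k. det (\<chi> i j. if j = k then b x $ i else A x $ i $ j) * inverse (det (A x))) U"
  proof (rule C1_vecI, simp only: vec_lambda_beta, rule C1_mult, rule C1_det, rule C1_vecI, rule C1_vecI)
    fix k i j
    show "C_k_on 1 (\<lambda>x. (\<chi> i j. if j = k then b x $ i else A x $ i $ j) $ i $ j) U"
      by (cases "j = k") (simp_all only: vec_lambda_beta if_True if_False refl C1_nth assms)
  next
    show "C_k_on 1 (\<lambda>x. inverse (det (A x))) U"
      by (rule C1_inverse[OF C1_det[OF assms(1)]]) (use assms(3) in \<open>simp add: invertible_det_nz\<close>)
  qed
  fix x assume x: "x \<in> U"
  have "A x *v (matrix_inv (A x) *v b x) = b x"
    using matrix_inv_mult_right[OF assms(3)[OF x]] by (simp add: matrix_vector_mul_assoc)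
  then show "matrix_inv (A x) *v b x = (\<chi> k. det (\<chi> i j. if j = k then b x $ i else A x $ i $ j) * inverse (det (A x)))"
    using cramer[of "A x" "matrix_inv (A x) *v b x" "b x"] assms(3)[OF x]
    by (simp add: invertible_det_nz divide_inverse)
qed

section \<open>Orthonormal frames of a scalar product\<close>

lemma spd_inner_commute: "spd N \<Longrightarrow> x \<bullet> (N *v y) = y \<bullet> (N *v x)"
  by (metis spd_def dot_lmul_matrix transpose_matrix_vector inner_commute)

lemma spd_invertible: assumes "spd N" shows "invertible N"
proof -
  have "x = 0" if "N *v x = 0" for x
    using assms that unfolding spd_def by (metis inner_zero_right less_irrefl)
  then show ?thesis by (metis invertible_left_inverse matrix_left_invertible_ker)
qed

lemma spd_matrix_inv: assumes "spd N" shows "spd (matrix_inv N)"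
proof -
  note inv = spd_invertible[OF assms]
  let ?I = "matrix_inv N"
  have t: "transpose ?I = ?I"
  proof -
    have "transpose ?I ** N = mat 1"
      using matrix_inv_mult_right[OF inv] assms
      by (metis matrix_transpose_mul spd_def transpose_mat)
    then have "transpose ?I ** (N ** ?I) = ?I" by (simp add: matrix_mul_assoc)
    then show ?thesis using matrix_inv_mult_right[OF inv] by simp
  qed
  have "0 < x \<bullet> (?I *v x)" if "x \<noteq> 0" for x
  proof -
    have x: "N *v (?I *v x) = x"
      by (simp add: matrix_vector_mul_assoc matrix_inv_mult_right[OF inv])
    then have "?I *v x \<noteq> 0" using that by auto
    then have "0 < (?I *v x) \<bullet> (N *v (?I *v x))" using assms by (simp add: spd_def)
    then show ?thesis by (simp add: x inner_commute)
  qed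
  with t show ?thesis by (simp add: spd_def)
qed

text \<open>Normalise one vector and continue in its orthogonal complement inside \<open>W\<close>, whose dimension is smaller
by one.\<close>
lemma orthonormal_family_exists:
  assumes "spd N" "subspace W" "dim W = n"
  shows "\<exists>B\<subseteq>W. finite B \<and> card B = n \<and> (\<forall>x\<in>B. \<forall>y\<in>B. x \<bullet> (N *v y) = (if x = y then 1 else 0))"
  using assms(2,3)
proof (induction n arbitrary: W)
  case 0
  then show ?case by (intro exI[of _ "{}"]) auto
next
  case (Suc n)
  have "W \<noteq> {0}" using Suc.prems by auto
  then obtain w0 where w0: "w0 \<in> W" "w0 \<noteq> 0" using subspace_0[OF Suc.prems(1)] by blast
  define c where "c = w0 \<bullet> (N *v w0)"
  have c: "c > 0" using assms(1) w0 by (simp add: c_def spd_def)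
  define w where "w = (1 / sqrt c) *\<^sub>R w0"
  have w: "w \<in> W" "w \<bullet> (N *v w) = 1"
    using w0 c Suc.prems(1)
    by (auto simp: w_def subspace_scale matrix_vector_mult_scaleR c_def[symmetric] field_simps)
  define W' where "W' = {x \<in> W. x \<bullet> (N *v w) = 0}"
  have sub: "subspace W'" using Suc.prems(1)
    by (auto simp: W'_def subspace_def inner_left_distrib)
  have "w \<notin> W'" using w by (simp add: W'_def)
  have "x \<in> span (insert w W')" if "x \<in> W" for x
  proof -
    have "x - (x \<bullet> (N *v w)) *\<^sub>R w \<in> W'"
      using that w Suc.prems(1) by (auto simp: W'_def subspace_diff subspace_scale inner_diff_left)
    then show ?thesis unfolding span_insert by (auto intro: span_base)
  qed
  then have "span (insert w W') = W"
    using span_minimal[of "insert w W'" W] w(1) Suc.prems(1) by (auto simp: W'_def)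
  then have "dim (insert w W') = Suc n" using Suc.prems(2) by (metis dim_span)
  then have "dim W' = n" using \<open>w \<notin> W'\<close> sub by (simp add: dim_insert span_eq_iff[THEN iffD2])
  from Suc.IH[OF sub this] obtain B where B: "B \<subseteq> W'" "finite B" "card B = n"
    "\<forall>x\<in>B. \<forall>y\<in>B. x \<bullet> (N *v y) = (if x = y then 1 else 0)" by blast
  have "w \<notin> B" using \<open>w \<notin> W'\<close> B by auto
  have 0: "x \<bullet> (N *v w) = 0" "w \<bullet> (N *v x) = 0" "x \<noteq> w" if "x \<in> B" for x
    using that B(1) \<open>w \<notin> B\<close> spd_inner_commute[OF assms(1), of w x] by (auto simp: W'_def)
  show ?case
    by (rule exI[of _ "insert w B"])
       (use B \<open>w \<notin> B\<close> w 0 in \<open>auto simp: W'_def\<close>)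
qed

lemma transpose_mult_entry:
  "(transpose E ** N ** E) $ i $ j = column i E \<bullet> (N *v column j (E::real^'k^'d))"
proof -
  have "(transpose E ** N ** E) $ i $ j = (transpose E ** (N ** E)) $ i $ j"
    by (simp add: matrix_mul_assoc)
  also have "\<dots> = column i E \<bullet> column j (N ** E)"
    by (simp add: matrix_matrix_mult_def transpose_def column_def inner_vec_def)
  also have "column j (N ** E) = N *v column j E"
    by (simp add: vec_eq_iff column_def matrix_matrix_mult_def matrix_vector_mult_def)
  finally show ?thesis .
qed

lemma orthonormal_frame_exists:
  fixes N :: "real^'d^'d"
  assumes "spd N" "subspace W" "dim W = CARD('k::finite)"
  shows "\<exists>E::real^'k^'d. transpose E ** N ** E = mat 1 \<and> range ((*v) E) = W"
proof -
  obtain B where B: "B \<subseteq> W" "finite B" "card B = CARD('k)"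
    "\<And>x y. x\<in>B \<Longrightarrow> y\<in>B \<Longrightarrow> x \<bullet> (N *v y) = (if x = y then 1 else 0)"
    using orthonormal_family_exists[OF assms] by blast
  obtain e where e: "bij_betw e (UNIV::'k set) B"
    using finite_same_card_bij[of "UNIV::'k set" B] B by auto
  define E :: "real^'k^'d" where "E = (\<chi> i j. e j $ i)"
  have col: "column j E = e j" for j by (simp add: E_def column_def vec_eq_iff)
  have eB: "e j \<in> B" for j using e by (auto simp: bij_betw_def)
  have ei: "e i = e j \<longleftrightarrow> i = j" for i j using e by (auto simp: bij_betw_def inj_on_def)
  have EE: "transpose E ** N ** E = mat 1"
  proof -
    have "(transpose E ** N ** E) $ i $ j = mat 1 $ i $ j" for i j
      unfolding transpose_mult_entry by (simp add: col B(4)[OF eB eB] ei mat_def)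
    then show ?thesis by (simp add: vec_eq_iff)
  qed
  have inj: "inj ((*v) E)"
    by (rule inj_on_inverseI[of _ "(*v) (transpose E ** N)"]) (simp add: matrix_vector_mul_assoc EE)
  have "E *v y = (\<Sum>j\<in>UNIV. y $ j *\<^sub>R e j)" for y
    by (simp add: matrix_mult_sum col scalar_mult_eq_scaleR)
  then have sub: "range ((*v) E) \<subseteq> W"
    using B(1) eB assms(2) by (auto intro!: subspace_sum subspace_scale)
  have "dim (range ((*v) E)) = dim (UNIV :: (real^'k) set)"
    by (rule dim_image_eq) (use inj in auto)
  then have "dim (range ((*v) E)) = dim W" using assms(3) by simp
  then have "range ((*v) E) = W"
    using sub assms(2) by (intro subspace_dim_equal) (auto intro: linear_subspace_image)
  with EE show ?thesis by blast
qed

text \<open>The cotangent space is the Euclidean orthogonal complement of the range of \<open>matrix_inv M ** grads \<xi> q\<close>,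
and invertibility of the Gram matrix makes that matrix injective.\<close>
lemma cotangent_space_dim:
  fixes M :: "real^'d^'d" and \<xi> :: "real^'d \<Rightarrow> real^'m"
  assumes "spd M" "invertible (gram M \<xi> q)"
  shows "dim (cotangent_space M \<xi> q) = CARD('d) - CARD('m)" "subspace (cotangent_space M \<xi> q)"
proof -
  let ?R = "range ((*v) (matrix_inv M ** grads \<xi> q))"
  note inv = spd_matrix_inv[OF assms(1)]
  have eq: "cotangent_space M \<xi> q = {p \<in> UNIV. \<forall>x\<in>?R. orthogonal x p}"
  proof -
    have "transpose (grads \<xi> q) *v (matrix_inv M *v p) = 0 \<longleftrightarrow> (\<forall>x\<in>?R. orthogonal x p)" for p
    proof -
      have "(matrix_inv M ** grads \<xi> q *v y) \<bullet> p = y \<bullet> (transpose (grads \<xi> q) *v (matrix_inv M *v p))" for y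
        by (metis dot_lmul_matrix inner_commute inv matrix_vector_mul_assoc spd_def transpose_matrix_vector)
      then show ?thesis by (simp add: orthogonal_def) (metis inner_eq_zero_iff inner_zero_right)
    qed
    then show ?thesis by (auto simp: cotangent_space_def)
  qed
  have sR: "subspace ?R" by (auto intro: linear_subspace_image)
  have "inj ((*v) (matrix_inv M ** grads \<xi> q))"
  proof (rule inj_on_inverseI)
    show "(matrix_inv (gram M \<xi> q) ** transpose (grads \<xi> q)) *v (matrix_inv M ** grads \<xi> q *v x) = x" for x
      using matrix_inv_mult_left[OF assms(2)]
      by (simp add: matrix_vector_mul_assoc gram_def matrix_mul_assoc)
  qed
  then have "dim ?R = CARD('m)"
    using dim_image_eq[of "(*v) (matrix_inv M ** grads \<xi> q)" UNIV] by simp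
  moreover have "dim (cotangent_space M \<xi> q) + dim ?R = CARD('d)"
    unfolding eq using dim_subspace_orthogonal_to_vectors[OF sR subspace_UNIV] by simp
  ultimately show "dim (cotangent_space M \<xi> q) = CARD('d) - CARD('m)" by simp
  show "subspace (cotangent_space M \<xi> q)"
    unfolding cotangent_space_def
    by (auto simp: subspace_def matrix_vector_right_distrib matrix_vector_mult_scaleR simp del: transpose_matrix_vector)
qed

section \<open>Charts of the constraint manifold\<close>

lemma smooth_C1: "smooth f \<Longrightarrow> C_k_on 1 f U"
  by (metis smooth_def C1_subset subset_UNIV)

lemma smooth_C1_derivative:
  assumes "smooth f" shows "C_k_on 1 (\<lambda>x. frechet_derivative f (at x) v) U"
proof -
  have "C_k_on (Suc 1) f UNIV" using assms by (simp only: smooth_def)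
  then have "C_k_on 1 (\<lambda>x. frechet_derivative f (at x) v) UNIV" by (metis C_k_on.simps(2))
  then show ?thesis using C1_subset by blast
qed

lemma smooth_has_derivative: "smooth f \<Longrightarrow> (f has_derivative frechet_derivative f (at x)) (at x)"
  using smooth_C1[of f UNIV] by (auto simp: frechet_derivative_works[symmetric])

lemma frechet_derivative_nth:
  assumes "smooth \<xi>" shows "frechet_derivative (\<lambda>x. \<xi> x $ j) (at q) v = frechet_derivative \<xi> (at q) v $ j"
proof -
  have "((\<lambda>x. \<xi> x $ j) has_derivative (\<lambda>v. frechet_derivative \<xi> (at q) v $ j)) (at q)"
    by (rule bounded_linear.has_derivative[OF bounded_linear_vec_nth smooth_has_derivative[OF assms]])
  from frechet_derivative_at[OF this] show ?thesis by metis
qed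

lemma grads_derivative:
  fixes \<xi> :: "real^'d \<Rightarrow> real^'m"
  assumes "smooth \<xi>"
  shows "(\<xi> has_derivative (\<lambda>v. transpose (grads \<xi> q) *v v)) (at q)"
proof -
  note d = smooth_has_derivative[OF assms, of q]
  have "transpose (grads \<xi> q) = matrix (frechet_derivative \<xi> (at q))"
    by (simp add: transpose_def grads_def gradient_def matrix_def frechet_derivative_nth[OF assms])
  then have "frechet_derivative \<xi> (at q) = (\<lambda>v. transpose (grads \<xi> q) *v v)"
    using matrix_vector_mul(2)[OF has_derivative_linear[OF d]] by simp
  with d show ?thesis by metis
qed

lemma C1_grads:
  assumes "smooth \<xi>" shows "C_k_on 1 (grads \<xi>) U"
  by (rule C1_vecI, rule C1_vecI)
     (simp only: grads_def gradient_def vec_lambda_beta frechet_derivative_nth[OF assms],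
      rule C1_nth, rule smooth_C1_derivative[OF assms])

lemma C1_gradient:
  assumes "smooth V" shows "C_k_on 1 (gradient V) U"
  by (rule C1_vecI) (simp only: gradient_def vec_lambda_beta, rule smooth_C1_derivative[OF assms])

lemma open_invertible: "open {A::real^'n^'n. invertible A}"
proof -
  have "continuous_on UNIV (\<lambda>A::real^'n^'n. det A)"
    by (rule C1_imp_continuous_on[OF C1_det[OF C1_linear[OF bounded_linear_ident]]])
  then show ?thesis unfolding invertible_det_nz by (intro open_Collect_neq) (auto intro: continuous_intros)
qed

lemma continuous_on_matrix_inv_vector:
  fixes A :: "_ \<Rightarrow> real^'n^'n"
  assumes "continuous_on X A" "\<And>x. x \<in> X \<Longrightarrow> invertible (A x)"
  shows "continuous_on X (\<lambda>x. matrix_inv (A x) *v b)"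
proof (rule continuous_on_compose2[OF _ assms(1)])
  have "C_k_on 1 (\<lambda>A::real^'n^'n. matrix_inv A *v b) {A. invertible A}"
  proof (rule C1_matrix_inv_vector)
    show "C_k_on 1 (\<lambda>A::real^'n^'n. A) {A. invertible A}" by (rule C1_linear[OF bounded_linear_ident])
    show "C_k_on 1 (\<lambda>A::real^'n^'n. b) {A. invertible A}" by (rule C1_const)
  qed (simp_all add: open_invertible)
  then show "continuous_on {A. invertible A} (\<lambda>A::real^'n^'n. matrix_inv A *v b)" by (rule C1_imp_continuous_on)
qed (use assms in auto)

text \<open>The implicit function theorem in the form that produces a chart: with a frame \<open>E\<close> of the tangent space at
\<open>q0\<close>, a left inverse \<open>L\<close> of \<open>E\<close> and a complementary frame \<open>N\<close>, the map \<open>H q = E (L (q - q0)) + N (\<xi> q)\<close> is a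
local diffeomorphism which sends the constraint set to the range of \<open>E\<close>. The chart is the local inverse of
\<open>H\<close> on that range, and its inverse is the restriction of the affine map \<open>\<lambda>q. L (q - q0)\<close>.\<close>
lemma constraint_chart_exists:
  fixes M :: "real^'d^'d" and \<xi> :: "real^'d \<Rightarrow> real^'m"
  assumes "spd M" "smooth \<xi>" and q0: "q0 \<in> constraint_set \<xi>" and gi: "invertible (gram M \<xi> q0)"
    and k: "CARD('k::finite) = CARD('d) - CARD('m)"
  shows "\<exists>W (\<phi> :: real^'k \<Rightarrow> real^'d). local_parametrization (constraint_set \<xi>) W \<phi> \<and> q0 \<in> \<phi> ` W"
proof -
  let ?Mi = "matrix_inv M"
  have spdi: "spd ?Mi" by (rule spd_matrix_inv[OF assms(1)])
  then have tMi: "transpose ?Mi = ?Mi" by (simp add: spd_def)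
  have MMi: "M ** ?Mi = mat 1" "?Mi ** M = mat 1"
    using spd_invertible[OF assms(1)] by (simp_all add: matrix_inv_mult_right matrix_inv_mult_left)
  obtain E0 :: "real^'k^'d" where E0: "transpose E0 ** ?Mi ** E0 = mat 1" "range ((*v) E0) = cotangent_space M \<xi> q0"
    using orthonormal_frame_exists[OF spdi cotangent_space_dim(2)[OF assms(1) gi]]
      cotangent_space_dim(1)[OF assms(1) gi] k by metis
  define G where "G = grads \<xi> q0"
  define N where "N = ?Mi ** G"
  define E where "E = ?Mi ** E0"
  define L where "L = transpose E0"
  \<comment> \<open>The rows of \<open>L\<close> and \<open>transpose G\<close> separate the two summands of \<open>H\<close>: each annihilates one of \<open>E\<close> and \<open>N\<close> and is invertible on the other.\<close>
  have LE: "L ** E = mat 1" using E0(1) by (simp add: L_def E_def matrix_mul_assoc)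
  have GN: "transpose G ** N = gram M \<xi> q0" by (simp add: G_def N_def gram_def matrix_mul_assoc)
  have GE: "transpose G ** E = 0"
  proof -
    have "transpose G *v (?Mi *v (E0 *v y)) = 0" for y
      using E0(2) by (auto simp: cotangent_space_def G_def simp del: transpose_matrix_vector)
    then have "(transpose G ** E) *v y = 0 *v y" for y
      by (simp add: E_def matrix_vector_mul_assoc[symmetric] del: transpose_matrix_vector)
    then show ?thesis using matrix_eq by blast
  qed
  have LN: "L ** N = 0"
  proof -
    have "transpose (L ** N) = transpose G ** E"
      by (simp add: L_def N_def E_def matrix_transpose_mul tMi matrix_mul_assoc)
    then have "transpose (transpose (L ** N)) = transpose 0" using GE by simp
    then show ?thesis by (simp add: vec_eq_iff transpose_def)
  qed
  define H where "H q = E *v (L *v (q - q0)) + N *v \<xi> q" for q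
  define J where "J q = E ** L + N ** transpose (grads \<xi> q)" for q
  have HJ: "(H has_derivative (*v) (J q)) (at q)" for q
  proof -
    have "(H has_derivative (\<lambda>v. E *v (L *v v) + N *v (transpose (grads \<xi> q) *v v))) (at q)"
      unfolding H_def
      by (rule has_derivative_add; rule bounded_linear.has_derivative[OF matrix_vector_mul_bounded_linear])
         (auto intro!: derivative_eq_intros grads_derivative[OF assms(2)] bounded_linear.has_derivative[OF matrix_vector_mul_bounded_linear] simp del: transpose_matrix_vector)
    moreover have "(\<lambda>v. E *v (L *v v) + N *v (transpose (grads \<xi> q) *v v)) = (*v) (J q)"
      by (simp add: fun_eq_iff J_def matrix_vector_mult_add_rdistrib matrix_vector_mul_assoc del: transpose_matrix_vector)
    ultimately show ?thesis by simp
  qed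
  have Jc1: "C_k_on 1 J UNIV"
    unfolding J_def by (intro C1_add C1_const C1_matrix_mult C1_transpose C1_grads assms)
  have Jcont: "continuous_on UNIV J" by (rule C1_imp_continuous_on[OF Jc1])
  have HC1: "C_k_on 1 H UNIV"
    by (rule C1_derivativeI[OF HJ]) (rule C1_imp_continuous_on[OF C1_matrix_vector_mult[OF Jc1 C1_const]])
  from C1_blinfunE[OF HC1] obtain f' where f': "\<And>x. (H has_derivative blinfun_apply (f' x)) (at x)" "continuous_on UNIV f'"
    by (metis UNIV_I)
  have f'J: "blinfun_apply (f' x) = (*v) (J x)" for x
    by (rule has_derivative_unique[OF f'(1) HJ])
  have Ginj: "z = 0" if "transpose G *v (N *v z) = 0" for z
    using that gi matrix_inv_mult_left[OF gi] GN
    by (metis matrix_vector_mul_assoc matrix_vector_mul_lid matrix_vector_mult_0_right)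
  have inj0: "v = 0" if v: "J q0 *v v = 0" for v
  proof -
    have 1: "E *v (L *v v) + N *v (transpose G *v v) = 0"
      using v by (simp add: J_def G_def matrix_vector_mult_add_rdistrib matrix_vector_mul_assoc del: transpose_matrix_vector)
    have "transpose G *v (E *v (L *v v)) = 0"
      by (metis GE matrix_vector_mul_assoc matrix_vector_mult_0)
    then have "transpose G *v (N *v (transpose G *v v)) = 0"
      using 1 by (metis add_0 matrix_vector_right_distrib matrix_vector_mult_0_right)
    then have Gv: "transpose G *v v = 0" by (rule Ginj)
    then have "E *v (L *v v) = 0" using 1 by (simp del: transpose_matrix_vector)
    then have Lv: "L *v v = 0" by (metis LE matrix_vector_mul_assoc matrix_vector_mul_lid matrix_vector_mult_0_right)
    have "M *v v \<in> range ((*v) E0)"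
    proof -
      have "?Mi *v (M *v v) = v" by (simp add: matrix_vector_mul_assoc MMi)
      then show ?thesis unfolding E0(2) cotangent_space_def using Gv
        by (simp add: G_def del: transpose_matrix_vector)
    qed
    then obtain y where "M *v v = E0 *v y" by blast
    then have "v = E *v y" by (metis E_def MMi(2) matrix_vector_mul_assoc matrix_vector_mul_lid)
    then show "v = 0" using Lv LE by (metis matrix_vector_mul_assoc matrix_vector_mul_lid matrix_vector_mult_0_right)
  qed
  then have "invertible (J q0)" by (metis invertible_left_inverse matrix_left_invertible_ker)
  then have "Blinfun ((*v) (matrix_inv (J q0))) o\<^sub>L f' q0 = id_blinfun"
    by (intro blinfun_eqI) (simp add: bounded_linear_Blinfun_apply f'J matrix_vector_mul_assoc matrix_inv_mult_left)
  then obtain U' V g g' where UV: "open U'" "q0 \<in> U'" "open V" "H q0 \<in> V" "homeomorphism U' V H g"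
    and g: "\<And>y. y \<in> V \<Longrightarrow> (g has_derivative (g' y)) (at y)" "\<And>y. y \<in> V \<Longrightarrow> g' y = inv (blinfun_apply (f'(g y)))"
    "\<And>y. y \<in> V \<Longrightarrow> bij (blinfun_apply (f'(g y)))"
    by (rule inverse_function_theorem[OF open_UNIV f'(1) f'(2) UNIV_I]) (rule that; assumption)
  have Ji: "invertible (J (g y))" if "y \<in> V" for y
    using g(3)[OF that] unfolding f'J by (simp add: invertible_eq_bij)
  have g': "g' y = (*v) (matrix_inv (J (g y)))" if "y \<in> V" for y
    unfolding g(2)[OF that] f'J
    by (rule inv_equality) (simp_all add: matrix_vector_mul_assoc matrix_inv_mult_left matrix_inv_mult_right Ji[OF that])
  define \<phi> where "\<phi> x = g (E *v x)" for x
  define W where "W = {x. E *v x \<in> V}"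
  have oW: "open W" unfolding W_def
    by (rule open_vimage[OF UV(3), unfolded vimage_def]) (intro linear_continuous_on matrix_vector_mul_bounded_linear)
  have gV: "g y \<in> U'" "H (g y) = y" if "y \<in> V" for y using UV(5) that by (auto simp: homeomorphism_def)
  have gU: "H q \<in> V" "g (H q) = q" if "q \<in> U'" for q using UV(5) that by (auto simp: homeomorphism_def)
  have der: "(\<phi> has_derivative (\<lambda>v. matrix_inv (J (\<phi> x)) *v (E *v v))) (at x)" if "x \<in> W" for x
  proof -
    have "((\<lambda>x. g (E *v x)) has_derivative (\<lambda>v. g' (E *v x) (E *v v))) (at x)"
      by (rule has_derivative_compose[OF bounded_linear_imp_has_derivative[OF matrix_vector_mul_bounded_linear]])
         (use g(1) that in \<open>simp add: W_def\<close>)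
    then show ?thesis using g' that by (simp add: \<phi>_def[abs_def] W_def)
  qed
  have cphi: "continuous_on W \<phi>"
    using der by (meson continuous_at_imp_continuous_on has_derivative_continuous)
  have Jphi: "invertible (J (\<phi> x))" if "x \<in> W" for x using that Ji by (simp add: W_def \<phi>_def)
  have C1: "C_k_on 1 \<phi> W"
  proof (rule C1_derivativeI[OF der])
    show "continuous_on W (\<lambda>x. matrix_inv (J (\<phi> x)) *v (E *v v))" for v
      by (rule continuous_on_matrix_inv_vector)
         (auto intro: continuous_on_compose2[OF Jcont cphi] Jphi)
  qed
  have injd: "inj (frechet_derivative \<phi> (at x))" if x: "x \<in> W" for x
  proof -
    have "frechet_derivative \<phi> (at x) = (\<lambda>v. matrix_inv (J (\<phi> x)) *v (E *v v))"
      using frechet_derivative_at[OF der[OF x]] by simp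
    moreover have "L *v (J (\<phi> x) *v (matrix_inv (J (\<phi> x)) *v (E *v v))) = v" for v
      by (simp add: matrix_vector_mul_assoc matrix_mul_assoc[symmetric] matrix_inv_mult_right[OF Jphi[OF x]] LE)
         (simp add: matrix_mul_assoc matrix_inv_mult_right[OF Jphi[OF x]] LE)
    ultimately show ?thesis by (metis (mono_tags, lifting) injI)
  qed
  \<comment> \<open>Applying \<open>transpose G\<close> to \<open>H (\<phi> x) = E x\<close> isolates \<open>\<xi> (\<phi> x)\<close>, applying \<open>L\<close> isolates \<open>x\<close>.\<close>
  have x1: "\<xi> (\<phi> x) = 0" "L *v (\<phi> x - q0) = x" if x: "x \<in> W" for x
  proof -
    have H: "E *v (L *v (\<phi> x - q0)) + N *v \<xi> (\<phi> x) = E *v x"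
      using gV(2)[of "E *v x"] x by (simp add: W_def \<phi>_def H_def)
    have "transpose G *v (E *v y) = 0" for y
      by (metis GE matrix_vector_mul_assoc matrix_vector_mult_0)
    then have "transpose G *v (N *v \<xi> (\<phi> x)) = 0"
      using arg_cong[OF H, of "(*v) (transpose G)"] by (simp add: matrix_vector_right_distrib del: transpose_matrix_vector)
    then show 0: "\<xi> (\<phi> x) = 0" by (rule Ginj)
    have "L *v (E *v y) = y" for y by (simp add: matrix_vector_mul_assoc LE)
    then show "L *v (\<phi> x - q0) = x" using H 0 by (metis add.right_neutral matrix_vector_mult_0_right)
  qed
  have im: "\<phi> ` W = constraint_set \<xi> \<inter> U'"
  proof (intro set_eqI iffI)
    fix q assume "q \<in> \<phi> ` W"
    then show "q \<in> constraint_set \<xi> \<inter> U'" using x1 gV by (auto simp: constraint_set_def \<phi>_def W_def)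
  next
    fix q assume q: "q \<in> constraint_set \<xi> \<inter> U'"
    then have "H q = E *v (L *v (q - q0))" by (simp add: H_def constraint_set_def)
    then have "L *v (q - q0) \<in> W" "\<phi> (L *v (q - q0)) = q"
      using gU[of q] q by (auto simp: W_def \<phi>_def)
    then show "q \<in> \<phi> ` W" by (metis imageI)
  qed
  have "homeomorphism W (\<phi> ` W) \<phi> (\<lambda>q. L *v (q - q0))"
    by (rule homeomorphismI) (use cphi x1 in \<open>auto intro!: continuous_intros bounded_linear.continuous_on[OF matrix_vector_mul_bounded_linear]\<close>)
  moreover have "openin (top_of_set (constraint_set \<xi>)) (\<phi> ` W)"
    unfolding im using UV(1) by (rule openin_open_Int)
  ultimately have "local_parametrization (constraint_set \<xi>) W \<phi>"
    unfolding local_parametrization_def using oW C1 injd by blast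
  moreover have "q0 \<in> \<phi> ` W" unfolding im using q0 UV(2) by simp
  ultimately show ?thesis by blast
qed

section \<open>Change of charts\<close>

definition volume_density :: "real^'d^'d \<Rightarrow> (real^'k::finite \<Rightarrow> real^'d) \<Rightarrow> real^'k \<Rightarrow> real" where
  "volume_density N \<phi> x =
     sqrt (det (transpose (matrix (frechet_derivative \<phi> (at x))) ** N ** matrix (frechet_derivative \<phi> (at x))))"

lemma local_parametrizationD:
  assumes "local_parametrization S W \<phi>"
  shows "open W" "\<phi> ` W \<subseteq> S" "C_k_on 1 \<phi> W" "continuous_on W \<phi>" "inj_on \<phi> W"
    "\<And>x. x \<in> W \<Longrightarrow> (\<phi> has_derivative frechet_derivative \<phi> (at x)) (at x)"
    "\<And>x. x \<in> W \<Longrightarrow> inj (frechet_derivative \<phi> (at x))"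
    "openin (top_of_set S) (\<phi> ` W)"
    "continuous_on (\<phi> ` W) (inv_into W \<phi>)"
proof -
  obtain \<psi> where h: "homeomorphism W (\<phi> ` W) \<phi> \<psi>" and C1: "C_k_on 1 \<phi> W"
    using assms by (auto simp: local_parametrization_def simp del: C_k_on.simps)
  show "open W" "C_k_on 1 \<phi> W" "openin (top_of_set S) (\<phi> ` W)" "\<And>x. x \<in> W \<Longrightarrow> inj (frechet_derivative \<phi> (at x))"
    using assms unfolding local_parametrization_def by auto
  show "\<phi> ` W \<subseteq> S" using assms unfolding local_parametrization_def by (meson openin_imp_subset)
  show "\<And>x. x \<in> W \<Longrightarrow> (\<phi> has_derivative frechet_derivative \<phi> (at x)) (at x)"
    using C1 by (auto simp: frechet_derivative_works[symmetric])
  show "continuous_on W \<phi>" by (rule C1_imp_continuous_on[OF C1])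
  show inj: "inj_on \<phi> W" using h by (metis homeomorphism_apply1 inj_on_inverseI)
  have "\<psi> q = inv_into W \<phi> q" if "q \<in> \<phi> ` W" for q
    using h inj that by (auto simp: homeomorphism_def)
  then show "continuous_on (\<phi> ` W) (inv_into W \<phi>)"
    using h by (metis continuous_on_eq homeomorphism_cont2)
qed

text \<open>In an orthonormal frame the coordinates are scalar products with the frame vectors.\<close>
lemma orthonormal_frame_coordinates:
  fixes E :: "real^'k::finite^'d"
  assumes "transpose E ** N ** E = mat 1" "range ((*v) D) \<subseteq> range ((*v) E)"
  shows "D = E ** (transpose E ** N ** D)"
proof -
  have "D *v v = (E ** (transpose E ** N ** D)) *v v" for v
  proof -
    obtain y where y: "D *v v = E *v y" using assms(2) by auto
    have "(E ** (transpose E ** N ** D)) *v v = E *v ((transpose E ** N) *v (D *v v))"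
      by (simp add: matrix_vector_mul_assoc matrix_mul_assoc)
    also have "\<dots> = E *v y"
      by (simp add: y matrix_vector_mul_assoc assms(1))
    finally show ?thesis using y by simp
  qed
  then show ?thesis using matrix_eq by blast
qed

lemma gram_det_factor:
  fixes E :: "real^'k::finite^'d" and R :: "real^'k^'k"
  assumes "transpose E ** N ** E = mat 1"
  shows "det (transpose (E ** R) ** N ** (E ** R)) = (det R)\<^sup>2"
proof -
  have "transpose (E ** R) ** N ** (E ** R) = transpose R ** (transpose E ** N ** E) ** R"
    by (simp add: matrix_transpose_mul matrix_mul_assoc)
  then show ?thesis by (simp add: assms det_mul power2_eq_square)
qed

text \<open>An injective \<open>D\<close> is an orthonormal frame of its range times a square matrix \<open>R\<close>, so the Gram determinant is
\<open>(det R)\<^sup>2\<close>; otherwise it vanishes.\<close>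
lemma det_gram_nonneg:
  fixes D :: "real^'k::finite^'d"
  assumes "spd N" shows "0 \<le> det (transpose D ** N ** D)"
proof (cases "inj ((*v) D)")
  case True
  have "dim (range ((*v) D)) = CARD('k)"
    using dim_image_eq[of "(*v) D" UNIV] True by simp
  then obtain E :: "real^'k^'d" where E: "transpose E ** N ** E = mat 1" "range ((*v) E) = range ((*v) D)"
    using orthonormal_frame_exists[OF assms, of "range ((*v) D)"] by (metis linear_subspace_image matrix_vector_mul_linear subspace_UNIV)
  have "D = E ** (transpose E ** N ** D)"
    by (rule orthonormal_frame_coordinates[OF E(1)]) (simp add: E(2))
  then have "det (transpose D ** N ** D) = (det (transpose E ** N ** D))\<^sup>2"
    using gram_det_factor[OF E(1)] by metis
  then show ?thesis by simp
next
  case False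
  then obtain v where v: "v \<noteq> 0" "D *v v = 0" by (metis matrix_left_invertible_injective matrix_left_invertible_ker)
  then have "(transpose D ** N ** D) *v v = 0" by (simp add: matrix_vector_mul_assoc[symmetric] del: transpose_matrix_vector)
  then have "\<not> invertible (transpose D ** N ** D)"
    using v(1) by (metis invertible_left_inverse matrix_left_invertible_ker)
  then show ?thesis by (simp add: invertible_det_nz)
qed

lemma volume_density_nonneg: "spd N \<Longrightarrow> 0 \<le> volume_density N \<phi> x"
  by (simp add: volume_density_def det_gram_nonneg)

lemma continuous_on_volume_density:
  assumes "C_k_on 1 \<phi> W"
  shows "continuous_on W (volume_density N \<phi>)"
   "continuous_on W (\<lambda>x. matrix (frechet_derivative \<phi> (at x)))"
proof -
  have "continuous_on W (\<lambda>x. frechet_derivative \<phi> (at x) v)" for v using assms by auto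
  then show *: "continuous_on W (\<lambda>x. matrix (frechet_derivative \<phi> (at x)))"
    unfolding matrix_def by (auto intro!: continuous_intros)
  have cd: "continuous_on UNIV (\<lambda>D. det (transpose D ** N ** D))"
    by (rule C1_imp_continuous_on) (intro C1_det C1_matrix_mult C1_transpose C1_const C1_linear bounded_linear_ident)
  show "continuous_on W (volume_density N \<phi>)"
    unfolding volume_density_def
    by (intro continuous_on_real_sqrt continuous_on_compose2[OF cd *]) auto
qed

lemma borel_preimage:
  fixes f :: "'a::topological_space \<Rightarrow> 'b::topological_space"
  assumes "W \<in> sets borel" "continuous_on W f" "X \<in> sets borel"
  shows "{x \<in> W. f x \<in> X} \<in> sets borel"
proof -
  have "f -` X \<inter> space (restrict_space borel W) \<in> sets (restrict_space borel W)"
    by (rule measurable_sets[OF borel_measurable_continuous_on_restrict[OF assms(2)] assms(3)])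
  then have "f -` X \<inter> W \<in> sets borel"
    using assms(1) by (simp add: sets_restrict_space_iff space_restrict_space)
  moreover have "f -` X \<inter> W = {x \<in> W. f x \<in> X}" by blast
  ultimately show ?thesis by simp
qed

text \<open>The inverse chart is continuous on the Borel set \<open>\<phi> ` W\<close>, and the image of \<open>E\<close> is a preimage under it.\<close>
lemma chart_image_borel:
  assumes "local_parametrization S W \<phi>" "S \<in> sets borel" "E \<in> sets borel" "E \<subseteq> W"
  shows "\<phi> ` E \<in> sets borel"
proof -
  note l = local_parametrizationD[OF assms(1)]
  obtain O' where "open O'" "\<phi> ` W = S \<inter> O'" using l(8) by (auto simp: openin_open)
  then have b: "\<phi> ` W \<in> sets borel" using assms by auto
  have "{q \<in> \<phi> ` W. inv_into W \<phi> q \<in> E} \<in> sets borel"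
    by (rule borel_preimage[OF b l(9) assms(3)])
  moreover have "{q \<in> \<phi> ` W. inv_into W \<phi> q \<in> E} = \<phi> ` E"
    using l(5) assms(4) by (force simp: inv_into_f_f subset_iff)
  ultimately show ?thesis by simp
qed

lemma measurable_indicator_times_continuous_on:
  fixes f :: "_ \<Rightarrow> real"
  assumes "continuous_on W f" "open W" "E \<in> sets borel" "E \<subseteq> W"
  shows "(\<lambda>x. indicator E x * f x) \<in> borel_measurable borel"
proof -
  have "(\<lambda>x. indicator W x *\<^sub>R f x) \<in> borel_measurable borel"
    by (rule borel_measurable_continuous_on_indicator) (use assms in auto)
  then have "(\<lambda>x. indicator E x * (indicator W x *\<^sub>R f x)) \<in> borel_measurable borel"
    using assms(3) by measurable
  moreover have "(\<lambda>x. indicator E x * (indicator W x *\<^sub>R f x)) = (\<lambda>x. indicator E x * f x)"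
    using assms(4) by (auto simp: indicator_def fun_eq_iff)
  ultimately show ?thesis by simp
qed

lemma matrix_compose_linear:
  "linear f \<Longrightarrow> linear g \<Longrightarrow> matrix (\<lambda>x. g (f x)) = matrix g ** matrix (f :: real^'a \<Rightarrow> real^'b)"
  using matrix_compose[of f g] by (simp add: o_def linear_matrix_vector_mul_eq)

text \<open>The inverse of \<open>\<phi>'\<close> is only defined on the submanifold, so it cannot be differentiated in the ambient space.
Composing \<open>\<phi>'\<close> with a linear left inverse \<open>L\<close> of its derivative gives a local diffeomorphism \<open>f\<close> between open
sets of the parameter space, and the transition map is \<open>f\<close> inverse applied to \<open>L (\<phi> x)\<close>. The Gram
determinant then changes by the square of the Jacobian of the transition map.\<close>
lemma chart_transition_derivative:
  fixes \<phi> :: "real^'k::finite \<Rightarrow> real^'d" and \<phi>' :: "real^'k \<Rightarrow> real^'d"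
  assumes \<phi>: "local_parametrization S W \<phi>" and \<phi>': "local_parametrization S W' \<phi>'"
    and x0: "x0 \<in> W" "\<phi> x0 \<in> \<phi>' ` W'"
  defines "\<tau> \<equiv> \<lambda>x. inv_into W' \<phi>' (\<phi> x)"
  shows "\<exists>T. (\<tau> has_derivative T) (at x0) \<and>
    volume_density N \<phi> x0 = \<bar>det (matrix T)\<bar> * volume_density N \<phi>' (\<tau> x0)"
proof -
  note l = local_parametrizationD[OF \<phi>] and l' = local_parametrizationD[OF \<phi>']
  obtain O' where O': "open O'" "\<phi>' ` W' = S \<inter> O'" using l'(8) by (auto simp: openin_open)
  define Vo where "Vo = W \<inter> \<phi> -` O'"
  have oV: "open Vo" unfolding Vo_def by (rule continuous_open_preimage[OF l(4) l(1) O'(1)])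
  have V: "x \<in> Vo \<longleftrightarrow> x \<in> W \<and> \<phi> x \<in> \<phi>' ` W'" for x using O'(2) l(2) by (auto simp: Vo_def)
  have x0V: "x0 \<in> Vo" using x0 V by simp
  have \<tau>: "\<tau> x \<in> W'" "\<phi>' (\<tau> x) = \<phi> x" if "x \<in> Vo" for x
    using that V by (auto simp: \<tau>_def f_inv_into_f inv_into_into)
  have c\<tau>: "continuous_on Vo \<tau>"
    unfolding \<tau>_def by (rule continuous_on_compose2[OF l'(9) continuous_on_subset[OF l(4)]]) (auto simp: V)
  define y0 where "y0 = \<tau> x0"
  have y0: "y0 \<in> W'" using \<tau>[OF x0V] by (simp add: y0_def)
  from C1_blinfunE[OF l'(3)] obtain D where D: "\<And>y. y \<in> W' \<Longrightarrow> (\<phi>' has_derivative blinfun_apply (D y)) (at y)" "continuous_on W' D" by blast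
  have Dfr: "frechet_derivative \<phi>' (at y) = blinfun_apply (D y)" if "y \<in> W'" for y
    using frechet_derivative_at[OF D(1)[OF that]] by simp
  have "inj (blinfun_apply (D y0))" using l'(7)[OF y0] Dfr[OF y0] by simp
  \<comment> \<open>\<open>f\<close> below is a local diffeomorphism of the parameter space, since \<open>L\<close> inverts the derivative at \<open>y0\<close>.\<close>
  then obtain L where L: "linear L" "L \<circ> blinfun_apply (D y0) = id"
    using linear_injective_left_inverse[of "blinfun_apply (D y0)"] by (auto simp: linear_conv_bounded_linear blinfun.bounded_linear_right)
  have bL: "bounded_linear L" using L(1) by (simp add: linear_conv_bounded_linear)
  define f where "f y = L (\<phi>' y)" for y
  define f' where "f' y = Blinfun L o\<^sub>L D y" for y
  have f'a: "blinfun_apply (f' y) = (\<lambda>v. L (D y v))" for y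
    by (simp add: f'_def bounded_linear_Blinfun_apply[OF bL] fun_eq_iff)
  have fd: "(f has_derivative blinfun_apply (f' y)) (at y)" if "y \<in> W'" for y
    unfolding f_def f'a by (rule bounded_linear.has_derivative[OF bL D(1)[OF that]])
  have fc: "continuous_on W' f'" unfolding f'_def by (intro continuous_intros D(2))
  have id: "id_blinfun o\<^sub>L f' y0 = id_blinfun"
    by (rule blinfun_eqI) (use L(2) in \<open>simp add: f'a fun_eq_iff\<close>)
  obtain U' V g g' where UV: "open U'" "U' \<subseteq> W'" "y0 \<in> U'" "open V" "f y0 \<in> V" "homeomorphism U' V f g"
    and g: "\<And>y. y \<in> V \<Longrightarrow> (g has_derivative (g' y)) (at y)"
    by (rule inverse_function_theorem[OF l'(1) fd fc y0 id]) (assumption | rule that)+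
  define P where "P = Vo \<inter> \<tau> -` U'"
  have oP: "open P" unfolding P_def by (rule continuous_open_preimage[OF c\<tau> oV UV(1)])
  have x0P: "x0 \<in> P" using x0V UV(3) by (simp add: P_def y0_def)
  have eq: "\<tau> x = g (L (\<phi> x))" if "x \<in> P" for x
    using that \<tau>(2)[of x] UV(6) by (auto simp: P_def f_def[symmetric] homeomorphism_def) (metis f_def)
  have "L (\<phi> x0) \<in> V" using UV(5) \<tau>[OF x0V] by (simp add: f_def y0_def)
  then have "((\<lambda>x. g (L (\<phi> x))) has_derivative (\<lambda>v. g' (L (\<phi> x0)) (L (frechet_derivative \<phi> (at x0) v)))) (at x0)"
    by (intro has_derivative_compose[OF bounded_linear.has_derivative[OF bL l(6)[OF x0(1)]] g])
  then have "(\<tau> has_derivative (\<lambda>v. g' (L (\<phi> x0)) (L (frechet_derivative \<phi> (at x0) v)))) (at x0)"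
    by (rule has_derivative_transform_within_open[OF _ oP x0P]) (simp add: eq)
  then obtain T where T: "(\<tau> has_derivative T) (at x0)" by blast
  have "((\<lambda>x. \<phi>' (\<tau> x)) has_derivative (\<lambda>v. D y0 (T v))) (at x0)"
    using has_derivative_compose[OF T D(1)] y0 by (simp add: y0_def)
  then have "(\<phi> has_derivative (\<lambda>v. D y0 (T v))) (at x0)"
    by (rule has_derivative_transform_within_open[OF _ oV x0V]) (simp add: \<tau>)
  then have "frechet_derivative \<phi> (at x0) = (\<lambda>v. D y0 (T v))" using frechet_derivative_at by metis
  then have m: "matrix (frechet_derivative \<phi> (at x0)) = matrix (frechet_derivative \<phi>' (at y0)) ** matrix T"
    using matrix_compose_linear[OF has_derivative_linear[OF T] has_derivative_linear[OF D(1)[OF y0]]] Dfr[OF y0] by simp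
  have "volume_density N \<phi> x0 = \<bar>det (matrix T)\<bar> * volume_density N \<phi>' y0"
  proof -
    let ?D = "matrix (frechet_derivative \<phi>' (at y0))" and ?T = "matrix T"
    have "det (transpose (?D ** ?T) ** N ** (?D ** ?T)) = det (transpose ?T ** (transpose ?D ** N ** ?D) ** ?T)"
      by (simp add: matrix_transpose_mul matrix_mul_assoc)
    also have "\<dots> = (det ?T)\<^sup>2 * det (transpose ?D ** N ** ?D)"
      by (simp add: det_mul power2_eq_square)
    finally show ?thesis unfolding volume_density_def m by (simp add: real_sqrt_mult)
  qed
  with T show ?thesis unfolding y0_def by blast
qed

lemma nn_integral_chart_transition:
  fixes \<phi> :: "real^'k::finite \<Rightarrow> real^'d" and \<phi>' :: "real^'k \<Rightarrow> real^'d"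
  assumes \<phi>: "local_parametrization S W \<phi>" and \<phi>': "local_parametrization S W' \<phi>'"
    and S: "S \<in> sets borel" and E: "E \<in> sets borel" "E \<subseteq> W" "\<phi> ` E \<subseteq> \<phi>' ` W'" and N: "spd N"
  shows "(\<integral>\<^sup>+y. ennreal (indicator {y \<in> W'. \<phi>' y \<in> \<phi> ` E} y * volume_density N \<phi>' y) \<partial>lborel) =
    (\<integral>\<^sup>+x. ennreal (indicator E x * volume_density N \<phi> x) \<partial>lborel)"
proof -
  note l = local_parametrizationD[OF \<phi>] and l' = local_parametrizationD[OF \<phi>']
  define \<tau> where "\<tau> x = inv_into W' \<phi>' (\<phi> x)" for x
  have "\<forall>x\<in>E. \<exists>T. (\<tau> has_derivative T) (at x) \<and>
    volume_density N \<phi> x = \<bar>det (matrix T)\<bar> * volume_density N \<phi>' (\<tau> x)"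
    using chart_transition_derivative[OF \<phi> \<phi>'] E unfolding \<tau>_def by blast
  then obtain T where T: "\<And>x. x \<in> E \<Longrightarrow> (\<tau> has_derivative T x) (at x)"
    "\<And>x. x \<in> E \<Longrightarrow> volume_density N \<phi> x = \<bar>det (matrix (T x))\<bar> * volume_density N \<phi>' (\<tau> x)" by metis
  have \<tau>: "\<tau> x \<in> W'" "\<phi>' (\<tau> x) = \<phi> x" if "x \<in> E" for x
    using that E by (auto simp: \<tau>_def f_inv_into_f inv_into_into)
  have im: "\<tau> ` E = {y \<in> W'. \<phi>' y \<in> \<phi> ` E}"
  proof (intro set_eqI iffI)
    fix y assume "y \<in> {y \<in> W'. \<phi>' y \<in> \<phi> ` E}"
    then obtain x where "x \<in> E" "\<phi>' y = \<phi> x" "y \<in> W'" by auto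
    then have "\<tau> x = y" using \<tau>[of x] l'(5) by (metis inj_onD)
    then show "y \<in> \<tau> ` E" using \<open>x \<in> E\<close> by blast
  qed (use \<tau> in auto)
  have inj: "inj_on \<tau> E" using \<tau> l(5) E(2) by (metis inj_on_def subsetD)
  have b: "{y \<in> W'. \<phi>' y \<in> \<phi> ` E} \<in> sets borel"
    by (rule borel_preimage[OF borel_open[OF l'(1)] l'(4) chart_image_borel[OF \<phi> S E(1,2)]])
  have eq: "indicator E x * (\<bar>det (matrix (T x))\<bar> * volume_density N \<phi>' (\<tau> x)) = indicator E x * volume_density N \<phi> x" for x
    using T(2)[of x] by (simp add: indicator_def)
  have "(\<integral>\<^sup>+y. ennreal (indicator (\<tau> ` E) y * volume_density N \<phi>' y) \<partial>lborel) =
    (\<integral>\<^sup>+x. ennreal (indicator E x * (\<bar>det (matrix (T x))\<bar> * volume_density N \<phi>' (\<tau> x))) \<partial>lborel)"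
  proof (rule nn_integral_change_of_variables[OF E(1) has_derivative_at_withinI[OF T(1)] inj])
    show "(\<lambda>x. indicator E x * (\<bar>det (matrix (T x))\<bar> * volume_density N \<phi>' (\<tau> x))) \<in> borel_measurable borel"
      unfolding eq by (rule measurable_indicator_times_continuous_on[OF continuous_on_volume_density(1)[OF l(3)] l(1) E(1,2)])
    show "(\<lambda>x. indicator (\<tau> ` E) x * volume_density N \<phi>' x) \<in> borel_measurable borel"
      unfolding im by (rule measurable_indicator_times_continuous_on[OF continuous_on_volume_density(1)[OF l'(3)] l'(1) b]) auto
  qed (use volume_density_nonneg[OF N] in auto)
  then show ?thesis by (simp only: eq im)
qed

section \<open>The Riemannian measure of an atlas\<close>

text \<open>Countably many charts \<open>\<phi> i\<close> that cover \<open>S\<close>, possibly overlapping. Keeping in chart \<open>i\<close> only the points that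
no earlier chart reaches turns them into a single Borel bijection \<open>pt\<close> onto \<open>S\<close> from a Borel set \<open>cells\<close> of
pairs of an index and a parameter. Integrals over \<open>S\<close> become integrals over the \<open>\<sigma>\<close>-finite measure
space \<open>base\<close>.\<close>
locale atlas =
  fixes S :: "(real^'d) set" and W :: "nat \<Rightarrow> (real^'k::finite) set" and \<phi> :: "nat \<Rightarrow> real^'k \<Rightarrow> real^'d"
  assumes S_borel: "S \<in> sets borel"
    and chart: "\<And>i. local_parametrization S (W i) (\<phi> i)"
    and cover: "S = (\<Union>i. \<phi> i ` W i)"
begin

definition piece :: "nat \<Rightarrow> (real^'k) set" where
  "piece i = {x \<in> W i. \<forall>j<i. \<phi> i x \<notin> \<phi> j ` W j}"

definition base :: "(nat \<times> (real^'k)) measure" where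
  "base = count_space UNIV \<Otimes>\<^sub>M lborel"

definition cells :: "(nat \<times> (real^'k)) set" where
  "cells = (SIGMA i:UNIV. piece i)"

definition pt :: "nat \<times> (real^'k) \<Rightarrow> real^'d" where
  "pt z = (if z \<in> cells then \<phi> (fst z) (snd z) else 0)"

definition tangent :: "nat \<times> (real^'k) \<Rightarrow> real^'k^'d" where
  "tangent z = (if z \<in> cells then matrix (frechet_derivative (\<phi> (fst z)) (at (snd z))) else 0)"

definition dens :: "real^'d^'d \<Rightarrow> nat \<times> (real^'k) \<Rightarrow> real" where
  "dens N z = sqrt (det (transpose (tangent z) ** N ** tangent z))"

definition vol :: "real^'d^'d \<Rightarrow> (real^'d) measure" where
  "vol N = distr (density (restrict_space base cells) (\<lambda>z. ennreal (dens N z))) (restrict_space borel S) pt"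

lemmas chartD = local_parametrizationD[OF chart]

lemma piece_borel: "piece i \<in> sets borel"
proof -
  have "\<phi> j ` W j \<in> sets borel" for j
    by (rule chart_image_borel[OF chart S_borel _ order_refl]) (use chartD(1) in \<open>rule borel_open\<close>)
  then have "(\<Union>j\<in>{..<i}. \<phi> j ` W j) \<in> sets borel" by (intro sets.finite_UN) auto
  then have "- (\<Union>j<i. \<phi> j ` W j) \<in> sets borel" by (rule borel_comp)
  then have "{x \<in> W i. \<phi> i x \<in> - (\<Union>j<i. \<phi> j ` W j)} \<in> sets borel"
    by (rule borel_preimage[OF borel_open[OF chartD(1)] chartD(4)])
  moreover have "piece i = {x \<in> W i. \<phi> i x \<in> - (\<Union>j<i. \<phi> j ` W j)}"
    unfolding piece_def by blast
  ultimately show ?thesis by (rule ssubst[rotated])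
qed

lemma piece_subset: "piece i \<subseteq> W i" by (auto simp: piece_def)

lemma space_base [simp]: "space base = UNIV"
  by (simp add: base_def space_pair_measure)

lemma sigma_finite_base: "sigma_finite_measure base"
  unfolding base_def
  by (intro sigma_finite_pair_measure sigma_finite_measure_count_space_countable sigma_finite_lborel) auto

lemma measurable_baseI:
  assumes "\<And>i. (\<lambda>x. f (i, x)) \<in> measurable borel N" shows "f \<in> measurable base N"
  unfolding base_def by (rule measurable_pair_measure_countable1) (use assms in auto)

lemma base_slice:
  assumes "f \<in> measurable base N" shows "(\<lambda>x. f (i, x)) \<in> measurable borel N"
proof -
  have "Pair i \<in> measurable lborel base" unfolding base_def by (rule measurable_Pair1') simp
  from measurable_compose[OF this assms] show ?thesis by simp
qed

lemma cells_sets: "cells \<in> sets base"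
proof -
  have "{i} \<times> piece i \<in> sets base" for i
    unfolding base_def by (rule pair_measureI) (use piece_borel in auto)
  then have "(\<Union>i. {i} \<times> piece i) \<in> sets base" by (intro sets.countable_UN) auto
  moreover have "(\<Union>i. {i} \<times> piece i) = cells" by (auto simp: cells_def)
  ultimately show ?thesis by simp
qed

lemma measurable_base_cells_if:
  fixes f :: "nat \<Rightarrow> real^'k \<Rightarrow> 'b::{euclidean_space}"
  assumes "\<And>i. continuous_on (W i) (f i)"
  shows "(\<lambda>z. if z \<in> cells then f (fst z) (snd z) else 0) \<in> borel_measurable base"
proof (rule measurable_baseI)
  fix i
  have "f i \<in> borel_measurable (restrict_space borel (piece i))"
    by (rule borel_measurable_continuous_on_restrict[OF continuous_on_subset[OF assms piece_subset]])
  then have "(\<lambda>x. indicator (piece i) x *\<^sub>R f i x) \<in> borel_measurable borel"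
    using borel_measurable_restrict_space_iff[of "piece i" borel "f i"] piece_borel by simp
  moreover have "(\<lambda>x. indicator (piece i) x *\<^sub>R f i x) = (\<lambda>x. if (i, x) \<in> cells then f (fst (i, x)) (snd (i, x)) else 0)"
    by (auto simp: cells_def fun_eq_iff)
  ultimately show "(\<lambda>x. if (i, x) \<in> cells then f (fst (i, x)) (snd (i, x)) else 0) \<in> borel_measurable borel" by simp
qed

lemma measurable_pt [measurable]: "pt \<in> borel_measurable base"
  unfolding pt_def by (rule measurable_base_cells_if) (rule chartD)

lemma measurable_tangent [measurable]: "tangent \<in> borel_measurable base"
  unfolding tangent_def
  by (rule measurable_base_cells_if) (rule continuous_on_volume_density(2)[OF chartD(3)])

lemma dens_eq: "z \<in> cells \<Longrightarrow> dens N z = volume_density N (\<phi> (fst z)) (snd z)"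
  by (simp add: dens_def volume_density_def tangent_def)

lemma borel_det_gram: "(\<lambda>D::real^'k^'d. det (transpose D ** N ** D)) \<in> borel_measurable borel"
  by (rule borel_measurable_continuous_onI, rule C1_imp_continuous_on)
     (intro C1_det C1_matrix_mult C1_transpose C1_const C1_linear bounded_linear_ident)

lemma measurable_dens [measurable]: "dens N \<in> borel_measurable base"
proof -
  have "(\<lambda>z. det (transpose (tangent z) ** N ** tangent z)) \<in> borel_measurable base"
    by (rule measurable_compose[OF measurable_tangent borel_det_gram])
  then show ?thesis unfolding dens_def by measurable
qed

lemma pt_bij: "bij_betw pt cells S"
proof (rule bij_betw_imageI)
  have ne: "pt (i, x) \<noteq> pt (j, y)" if "(i, x) \<in> cells" "(j, y) \<in> cells" "i < j" for i j x y
    using that unfolding pt_def cells_def piece_def by simp (metis imageI)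
  show "inj_on pt cells"
  proof (rule inj_onI, clarify)
    fix i x j y assume *: "(i, x) \<in> cells" "(j, y) \<in> cells" "pt (i, x) = pt (j, y)"
    then have "i = j" using ne[of i x j y] ne[of j y i x] by (metis linorder_neqE_nat)
    moreover have "x = y" using * \<open>i = j\<close> chartD(5)[of i]
      by (auto simp: pt_def cells_def piece_def inj_on_def)
    ultimately show "i = j \<and> x = y" by simp
  qed
  show "pt ` cells = S"
  proof
    show "pt ` cells \<subseteq> S"
    proof clarify
      fix i x assume "(i, x) \<in> cells"
      then have "pt (i, x) = \<phi> i x" "x \<in> W i" by (simp_all add: pt_def cells_def piece_def)
      then show "pt (i, x) \<in> S" using chartD(2)[of i] by blast
    qed
    show "S \<subseteq> pt ` cells"
    proof
      fix q assume "q \<in> S"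
      then have ex: "\<exists>i. q \<in> \<phi> i ` W i" using cover by blast
      define i where "i = (LEAST i. q \<in> \<phi> i ` W i)"
      have "q \<in> \<phi> i ` W i" unfolding i_def by (rule LeastI_ex[OF ex])
      then obtain x where x: "x \<in> W i" "q = \<phi> i x" by blast
      have "\<forall>j<i. q \<notin> \<phi> j ` W j" unfolding i_def using not_less_Least by blast
      then have "(i, x) \<in> cells" using x by (simp add: cells_def piece_def)
      then show "q \<in> pt ` cells" using x by (metis pt_def fst_conv snd_conv imageI)
    qed
  qed
qed

lemma pt_in_S: "z \<in> cells \<Longrightarrow> pt z \<in> S" using pt_bij by (auto simp: bij_betw_def)

lemma measurable_pt_S: "pt \<in> measurable (restrict_space base cells) (restrict_space borel S)"
  by (rule measurable_restrict_space2)
     (use pt_in_S cells_sets in \<open>auto simp: space_restrict_space intro: measurable_restrict_space1\<close>)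

lemma sets_vol [simp]: "sets (vol N) = sets (restrict_space borel S)" by (simp add: vol_def)
lemma space_vol [simp]: "space (vol N) = S" by (simp add: vol_def space_restrict_space)

lemma nn_integral_vol:
  assumes "f \<in> borel_measurable (restrict_space borel S)"
  shows "(\<integral>\<^sup>+q. f q \<partial>vol N) = (\<integral>\<^sup>+z. indicator cells z * (ennreal (dens N z) * f (pt z)) \<partial>base)"
proof -
  have d: "(\<lambda>z. ennreal (dens N z)) \<in> borel_measurable (restrict_space base cells)"
    by (rule measurable_restrict_space1) measurable
  have "(\<integral>\<^sup>+q. f q \<partial>vol N) = (\<integral>\<^sup>+z. f (pt z) \<partial>density (restrict_space base cells) (\<lambda>z. ennreal (dens N z)))"
    unfolding vol_def by (rule nn_integral_distr) (use measurable_pt_S assms in auto)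
  also have "\<dots> = (\<integral>\<^sup>+z. ennreal (dens N z) * f (pt z) \<partial>restrict_space base cells)"
    by (rule nn_integral_density[OF d measurable_compose[OF measurable_pt_S assms]])
  also have "\<dots> = (\<integral>\<^sup>+z. ennreal (dens N z) * f (pt z) * indicator cells z \<partial>base)"
    by (rule nn_integral_restrict_space) (use cells_sets in simp)
  finally show ?thesis by (simp add: mult.commute)
qed

lemma nn_integral_base:
  assumes "f \<in> borel_measurable base"
  shows "(\<integral>\<^sup>+z. f z \<partial>base) = (\<Sum>i. \<integral>\<^sup>+x. f (i, x) \<partial>lborel)"
proof -
  have "(\<integral>\<^sup>+z. f z \<partial>base) = (\<integral>\<^sup>+i. \<integral>\<^sup>+x. f (i, x) \<partial>lborel \<partial>count_space UNIV)"
    unfolding base_def by (rule lborel.nn_integral_fst[symmetric]) (use assms in \<open>simp add: base_def\<close>)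
  then show ?thesis by (simp add: nn_integral_count_space_nat)
qed

lemma emeasure_vol:
  assumes "X \<in> sets borel" "X \<subseteq> S"
  shows "emeasure (vol N) X = (\<integral>\<^sup>+z. indicator cells z * (ennreal (dens N z) * indicator X (pt z)) \<partial>base)"
proof -
  have X: "X \<in> sets (restrict_space borel S)" using assms S_borel by (simp add: sets_restrict_space_iff)
  then have "emeasure (vol N) X = (\<integral>\<^sup>+q. indicator X q \<partial>vol N)" by simp
  also have "\<dots> = (\<integral>\<^sup>+z. indicator cells z * (ennreal (dens N z) * indicator X (pt z)) \<partial>base)"
    by (rule nn_integral_vol) (use X in simp)
  finally show ?thesis .
qed

lemma piece_preimage_borel: "X \<in> sets borel \<Longrightarrow> {x \<in> piece i. \<phi> i x \<in> X} \<in> sets borel"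
proof -
  assume "X \<in> sets borel"
  then have "{x \<in> W i. \<phi> i x \<in> X} \<inter> piece i \<in> sets borel"
    using borel_preimage[OF borel_open[OF chartD(1)] chartD(4)] piece_borel by blast
  moreover have "{x \<in> W i. \<phi> i x \<in> X} \<inter> piece i = {x \<in> piece i. \<phi> i x \<in> X}"
    using piece_subset by blast
  ultimately show ?thesis by simp
qed

lemma emeasure_vol_sum:
  assumes "X \<in> sets borel" "X \<subseteq> S" "spd N"
  shows "emeasure (vol N) X =
    (\<Sum>i. \<integral>\<^sup>+x. ennreal (indicator {x \<in> piece i. \<phi> i x \<in> X} x * volume_density N (\<phi> i) x) \<partial>lborel)"
proof -
  have m: "(\<lambda>z. indicator cells z * (ennreal (dens N z) * indicator X (pt z))) \<in> borel_measurable base"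
    using cells_sets assms(1) by measurable
  have "indicator cells (i, x) * (ennreal (dens N (i, x)) * indicator X (pt (i, x))) =
    ennreal (indicator {x \<in> piece i. \<phi> i x \<in> X} x * volume_density N (\<phi> i) x)" for i x
    by (cases "(i, x) \<in> cells") (auto simp: dens_eq pt_def cells_def indicator_def)
  then show ?thesis
    unfolding emeasure_vol[OF assms(1,2)] nn_integral_base[OF m] by simp
qed

text \<open>Independence of the atlas: an arbitrary chart is cut along the pieces, and each part is compared with the
chart of its piece by the change of charts.\<close>
lemma emeasure_vol_chart:
  assumes \<psi>: "local_parametrization S U (\<psi> :: real^'k \<Rightarrow> real^'d)" and E: "E \<in> sets borel" "E \<subseteq> U" and N: "spd N"
  shows "emeasure (vol N) (\<psi> ` E) = (\<integral>\<^sup>+x. ennreal (indicator E x * volume_density N \<psi> x) \<partial>lborel)"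
proof -
  note l = local_parametrizationD[OF \<psi>]
  define P where "P i = \<phi> i ` piece i" for i
  have Pb: "P i \<in> sets borel" for i unfolding P_def
    by (rule chart_image_borel[OF chart S_borel piece_borel piece_subset])
  have Pd: "disjoint_family P"
    using pt_bij by (auto simp: disjoint_family_on_def P_def piece_def) (metis linorder_neqE_nat image_eqI)
  have PS: "(\<Union>i. P i) = S"
  proof -
    have "S = pt ` cells" using pt_bij by (simp add: bij_betw_def)
    also have "\<dots> = (\<Union>i. P i)" by (force simp: P_def pt_def cells_def image_iff)
    finally show ?thesis by simp
  qed
  \<comment> \<open>The parameters in \<open>E\<close> whose points lie in the piece of chart \<open>i\<close>.\<close>
  define F where "F i = {x \<in> U. \<psi> x \<in> P i} \<inter> E" for i
  have Fb: "F i \<in> sets borel" for i unfolding F_def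
    using borel_preimage[OF borel_open[OF l(1)] l(4) Pb] E(1) by blast
  have Fd: "disjoint_family F" using Pd by (auto simp: disjoint_family_on_def F_def)
  have FE: "(\<Union>i. F i) = E" using PS l(2) E(2) by (auto simp: F_def)
  have im: "\<psi> ` E \<in> sets borel" "\<psi> ` E \<subseteq> S"
    using chart_image_borel[OF \<psi> S_borel E] l(2) E(2) by auto
  let ?g = "\<lambda>x. indicator E x * volume_density N \<psi> x"
  have gm: "?g \<in> borel_measurable borel"
    by (rule measurable_indicator_times_continuous_on[OF continuous_on_volume_density(1)[OF l(3)] l(1) E])
  have "(\<integral>\<^sup>+x. ennreal (indicator {x \<in> piece i. \<phi> i x \<in> \<psi> ` E} x * volume_density N (\<phi> i) x) \<partial>lborel)
      = emeasure (density lborel ?g) (F i)" for i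
  proof -
    have "{x \<in> piece i. \<phi> i x \<in> \<psi> ` E} = {y \<in> W i. \<phi> i y \<in> \<psi> ` F i}"
    proof (intro set_eqI iffI)
      fix y assume "y \<in> {x \<in> piece i. \<phi> i x \<in> \<psi> ` E}"
      then show "y \<in> {y \<in> W i. \<phi> i y \<in> \<psi> ` F i}"
      proof -
        obtain x where x: "x \<in> E" "\<phi> i y = \<psi> x" and y: "y \<in> piece i"
          using \<open>y \<in> {x \<in> piece i. \<phi> i x \<in> \<psi> ` E}\<close> by auto
        then have "\<psi> x \<in> P i" unfolding P_def by (metis imageI)
        then have "x \<in> F i" using x E(2) by (auto simp: F_def)
        then show ?thesis using x y piece_subset by blast
      qed
    next
      fix y assume "y \<in> {y \<in> W i. \<phi> i y \<in> \<psi> ` F i}"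
      then obtain x where x: "y \<in> W i" "\<phi> i y = \<psi> x" "x \<in> F i" by auto
      then obtain y' where y': "y' \<in> piece i" "\<phi> i y' = \<psi> x" by (auto simp: F_def P_def)
      then have "y = y'" using x chartD(5)[of i] piece_subset by (metis inj_onD subsetD)
      then show "y \<in> {x \<in> piece i. \<phi> i x \<in> \<psi> ` E}" using x y' by (auto simp: F_def)
    qed
    moreover have "F i \<subseteq> U" "\<psi> ` F i \<subseteq> \<phi> i ` W i"
      using piece_subset[of i] by (auto simp: F_def P_def)
    ultimately have "(\<integral>\<^sup>+x. ennreal (indicator {x \<in> piece i. \<phi> i x \<in> \<psi> ` E} x * volume_density N (\<phi> i) x) \<partial>lborel)
      = (\<integral>\<^sup>+x. ennreal (indicator (F i) x * volume_density N \<psi> x) \<partial>lborel)"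
      using nn_integral_chart_transition[OF \<psi> chart S_borel Fb _ _ N, of i i] by simp
    also have "\<dots> = (\<integral>\<^sup>+x. ennreal (?g x) * indicator (F i) x \<partial>lborel)"
      by (rule nn_integral_cong) (auto simp: indicator_def F_def)
    also have "\<dots> = emeasure (density lborel ?g) (F i)"
      by (rule emeasure_density[symmetric]) (use gm Fb in auto)
    finally show ?thesis .
  qed
  then have "emeasure (vol N) (\<psi> ` E) = (\<Sum>i. emeasure (density lborel ?g) (F i))"
    unfolding emeasure_vol_sum[OF im N] by simp
  also have "\<dots> = emeasure (density lborel ?g) E"
    using suminf_emeasure[of F "density lborel ?g"] Fb Fd FE by (auto simp: image_subset_iff)
  also have "\<dots> = (\<integral>\<^sup>+x. ennreal (?g x) * indicator E x \<partial>lborel)"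
    by (rule emeasure_density) (use gm E in auto)
  also have "\<dots> = (\<integral>\<^sup>+x. ennreal (?g x) \<partial>lborel)"
    by (rule nn_integral_cong) (auto simp: indicator_def)
  finally show ?thesis .
qed

lemma cells_decomposition:
  assumes "X \<subseteq> S"
  shows "X = (\<Union>i. \<phi> i ` {x \<in> piece i. \<phi> i x \<in> X})" "disjoint_family (\<lambda>i. \<phi> i ` {x \<in> piece i. \<phi> i x \<in> X})"
proof -
  show "X = (\<Union>i. \<phi> i ` {x \<in> piece i. \<phi> i x \<in> X})"
  proof
    show "X \<subseteq> (\<Union>i. \<phi> i ` {x \<in> piece i. \<phi> i x \<in> X})"
    proof
      fix q assume q: "q \<in> X"
      then obtain z where z: "z \<in> cells" "q = pt z" using assms pt_bij by (auto simp: bij_betw_def)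
      then show "q \<in> (\<Union>i. \<phi> i ` {x \<in> piece i. \<phi> i x \<in> X})"
        using q by (cases z) (auto simp: pt_def cells_def)
    qed
  qed auto
  show "disjoint_family (\<lambda>i. \<phi> i ` {x \<in> piece i. \<phi> i x \<in> X})"
    by (auto simp: disjoint_family_on_def piece_def) (metis linorder_neqE_nat image_eqI)
qed

text \<open>Existence is the previous comparison with arbitrary charts. For uniqueness, a measure with the prescribed
values on chart images is determined on every Borel set by cutting the set along the pieces.\<close>
lemma riemannian_measure_eq:
  assumes N: "spd N"
  shows "riemannian_measure TYPE('k) N S = vol N"
  unfolding riemannian_measure_def
proof (rule the_equality)
  have *: "(\<integral>\<^sup>+x\<in>E. ennreal (sqrt (det (transpose (matrix (frechet_derivative \<psi> (at x))) ** N **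
                  matrix (frechet_derivative \<psi> (at x))))) \<partial>lborel) =
     (\<integral>\<^sup>+x. ennreal (indicator E x * volume_density N \<psi> x) \<partial>lborel)" for E and \<psi> :: "real^'k \<Rightarrow> real^'d"
    by (rule nn_integral_cong) (auto simp: indicator_def volume_density_def)
  show v: "space (vol N) = S \<and> sets (vol N) = sets (restrict_space borel S) \<and>
        (\<forall>W (\<phi> :: real^'k \<Rightarrow> real^'d). local_parametrization S W \<phi> \<longrightarrow>
           (\<forall>E\<in>sets borel. E \<subseteq> W \<longrightarrow>
              emeasure (vol N) (\<phi> ` E) =
              (\<integral>\<^sup>+x\<in>E. ennreal (sqrt (det
                 (transpose (matrix (frechet_derivative \<phi> (at x))) ** N **
                  matrix (frechet_derivative \<phi> (at x))))) \<partial>lborel)))"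
    unfolding * using emeasure_vol_chart N by simp
  fix \<mu> :: "(real^'d) measure"
  assume \<mu>: "space \<mu> = S \<and> sets \<mu> = sets (restrict_space borel S) \<and>
        (\<forall>W (\<phi> :: real^'k \<Rightarrow> real^'d). local_parametrization S W \<phi> \<longrightarrow>
           (\<forall>E\<in>sets borel. E \<subseteq> W \<longrightarrow>
              emeasure \<mu> (\<phi> ` E) =
              (\<integral>\<^sup>+x\<in>E. ennreal (sqrt (det
                 (transpose (matrix (frechet_derivative \<phi> (at x))) ** N **
                  matrix (frechet_derivative \<phi> (at x))))) \<partial>lborel)))"
  show "\<mu> = vol N"
  proof (rule measure_eqI)
    show "sets \<mu> = sets (vol N)" using \<mu> by simp
    fix X assume "X \<in> sets \<mu>"
    then have X: "X \<in> sets borel" "X \<subseteq> S" using \<mu> S_borel by (auto simp: sets_restrict_space_iff)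
    let ?Y = "\<lambda>i. {x \<in> piece i. \<phi> i x \<in> X}"
    note d = cells_decomposition[OF X(2)]
    have Yb: "?Y i \<in> sets borel" "?Y i \<subseteq> W i" for i using piece_preimage_borel[OF X(1)] piece_subset by auto
    have sub: "range (\<lambda>i. \<phi> i ` ?Y i) \<subseteq> sets (restrict_space borel S)"
      using chart_image_borel[OF chart S_borel Yb] S_borel chartD(2) piece_subset
      by (fastforce simp: sets_restrict_space_iff)
    have "emeasure \<mu> X = (\<Sum>i. emeasure \<mu> (\<phi> i ` ?Y i))"
      using suminf_emeasure[of "\<lambda>i. \<phi> i ` ?Y i" \<mu>] sub d \<mu> by simp
    also have "\<dots> = (\<Sum>i. emeasure (vol N) (\<phi> i ` ?Y i))"
      using conjunct2[OF conjunct2[OF \<mu>], rule_format, OF chart Yb]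
        conjunct2[OF conjunct2[OF v], rule_format, OF chart Yb] by simp
    also have "\<dots> = emeasure (vol N) X"
      using suminf_emeasure[of "\<lambda>i. \<phi> i ` ?Y i" "vol N"] sub d v by simp
    finally show "emeasure \<mu> X = emeasure (vol N) X" .
  qed
qed

text \<open>Since charts map Borel sets to Borel sets, the inverse of \<open>pt\<close> is measurable.\<close>
lemma measurable_from_charts:
  assumes "(\<lambda>z. f (pt z)) \<in> measurable (restrict_space base cells) K" "f \<in> S \<rightarrow> space K"
  shows "f \<in> measurable (restrict_space borel S) K"
proof (rule measurableI)
  show "f q \<in> space K" if "q \<in> space (restrict_space borel S)" for q
    using that assms(2) by (auto simp: space_restrict_space)
  fix X assume X: "X \<in> sets K"
  let ?Y = "\<lambda>i. {x \<in> piece i. f (\<phi> i x) \<in> X}"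
  have Yb: "?Y i \<in> sets borel" for i
  proof -
    have "(\<lambda>z. f (pt z)) -` X \<inter> space (restrict_space base cells) \<in> sets (restrict_space base cells)"
      by (rule measurable_sets[OF assms(1) X])
    then have "{z \<in> cells. f (pt z) \<in> X} \<in> sets base"
      using cells_sets by (simp add: sets_restrict_space_iff space_restrict_space vimage_def Int_def conj_commute)
    then have "(\<lambda>z. z \<in> {z \<in> cells. f (pt z) \<in> X}) \<in> measurable base (count_space UNIV)" by measurable
    from base_slice[OF this, of i] have "{x. (i, x) \<in> cells \<and> f (pt (i, x)) \<in> X} \<in> sets borel"
      by (simp add: pred_def)
    moreover have "{x. (i, x) \<in> cells \<and> f (pt (i, x)) \<in> X} = ?Y i" by (auto simp: cells_def pt_def)
    ultimately show ?thesis by simp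
  qed
  have "f -` X \<inter> S = (\<Union>i. \<phi> i ` ?Y i)"
  proof -
    have "{x \<in> piece i. \<phi> i x \<in> f -` X \<inter> S} = ?Y i" for i
      using chartD(2)[of i] piece_subset[of i] by blast
    then show ?thesis using cells_decomposition(1)[of "f -` X \<inter> S"] by simp
  qed
  moreover have "(\<Union>i. \<phi> i ` ?Y i) \<in> sets borel"
    using chart_image_borel[OF chart S_borel Yb] piece_subset by (intro sets.countable_UN) auto
  ultimately have "f -` X \<inter> S \<in> sets borel" by simp
  then show "f -` X \<inter> space (restrict_space borel S) \<in> sets (restrict_space borel S)"
    using S_borel by (simp add: sets_restrict_space_iff space_restrict_space)
qed

text \<open>The area formula for a map that is affine in the ambient coordinates and injective on the part \<open>X\<close> of the
manifold. A Borel measurable left inverse \<open>r\<close> is given, so that all images of Borel subsets of \<open>X\<close> are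
Borel sets.\<close>
lemma lborel_affine_image:
  fixes L :: "real^'d^'k" and c :: "real^'k"
  defines "h \<equiv> \<lambda>q. L *v q + c"
  assumes X: "X \<in> sets borel" "X \<subseteq> S" and hX: "h ` X \<in> sets borel"
    and r: "r \<in> borel_measurable (restrict_space borel (h ` X))" "\<And>q. q \<in> X \<Longrightarrow> r (h q) = q"
  shows "emeasure lborel (h ` X) =
    (\<integral>\<^sup>+z. indicator cells z * (indicator X (pt z) * ennreal \<bar>det (L ** tangent z)\<bar>) \<partial>base)"
proof -
  let ?Y = "\<lambda>i. {x \<in> piece i. \<phi> i x \<in> X}"
  let ?H = "\<lambda>i x. h (\<phi> i x)"
  have Yb: "?Y i \<in> sets borel" "?Y i \<subseteq> W i" for i using piece_preimage_borel[OF X(1)] piece_subset by auto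
  have hI: "h ` X' \<in> sets borel" if "X' \<in> sets borel" "X' \<subseteq> X" for X'
  proof -
    have "r -` X' \<inter> space (restrict_space borel (h ` X)) \<in> sets (restrict_space borel (h ` X))"
      by (rule measurable_sets[OF r(1) that(1)])
    then have "r -` X' \<inter> h ` X \<in> sets borel" using hX by (simp add: sets_restrict_space_iff space_restrict_space)
    moreover have "r -` X' \<inter> h ` X = h ` X'" using r(2) that(2) by (auto simp: image_iff)
    ultimately show ?thesis by simp
  qed
  \<comment> \<open>\<open>h\<close> is injective across all charts, so the images of the pieces are disjoint.\<close>
  have injh: "inj_on h X" using r(2) by (rule inj_on_inverseI)
  have im: "?H i ` ?Y i = h ` (\<phi> i ` ?Y i)" for i by (simp add: image_image)
  have bim: "?H i ` ?Y i \<in> sets borel" for i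
    unfolding im by (rule hI[OF chart_image_borel[OF chart S_borel Yb]]) auto
  have inj: "inj_on (?H i) (?Y i)" for i
    using injh chartD(5)[of i] piece_subset[of i] by (auto simp: inj_on_def subset_iff)
  have dis: "disjoint_family (\<lambda>i. ?H i ` ?Y i)"
  proof -
    have "\<phi> i x = \<phi> j y" if "x \<in> ?Y i" "y \<in> ?Y j" "?H i x = ?H j y" for i j x y
      using injh that by (auto simp: inj_on_def)
    then show ?thesis using cells_decomposition(2)[OF X(2)]
      unfolding disjoint_family_on_def by (simp add: disjoint_iff) blast
  qed
  have un: "(\<Union>i. ?H i ` ?Y i) = h ` X"
    unfolding im using cells_decomposition(1)[OF X(2)] by (metis image_UN)
  have der: "(?H i has_derivative (\<lambda>v. L *v (frechet_derivative (\<phi> i) (at x) v))) (at x within ?Y i)" if "x \<in> ?Y i" for i x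
  proof -
    have "x \<in> W i" using that piece_subset by auto
    from bounded_linear.has_derivative[OF matrix_vector_mul_bounded_linear[of L] chartD(6)[OF this]]
    have "((\<lambda>x. L *v \<phi> i x) has_derivative (\<lambda>v. L *v (frechet_derivative (\<phi> i) (at x) v))) (at x)" .
    then show ?thesis unfolding h_def
      by (intro has_derivative_at_withinI[OF has_derivative_add_const])
  qed
  have mat: "matrix (\<lambda>v. L *v (frechet_derivative (\<phi> i) (at x) v)) = L ** tangent (i, x)" if "x \<in> ?Y i" for i x
    using that matrix_compose_linear[OF has_derivative_linear[OF chartD(6)] matrix_vector_mul_linear[of L], of x i] piece_subset
    by (auto simp: tangent_def cells_def)
  have Lm: "(\<lambda>D::real^'k^'d. \<bar>det (L ** D)\<bar>) \<in> borel_measurable borel"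
    by (rule borel_measurable_abs, rule borel_measurable_continuous_onI, rule C1_imp_continuous_on)
       (intro C1_det C1_matrix_mult C1_const C1_linear bounded_linear_ident)
  have tm: "(\<lambda>z. \<bar>det (L ** tangent z)\<bar>) \<in> borel_measurable base"
    by (rule measurable_compose[OF measurable_tangent Lm])
  have eq: "indicator (?Y i) x * (\<bar>det (matrix (\<lambda>v. L *v (frechet_derivative (\<phi> i) (at x) v)))\<bar> * 1) =
     indicator (?Y i) x * \<bar>det (L ** tangent (i, x))\<bar>" for i x
    using mat[of x i] by (auto simp: indicator_def)
  have "emeasure lborel (?H i ` ?Y i) =
    (\<integral>\<^sup>+x. indicator cells (i, x) * (indicator X (pt (i, x)) * ennreal \<bar>det (L ** tangent (i, x))\<bar>) \<partial>lborel)" for i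
  proof -
    have "emeasure lborel (?H i ` ?Y i) = (\<integral>\<^sup>+x. ennreal (indicator (?H i ` ?Y i) x * 1) \<partial>lborel)"
      using bim by (simp add: ennreal_indicator)
    also have "\<dots> = (\<integral>\<^sup>+x. ennreal (indicator (?Y i) x * (\<bar>det (matrix (\<lambda>v. L *v (frechet_derivative (\<phi> i) (at x) v)))\<bar> * 1)) \<partial>lborel)"
    proof (rule nn_integral_change_of_variables[OF Yb(1) der inj])
      show "(\<lambda>x. indicator (?Y i) x * (\<bar>det (matrix (\<lambda>v. L *v (frechet_derivative (\<phi> i) (at x) v)))\<bar> * 1)) \<in> borel_measurable borel"
        unfolding eq using base_slice[OF tm, of i] Yb(1)[of i] by measurable
    qed (use bim in auto)
    also have "\<dots> = (\<integral>\<^sup>+x. indicator cells (i, x) * (indicator X (pt (i, x)) * ennreal \<bar>det (L ** tangent (i, x))\<bar>) \<partial>lborel)"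
      unfolding eq by (rule nn_integral_cong) (auto simp: indicator_def cells_def pt_def)
    finally show ?thesis .
  qed
  moreover have "emeasure lborel (h ` X) = (\<Sum>i. emeasure lborel (?H i ` ?Y i))"
    using suminf_emeasure[of "\<lambda>i. ?H i ` ?Y i" lborel] bim dis un by (auto simp: image_subset_iff)
  moreover have "(\<lambda>z. indicator cells z * (indicator X (pt z) * ennreal \<bar>det (L ** tangent z)\<bar>)) \<in> borel_measurable base"
    using cells_sets X(1) tm by measurable
  ultimately show ?thesis by (simp add: nn_integral_base)
qed

end

text \<open>Lindelof's theorem extracts a countable subcover. The chart with empty domain is added so that the subcover
can be enumerated even when \<open>S\<close> is empty.\<close>
lemma atlas_exists:
  fixes S :: "(real^'d) set"
  assumes "S \<in> sets borel"
    and ex: "\<And>q. q \<in> S \<Longrightarrow> \<exists>W (\<phi> :: real^'k::finite \<Rightarrow> real^'d). local_parametrization S W \<phi> \<and> q \<in> \<phi> ` W"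
  shows "\<exists>W (\<phi> :: nat \<Rightarrow> real^'k \<Rightarrow> real^'d). atlas S W \<phi>"
proof -
  define \<F> where "\<F> = {\<phi> ` W |W (\<phi> :: real^'k \<Rightarrow> real^'d). local_parametrization S W \<phi>}"
  have "\<And>T. T \<in> \<F> \<Longrightarrow> openin (top_of_set S) T" using local_parametrizationD(8) by (auto simp: \<F>_def)
  from Lindelof_openin[OF this] obtain \<G> where \<G>: "\<G> \<subseteq> \<F>" "countable \<G>" "\<Union>\<G> = \<Union>\<F>" by metis
  have UF: "\<Union>\<F> = S"
  proof
    show "\<Union>\<F> \<subseteq> S" using local_parametrizationD(2) by (fastforce simp: \<F>_def)
    show "S \<subseteq> \<Union>\<F>"
    proof
      fix q assume "q \<in> S"
      with ex obtain W and \<phi> :: "real^'k \<Rightarrow> real^'d"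
        where "local_parametrization S W \<phi>" "q \<in> \<phi> ` W" by blast
      then show "q \<in> \<Union>\<F>" unfolding \<F>_def by blast
    qed
  qed
  have "homeomorphism {} {} (\<lambda>x :: real^'k. 0 :: real^'d) (\<lambda>_. 0)"
    by (simp add: homeomorphism_def)
  then have "local_parametrization S {} (\<lambda>x :: real^'k. 0 :: real^'d)"
    unfolding local_parametrization_def by auto
  then have "(\<lambda>x :: real^'k. 0 :: real^'d) ` {} \<in> \<F>" unfolding \<F>_def by blast
  then have "{} \<in> \<F>" by simp
  define T where "T = from_nat_into (insert {} \<G>)"
  have rT: "range T = insert {} \<G>" unfolding T_def using \<G>(2) by (simp add: range_from_nat_into)
  then have "\<forall>i. T i \<in> \<F>" using \<G>(1) \<open>{} \<in> \<F>\<close> by (metis insert_iff rangeI subsetD)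
  then have "\<exists>W \<phi>. T i = \<phi> ` W \<and> local_parametrization S W (\<phi> :: real^'k \<Rightarrow> real^'d)" for i
    unfolding \<F>_def by blast
  then obtain W \<phi> where W: "\<And>i. T i = \<phi> i ` W i" "\<And>i. local_parametrization S (W i) (\<phi> i :: real^'k \<Rightarrow> real^'d)"
    by metis
  have "(\<Union>i. \<phi> i ` W i) = \<Union>(range T)" by (simp add: W(1))
  also have "\<dots> = S" unfolding rT by (simp add: \<G>(3) UF)
  finally have "S = (\<Union>i. \<phi> i ` W i)" by (rule sym)
  with assms(1) W(2) have "atlas S W \<phi>" by (rule atlas.intro)
  then show ?thesis by blast
qed

section \<open>The Liouville measure in charts\<close>

lemma closed_constraint_set: assumes "smooth \<xi>" shows "closed (constraint_set \<xi>)"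
proof -
  have "continuous_on UNIV \<xi>" by (rule C1_imp_continuous_on[OF smooth_C1[OF assms]])
  then show ?thesis unfolding constraint_set_def by (intro closed_Collect_eq continuous_on_const)
qed

lemma closed_cotangent_bundle: assumes "smooth \<xi>" shows "closed (cotangent_bundle M \<xi>)"
proof -
  have "continuous_on UNIV (\<lambda>x::(real^'a)\<times>(real^'a). \<xi> (fst x))"
    by (rule C1_imp_continuous_on, rule C1_compose[OF C1_linear[OF bounded_linear_fst] smooth_C1[OF assms, of UNIV]]) simp
  moreover have "continuous_on UNIV (\<lambda>x::(real^'a)\<times>(real^'a). transpose (grads \<xi> (fst x)) *v (matrix_inv M *v snd x))"
    by (rule C1_imp_continuous_on,
        intro C1_matrix_vector_mult C1_transpose C1_compose[OF C1_linear[OF bounded_linear_fst] C1_grads[OF assms, of UNIV]] C1_const C1_linear[OF bounded_linear_snd]) simp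
  ultimately have "closed ({x. \<xi> (fst x) = 0} \<inter> {x. transpose (grads \<xi> (fst x)) *v (matrix_inv M *v snd x) = 0})"
    by (intro closed_Int closed_Collect_eq continuous_on_const)
  moreover have "{x. \<xi> (fst x) = 0} \<inter> {x. transpose (grads \<xi> (fst x)) *v (matrix_inv M *v snd x) = 0} = cotangent_bundle M \<xi>"
    by (auto simp: cotangent_bundle_def constraint_set_def cotangent_space_def simp del: transpose_matrix_vector)
  ultimately show ?thesis by simp
qed

locale constrained_space = atlas "constraint_set \<xi>" W \<phi>
  for \<xi> :: "real^'d \<Rightarrow> real^'m" and W :: "nat \<Rightarrow> (real^'k::finite) set" and \<phi> +
  fixes M :: "real^'d^'d"
  assumes card_k: "CARD('k) = CARD('d) - CARD('m)"
    and spd_M: "spd M" and smooth_\<xi>: "smooth \<xi>"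
    and gram_invertible: "\<And>q. q \<in> constraint_set \<xi> \<Longrightarrow> invertible (gram M \<xi> q)"
begin

abbreviation Mi :: "real^'d^'d" where "Mi \<equiv> matrix_inv M"
abbreviation S :: "(real^'d) set" where "S \<equiv> constraint_set \<xi>"
abbreviation TM :: "((real^'d) \<times> (real^'d)) set" where "TM \<equiv> cotangent_bundle M \<xi>"

lemma spd_Mi: "spd Mi" by (rule spd_matrix_inv[OF spd_M])
lemma transpose_M: "transpose M = M" and transpose_Mi: "transpose Mi = Mi"
  using spd_M spd_Mi by (simp_all add: spd_def)
lemma M_Mi: "M ** Mi = mat 1" and Mi_M: "Mi ** M = mat 1"
  using spd_invertible[OF spd_M] by (simp_all add: matrix_inv_mult_right matrix_inv_mult_left)

text \<open>The basis in which \<open>subspace_lebesgue\<close> measures a cotangent space. It is an arbitrary choice at each point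
and need not depend measurably on \<open>q\<close>.\<close>
definition frame :: "real^'d \<Rightarrow> real^'k^'d" where
  "frame q = (SOME E::real^'k^'d. transpose E ** Mi ** E = mat 1 \<and> range ((*v) E) = cotangent_space M \<xi> q)"

lemma frame:
  assumes "q \<in> S"
  shows "transpose (frame q) ** Mi ** frame q = mat 1" "range ((*v) (frame q)) = cotangent_space M \<xi> q"
proof -
  note d = cotangent_space_dim[OF spd_M gram_invertible[OF assms]]
  have "\<exists>E::real^'k^'d. transpose E ** Mi ** E = mat 1 \<and> range ((*v) E) = cotangent_space M \<xi> q"
    by (rule orthonormal_frame_exists[OF spd_Mi d(2)]) (simp add: d(1) card_k)
  from someI_ex[OF this] show "transpose (frame q) ** Mi ** frame q = mat 1" "range ((*v) (frame q)) = cotangent_space M \<xi> q"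
    unfolding frame_def by auto
qed

lemma frame_coordinates: "q \<in> S \<Longrightarrow> (transpose (frame q) ** Mi) *v (frame q *v y) = y"
  by (simp add: matrix_vector_mul_assoc frame(1))

lemma frame_coordinates':
  assumes "q \<in> S" "p \<in> cotangent_space M \<xi> q"
  shows "frame q *v ((transpose (frame q) ** Mi) *v p) = p"
proof -
  obtain y where "p = frame q *v y" using assms frame(2) by blast
  then show ?thesis using frame_coordinates[OF assms(1)] by simp
qed

lemma tangent_inj: assumes "z \<in> cells" "tangent z *v v = 0" shows "v = 0"
proof -
  have "snd z \<in> W (fst z)" using assms(1) by (auto simp: cells_def piece_def)
  note d = chartD(6)[OF this] and i = chartD(7)[OF this]
  have "frechet_derivative (\<phi> (fst z)) (at (snd z)) v = 0"
    using assms matrix_vector_mul(2)[OF has_derivative_linear[OF d]] by (simp add: tangent_def)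
  then show ?thesis using i has_derivative_linear[OF d] by (metis inj_eq linear_0)
qed

text \<open>The constraint function vanishes identically along a chart, so its derivative annihilates the tangent
vectors.\<close>
lemma tangent_vertical:
  assumes "z \<in> cells" shows "transpose (grads \<xi> (pt z)) *v (tangent z *v v) = 0"
proof -
  let ?i = "fst z" and ?x = "snd z"
  have x: "?x \<in> W ?i" using assms by (auto simp: cells_def piece_def)
  note d = chartD(6)[OF x]
  have "((\<lambda>y. \<xi> (\<phi> ?i y)) has_derivative
      (\<lambda>v. transpose (grads \<xi> (\<phi> ?i ?x)) *v frechet_derivative (\<phi> ?i) (at ?x) v)) (at ?x)"
    by (rule has_derivative_compose[OF d grads_derivative[OF smooth_\<xi>]])
  moreover have "((\<lambda>y. \<xi> (\<phi> ?i y)) has_derivative (\<lambda>v. 0)) (at ?x)"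
  proof (rule has_derivative_transform_within_open[OF has_derivative_const chartD(1) x])
    show "0 = \<xi> (\<phi> ?i y)" if "y \<in> W ?i" for y
      using chartD(2)[of ?i] that by (auto simp: constraint_set_def)
  qed
  ultimately have "transpose (grads \<xi> (\<phi> ?i ?x)) *v frechet_derivative (\<phi> ?i) (at ?x) v = 0"
    using has_derivative_unique by (metis (no_types, lifting))
  moreover have "frechet_derivative (\<phi> ?i) (at ?x) v = tangent z *v v"
    using assms matrix_vector_mul(2)[OF has_derivative_linear[OF d]] by (simp add: tangent_def)
  ultimately show ?thesis using assms by (simp add: pt_def del: transpose_matrix_vector)
qed

definition tangent_coordinates :: "nat \<times> (real^'k) \<Rightarrow> real^'k^'k" where
  "tangent_coordinates z = transpose (frame (pt z)) ** tangent z"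

text \<open>Multiplication by \<open>M\<close> identifies the tangent space with the cotangent space, isometrically for the scalar
products given by \<open>M\<close> and its inverse. Hence the volume density of a chart is the absolute value of the
determinant of the coordinate change from \<open>frame\<close> to the basis that the chart induces.\<close>
lemma tangent_factor:
  assumes z: "z \<in> cells"
  shows "M ** tangent z = frame (pt z) ** tangent_coordinates z"
    and "dens M z = \<bar>det (tangent_coordinates z)\<bar>"
    and "invertible (tangent_coordinates z)"
proof -
  let ?F = "frame (pt z)" and ?R = "tangent_coordinates z"
  note f = frame[OF pt_in_S[OF z]]
  have "(M ** tangent z) *v v \<in> cotangent_space M \<xi> (pt z)" for v
  proof -
    have "Mi *v ((M ** tangent z) *v v) = tangent z *v v"
      by (simp add: matrix_vector_mul_assoc matrix_mul_assoc Mi_M)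
    then show ?thesis using tangent_vertical[OF z, of v]
      by (simp add: cotangent_space_def del: transpose_matrix_vector)
  qed
  then have "range ((*v) (M ** tangent z)) \<subseteq> range ((*v) ?F)" using f(2) by auto
  from orthonormal_frame_coordinates[OF f(1) this]
  have "M ** tangent z = ?F ** (transpose ?F ** (Mi ** M) ** tangent z)"
    by (simp add: matrix_mul_assoc)
  then show 1: "M ** tangent z = ?F ** ?R" by (simp add: Mi_M tangent_coordinates_def)
  have "transpose (tangent z) ** M ** tangent z = transpose (tangent z) ** (M ** Mi) ** M ** tangent z"
    by (simp add: M_Mi)
  also have "\<dots> = transpose (M ** tangent z) ** Mi ** (M ** tangent z)"
    by (simp add: matrix_transpose_mul transpose_M matrix_mul_assoc)
  finally have "det (transpose (tangent z) ** M ** tangent z) = (det ?R)\<^sup>2"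
    unfolding 1 using gram_det_factor[OF f(1)] by simp
  then show "dens M z = \<bar>det ?R\<bar>" by (simp add: dens_def)
  have "v = 0" if "?R *v v = 0" for v
  proof -
    have "M *v (tangent z *v v) = 0"
      using that by (simp add: matrix_vector_mul_assoc 1) (simp add: matrix_vector_mul_assoc[symmetric])
    then have "tangent z *v v = 0"
      by (metis Mi_M matrix_vector_mul_assoc matrix_vector_mul_lid matrix_vector_mult_0_right)
    then show ?thesis by (rule tangent_inj[OF z])
  qed
  then show "invertible ?R" by (metis invertible_left_inverse matrix_left_invertible_ker)
qed

definition fibre_measure :: "((real^'d) \<times> (real^'d)) set \<Rightarrow> real^'d \<Rightarrow> ennreal" where
  "fibre_measure X q = emeasure (subspace_lebesgue TYPE('k) Mi (cotangent_space M \<xi> q)) {p. (q, p) \<in> X}"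

lemma slice_borel:
  fixes X :: "((real^'d) \<times> (real^'d)) set"
  assumes "X \<in> sets borel" shows "{p. (q, p) \<in> X} \<in> sets borel"
proof -
  have "Pair q \<in> borel_measurable borel"
    by (intro borel_measurable_continuous_onI continuous_intros)
  from measurable_sets[OF this assms] show ?thesis by (simp add: vimage_def)
qed

lemma fibre_measure_eq:
  assumes "X \<in> sets borel"
  shows "fibre_measure X q = emeasure lborel {y. (q, frame q *v y) \<in> X}" "{y. (q, frame q *v y) \<in> X} \<in> sets borel"
proof -
  have m: "(*v) (frame q) \<in> borel_measurable borel"
    by (intro borel_measurable_continuous_onI linear_continuous_on matrix_vector_mul_bounded_linear)
  have v: "(*v) (frame q) -` {p. (q, p) \<in> X} = {y. (q, frame q *v y) \<in> X}" by auto
  show "fibre_measure X q = emeasure lborel {y. (q, frame q *v y) \<in> X}"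
    unfolding fibre_measure_def subspace_lebesgue_def Let_def frame_def[symmetric]
    by (subst emeasure_distr) (use m slice_borel[OF assms] v in auto)
  show "{y. (q, frame q *v y) \<in> X} \<in> sets borel"
    using measurable_sets[OF m slice_borel[OF assms]] v by simp
qed

text \<open>Here the momentum is \<open>M\<close> times the velocity with coordinates \<open>y\<close> in the chart. The right-hand side no longer
contains the arbitrary frame, which makes it measurable in \<open>z\<close>.\<close>
lemma fibre_measure_velocity:
  assumes X: "X \<in> sets borel" and z: "z \<in> cells"
  shows "fibre_measure X (pt z) =
    (\<integral>\<^sup>+y. indicator X (pt z, M *v (tangent z *v y)) * ennreal (dens M z) \<partial>lborel)"
proof -
  let ?R = "tangent_coordinates z" and ?F = "frame (pt z)"
  note t = tangent_factor[OF z]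
  define Y where "Y = {y. (pt z, ?F *v y) \<in> X}"
  have Yb: "Y \<in> sets borel" unfolding Y_def by (rule fibre_measure_eq(2)[OF X])
  have Rm: "(*v) ?R \<in> borel_measurable borel"
    by (intro borel_measurable_continuous_onI linear_continuous_on matrix_vector_mul_bounded_linear)
  define Y' where "Y' = (*v) ?R -` Y"
  have Y'b: "Y' \<in> sets borel" unfolding Y'_def using measurable_sets[OF Rm Yb] by simp
  have bij: "bij ((*v) ?R)" using t(3) by (simp add: invertible_eq_bij)
  then have im: "(*v) ?R ` Y' = Y" unfolding Y'_def by (simp add: bij_is_surj surj_image_vimage_eq)
  have Y'mem: "y \<in> Y' \<longleftrightarrow> (pt z, M *v (tangent z *v y)) \<in> X" for y
    by (simp add: Y'_def Y_def matrix_vector_mul_assoc t(1))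
  have "fibre_measure X (pt z) = emeasure lborel Y" unfolding Y_def by (rule fibre_measure_eq(1)[OF X])
  also have "\<dots> = (\<integral>\<^sup>+y. ennreal (indicator ((*v) ?R ` Y') y * 1) \<partial>lborel)"
    unfolding im using Yb by (simp add: ennreal_indicator)
  also have "\<dots> = (\<integral>\<^sup>+y. ennreal (indicator Y' y * (\<bar>det (matrix ((*v) ?R))\<bar> * 1)) \<partial>lborel)"
  proof (rule nn_integral_change_of_variables[OF Y'b])
    show "((*v) ?R has_derivative (*v) ?R) (at x within Y')" for x
      by (rule bounded_linear_imp_has_derivative[OF matrix_vector_mul_bounded_linear])
    show "inj_on ((*v) ?R) Y'" using bij by (meson bij_is_inj inj_on_subset subset_UNIV)
  qed (use Yb Y'b im in auto)
  also have "\<dots> = (\<integral>\<^sup>+y. indicator X (pt z, M *v (tangent z *v y)) * ennreal (dens M z) \<partial>lborel)"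
    by (rule nn_integral_cong) (simp add: t(2) indicator_def Y'mem)
  finally show ?thesis .
qed

lemma measurable_fibre_measure:
  assumes X: "X \<in> sets borel"
  shows "fibre_measure X \<in> borel_measurable (restrict_space borel S)"
proof (rule measurable_from_charts)
  let ?f = "\<lambda>z. \<integral>\<^sup>+y. indicator X (pt z, M *v (tangent z *v y)) * ennreal (dens M z) \<partial>lborel"
  have "(\<lambda>(D::real^'k^'d, y::real^'k). M *v (D *v y)) \<in> borel_measurable borel"
    unfolding case_prod_beta
    by (rule borel_measurable_continuous_onI, rule C1_imp_continuous_on)
       (intro C1_matrix_vector_mult C1_const C1_linear bounded_linear_fst bounded_linear_snd)
  then have mul: "(\<lambda>(D::real^'k^'d, y::real^'k). M *v (D *v y)) \<in> borel_measurable (borel \<Otimes>\<^sub>M borel)"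
    by (simp add: borel_prod)
  have t: "(\<lambda>w. M *v (tangent (fst w) *v snd w)) \<in> borel_measurable (base \<Otimes>\<^sub>M lborel)"
    using measurable_compose[OF _ mul, of "\<lambda>w. (tangent (fst w), snd w)"] by simp
  have "(\<lambda>w. (pt (fst w), M *v (tangent (fst w) *v snd w))) \<in> measurable (base \<Otimes>\<^sub>M lborel) (borel \<Otimes>\<^sub>M borel)"
    using t by measurable
  then have "(\<lambda>w. (pt (fst w), M *v (tangent (fst w) *v snd w))) \<in> borel_measurable (base \<Otimes>\<^sub>M lborel)"
    by (simp add: borel_prod)
  then have "(\<lambda>w. indicator X (pt (fst w), M *v (tangent (fst w) *v snd w)) * ennreal (dens M (fst w))) \<in> borel_measurable (base \<Otimes>\<^sub>M lborel)"
    using X by measurable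
  then have "?f \<in> borel_measurable base"
    by (intro lborel.borel_measurable_nn_integral) (simp add: case_prod_beta)
  then have "?f \<in> borel_measurable (restrict_space base cells)" by (rule measurable_restrict_space1)
  moreover have "fibre_measure X (pt z) = ?f z" if "z \<in> space (restrict_space base cells)" for z
    using that fibre_measure_velocity[OF X] by (simp add: space_restrict_space)
  ultimately show "(\<lambda>z. fibre_measure X (pt z)) \<in> borel_measurable (restrict_space base cells)"
    by (subst measurable_cong) auto
qed auto

lemma TM_borel: "TM \<in> sets borel" by (rule borel_closed[OF closed_cotangent_bundle[OF smooth_\<xi>]])

lemma sets_liouville: "sets (liouville_measure TYPE('k) M \<xi>) = sets (restrict_space borel TM)"
  and space_liouville: "space (liouville_measure TYPE('k) M \<xi>) = TM"
proof -
  have sp: "space (restrict_space borel TM) = TM" by (simp add: space_restrict_space)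
  have p: "sets (restrict_space borel TM) \<subseteq> Pow TM" using sets.space_closed[of "restrict_space borel TM"] sp by simp
  show "sets (liouville_measure TYPE('k) M \<xi>) = sets (restrict_space borel TM)"
    unfolding liouville_measure_def sets_measure_of[OF p]
    using sets.sigma_sets_eq[of "restrict_space borel TM"] sp by simp
  show "space (liouville_measure TYPE('k) M \<xi>) = TM"
    unfolding liouville_measure_def by (rule space_measure_of[OF p])
qed

lemma sets_liouville_iff: "X \<in> sets (liouville_measure TYPE('k) M \<xi>) \<longleftrightarrow> X \<in> sets borel \<and> X \<subseteq> TM"
  using TM_borel by (auto simp: sets_liouville sets_restrict_space_iff)

text \<open>The measure of a fibre depends measurably on the base point, so the iterated integral is countably
additive and \<open>measure_of\<close> keeps its values.\<close>
lemma emeasure_liouville: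
  assumes "X \<in> sets borel" "X \<subseteq> TM"
  shows "emeasure (liouville_measure TYPE('k) M \<xi>) X = (\<integral>\<^sup>+q. fibre_measure X q \<partial>vol M)"
proof -
  let ?L = "liouville_measure TYPE('k) M \<xi>"
  let ?\<mu> = "\<lambda>X. \<integral>\<^sup>+q. fibre_measure X q \<partial>vol M"
  have L: "?L = measure_of TM (sets (restrict_space borel TM)) ?\<mu>"
    unfolding liouville_measure_def riemannian_measure_eq[OF spd_M] fibre_measure_def ..
  have p: "sets (restrict_space borel TM) \<subseteq> Pow TM"
    using sets.space_closed[of "restrict_space borel TM"] by (simp add: space_restrict_space)
  show ?thesis
  proof (rule emeasure_measure_of[OF L p])
    show "X \<in> sets ?L" using assms by (simp add: sets_liouville_iff)
    show "positive (sets ?L) ?\<mu>" by (simp add: positive_def fibre_measure_def)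
    show "countably_additive (sets ?L) ?\<mu>"
    proof (rule countably_additiveI)
      fix A :: "nat \<Rightarrow> ((real^'d) \<times> (real^'d)) set"
      assume A: "range A \<subseteq> sets ?L" "disjoint_family A" "(\<Union>i. A i) \<in> sets ?L"
      then have Ab: "A i \<in> sets borel" for i using sets_liouville_iff by (metis rangeI subsetD)
      have "fibre_measure (\<Union>i. A i) q = (\<Sum>i. fibre_measure (A i) q)" for q
      proof -
        let ?N = "subspace_lebesgue TYPE('k) Mi (cotangent_space M \<xi> q)"
        have sN: "sets ?N = sets borel" by (simp add: subspace_lebesgue_def Let_def)
        have "{p. (q, p) \<in> (\<Union>i. A i)} = (\<Union>i. {p. (q, p) \<in> A i})" by auto
        moreover have "(\<Sum>i. emeasure ?N {p. (q, p) \<in> A i}) = emeasure ?N (\<Union>i. {p. (q, p) \<in> A i})"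
          by (rule suminf_emeasure)
             (use A(2) slice_borel[OF Ab] in \<open>auto simp: sN disjoint_family_on_def\<close>)
        ultimately show ?thesis by (simp add: fibre_measure_def)
      qed
      then have "?\<mu> (\<Union>i. A i) = (\<integral>\<^sup>+q. (\<Sum>i. fibre_measure (A i) q) \<partial>vol M)" by simp
      also have "\<dots> = (\<Sum>i. ?\<mu> (A i))"
        by (rule nn_integral_suminf) (use measurable_fibre_measure[OF Ab] in \<open>simp cong: measurable_cong_sets\<close>)
      finally show "(\<Sum>i. ?\<mu> (A i)) = ?\<mu> (\<Union>i. A i)" by simp
    qed
  qed
qed

end

section \<open>The RATTLE map in position variables\<close>

lemma C1_on_subset_cong:
  assumes "C1_on f S" "T \<subseteq> S" "\<And>x. x \<in> T \<Longrightarrow> f x = g x"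
  shows "C1_on g T"
  unfolding C1_on_def
proof
  fix x assume "x \<in> T"
  then obtain U F where "open U" "x \<in> U" "C_k_on 1 F U" "\<forall>y\<in>S \<inter> U. F y = f y"
    using assms(1,2) unfolding C1_on_def by blast
  moreover from this have "\<forall>y\<in>T \<inter> U. F y = g y" using assms(2,3) by auto
  ultimately show "\<exists>U F. open U \<and> x \<in> U \<and> C_k_on 1 F U \<and> (\<forall>y\<in>T \<inter> U. F y = g y)" by blast
qed

lemma C1_on_imp_continuous_on: assumes "C1_on f S" shows "continuous_on S f"
  unfolding continuous_on_eq_continuous_within
proof
  fix x assume "x \<in> S"
  then obtain U F where U: "open U" "x \<in> U" "C_k_on 1 F U" "\<forall>y\<in>S \<inter> U. F y = f y"
    using assms unfolding C1_on_def by blast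
  have "continuous (at x within S) F"
    using C1_imp_continuous_on[OF U(3)] U(1,2) by (simp add: continuous_on_eq_continuous_at continuous_at_imp_continuous_at_within)
  moreover have "eventually (\<lambda>y. F y = f y) (at x within S)"
    unfolding eventually_at_topological using U by blast
  moreover have "F x = f x" using U \<open>x \<in> S\<close> by blast
  ultimately show "continuous (at x within S) f"
    unfolding continuous_within by (metis tendsto_cong)
qed

lemma involution_C1_diffeomorphism:
  assumes "C1_on f S" "\<And>x. x \<in> S \<Longrightarrow> f x \<in> S" "\<And>x. x \<in> S \<Longrightarrow> f (f x) = x"
  shows "C1_diffeomorphism f S S"
proof -
  have b: "bij_betw f S S" by (rule bij_betwI[where g=f]) (use assms in auto)
  have "inv_into S f x = f x" if "x \<in> S" for x
    using b assms that by (metis bij_betw_inv_into_left)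
  then have "C1_on (inv_into S f) S" by (intro C1_on_subset_cong[OF assms(1)]) auto
  then show ?thesis unfolding C1_diffeomorphism_def using b assms(1) by blast
qed

locale rattle_system = constrained_space \<xi> W \<phi> M
  for \<xi> :: "real^'d \<Rightarrow> real^'m" and W :: "nat \<Rightarrow> (real^'k::finite) set" and \<phi> M +
  fixes V :: "real^'d \<Rightarrow> real" and D :: "((real^'d) \<times> (real^'d)) set"
    and \<Lambda> :: "(real^'d) \<times> (real^'d) \<Rightarrow> real^'m" and dt :: real and U :: "(real^'d) set"
  assumes smooth_V: "smooth V" and admissible: "admissible_multiplier M \<xi> D \<Lambda>" and dt_pos: "dt > 0"
    and open_U: "open U" and S_U: "constraint_set \<xi> \<subseteq> U"
    and gram_U: "\<And>q. q \<in> U \<Longrightarrow> invertible (gram M \<xi> q)"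
begin

abbreviation "A \<equiv> rattle_domain M \<xi> V D dt"
abbreviation "\<Psi> \<equiv> rattle M \<xi> V \<Lambda> dt"
abbreviation "B \<equiv> reversible_set M \<xi> V D \<Lambda> dt"
abbreviation "\<Psi>rev \<equiv> rattle_rev M \<xi> V D \<Lambda> dt"
abbreviation "step \<equiv> rattle_q1 M \<xi> V \<Lambda> dt"

text \<open>The momentum before projection that leads from \<open>q\<close> to \<open>q'\<close> in one step: the half step momentum
\<open>(1 / dt) M (q' - q)\<close> with the force term of the first half step undone.\<close>
definition impulse :: "real^'d \<Rightarrow> real^'d \<Rightarrow> real^'d" where
  "impulse q q' = (1 / dt) *\<^sub>R (M *v (q' - q)) + (dt / 2) *\<^sub>R gradient V q"

text \<open>The projection onto the cotangent space at \<open>q\<close> along the columns of \<open>grads \<xi> q\<close>; it is orthogonal for the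
scalar product given by \<open>matrix_inv M\<close>.\<close>
definition proj :: "real^'d \<Rightarrow> real^'d \<Rightarrow> real^'d" where
  "proj q y = y - grads \<xi> q *v (matrix_inv (gram M \<xi> q) *v (transpose (grads \<xi> q) *v (Mi *v y)))"

definition momentum :: "real^'d \<Rightarrow> real^'d \<Rightarrow> real^'d" where
  "momentum q q' = proj q (impulse q q')"

lemma gram_apply: "transpose (grads \<xi> q) *v (Mi *v (grads \<xi> q *v l)) = gram M \<xi> q *v l"
  by (simp add: gram_def matrix_vector_mul_assoc matrix_mul_assoc del: transpose_matrix_vector)

lemma proj_in_cotangent_space: assumes "q \<in> U" shows "proj q y \<in> cotangent_space M \<xi> q"
proof -
  let ?w = "transpose (grads \<xi> q) *v (Mi *v y)"
  have "transpose (grads \<xi> q) *v (Mi *v proj q y) = ?w - gram M \<xi> q *v (matrix_inv (gram M \<xi> q) *v ?w)"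
    unfolding proj_def by (simp add: matrix_vector_mult_diff_distrib gram_apply del: transpose_matrix_vector)
  also have "\<dots> = 0"
    by (simp add: matrix_vector_mul_assoc[of "gram M \<xi> q"] matrix_inv_mult_right[OF gram_U[OF assms]] del: transpose_matrix_vector)
  finally show ?thesis by (simp add: cotangent_space_def del: transpose_matrix_vector)
qed

lemma proj_absorbs_normal:
  assumes "q \<in> U" shows "proj q (y + grads \<xi> q *v l) = proj q y"
proof -
  have "matrix_inv (gram M \<xi> q) *v (gram M \<xi> q *v l) = l"
    by (simp add: matrix_vector_mul_assoc matrix_inv_mult_left[OF gram_U[OF assms]])
  then show ?thesis
    unfolding proj_def by (simp add: matrix_vector_right_distrib gram_apply del: transpose_matrix_vector)
qed

lemma proj_fixes_cotangent_space: "p \<in> cotangent_space M \<xi> q \<Longrightarrow> proj q p = p"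
  by (simp add: proj_def cotangent_space_def del: transpose_matrix_vector)

text \<open>The frame vectors are orthogonal, for the scalar product given by \<open>matrix_inv M\<close>, to the directions that
are projected out.\<close>
lemma frame_proj:
  assumes "q \<in> S"
  shows "(transpose (frame q) ** Mi) *v proj q y = (transpose (frame q) ** Mi) *v y"
proof -
  have 0: "transpose (grads \<xi> q) ** Mi ** frame q = 0"
  proof -
    have "(transpose (grads \<xi> q) ** Mi ** frame q) *v v = 0 *v v" for v
    proof -
      have "frame q *v v \<in> cotangent_space M \<xi> q" using frame(2)[OF assms] by auto
      then show ?thesis
        by (simp add: cotangent_space_def matrix_vector_mul_assoc matrix_mul_assoc del: transpose_matrix_vector)
    qed
    then show ?thesis using matrix_eq by blast
  qed
  have "transpose (transpose (grads \<xi> q) ** Mi ** frame q) = transpose (frame q) ** Mi ** grads \<xi> q"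
    by (simp add: matrix_transpose_mul transpose_Mi matrix_mul_assoc)
  then have "transpose (frame q) ** Mi ** grads \<xi> q = 0"
    unfolding 0 by (simp add: vec_eq_iff transpose_def)
  then have "(transpose (frame q) ** Mi) *v (grads \<xi> q *v l) = 0" for l
    by (simp add: matrix_vector_mul_assoc)
  then show ?thesis
    unfolding proj_def by (simp add: matrix_vector_mult_diff_distrib del: transpose_matrix_vector)
qed

lemma rattle_domainD: "x \<in> A \<Longrightarrow> fst x \<in> S \<and> snd x \<in> cotangent_space M \<xi> (fst x) \<and> (fst x, free_step M V dt x) \<in> D"
  by (auto simp: rattle_domain_def cotangent_bundle_def)

lemma rattle_domain_subset: "A \<subseteq> TM" by (auto simp: rattle_domain_def)
lemma reversible_subset: "B \<subseteq> A" by (auto simp: reversible_set_def)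

lemma step_eq: "step x = free_step M V dt x + Mi *v (grads \<xi> (fst x) *v \<Lambda> (fst x, free_step M V dt x))"
  using dt_pos by (cases x) (simp add: rattle_q1_def rattle_p_half_def Let_def free_step_def
     matrix_vector_right_distrib matrix_vector_mult_scaleR scaleR_right_distrib)

lemma step_in_S: assumes "x \<in> A" shows "step x \<in> S"
  using rattle_domainD[OF assms] admissible unfolding admissible_multiplier_def step_eq by blast

lemma rattle_p_half_eq: "rattle_p_half M \<xi> V \<Lambda> dt x = (1 / dt) *\<^sub>R (M *v (step x - fst x))"
proof -
  have "step x - fst x = dt *\<^sub>R (Mi *v rattle_p_half M \<xi> V \<Lambda> dt x)"
    by (cases x) (simp add: rattle_q1_def)
  then show ?thesis
    using dt_pos by (simp add: matrix_vector_mult_scaleR matrix_vector_mul_assoc M_Mi)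
qed

text \<open>The Lagrange multiplier moves the momentum along the columns of \<open>grads \<xi> q\<close> only, which \<open>proj\<close> removes. The
initial momentum is therefore a function of the initial and final positions, into which the choice of \<open>\<Lambda>\<close> enters
through the final position alone.\<close>
lemma momentum_step:
  assumes "x \<in> A" shows "snd x = momentum (fst x) (step x)"
proof -
  define l where "l = (1 / dt) *\<^sub>R \<Lambda> (fst x, free_step M V dt x)"
  have "rattle_p_half M \<xi> V \<Lambda> dt x = snd x - (dt / 2) *\<^sub>R gradient V (fst x) + grads \<xi> (fst x) *v l"
    by (cases x) (simp add: rattle_p_half_def l_def)
  then have "impulse (fst x) (step x) = snd x + grads \<xi> (fst x) *v l"
    unfolding impulse_def rattle_p_half_eq[symmetric] by simp
  then have "momentum (fst x) (step x) = proj (fst x) (snd x)"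
    unfolding momentum_def using proj_absorbs_normal S_U rattle_domainD[OF assms] by auto
  then show ?thesis using proj_fixes_cotangent_space rattle_domainD[OF assms] by simp
qed

lemma multiplier_unique: assumes "x \<in> A" shows "\<exists>!l. rattle_multiplier M \<xi> V \<Lambda> dt x l"
proof -
  let ?q = "step x"
  define a where "a = rattle_p_half M \<xi> V \<Lambda> dt x - (dt / 2) *\<^sub>R gradient V ?q"
  define b where "b = transpose (grads \<xi> ?q) *v (Mi *v a)"
  have inv: "invertible (gram M \<xi> ?q)" using gram_invertible step_in_S[OF assms] by blast
  have "rattle_multiplier M \<xi> V \<Lambda> dt x l \<longleftrightarrow> l = - (matrix_inv (gram M \<xi> ?q) *v b)" for l
  proof -
    have "rattle_multiplier M \<xi> V \<Lambda> dt x l \<longleftrightarrow> b + gram M \<xi> ?q *v l = 0"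
      unfolding rattle_multiplier_def rattle_p1_def Let_def a_def[symmetric] b_def
      by (simp add: matrix_vector_right_distrib gram_apply del: transpose_matrix_vector)
    also have "\<dots> \<longleftrightarrow> l = - (matrix_inv (gram M \<xi> ?q) *v b)"
    proof
      assume "b + gram M \<xi> ?q *v l = 0"
      then have "matrix_inv (gram M \<xi> ?q) *v b + matrix_inv (gram M \<xi> ?q) *v (gram M \<xi> ?q *v l) = 0"
        by (metis matrix_vector_mult_0_right matrix_vector_right_distrib)
      then show "l = - (matrix_inv (gram M \<xi> ?q) *v b)"
        by (simp add: matrix_vector_mul_assoc matrix_inv_mult_left[OF inv] eq_neg_iff_add_eq_0 add.commute)
    next
      assume "l = - (matrix_inv (gram M \<xi> ?q) *v b)"
      then show "b + gram M \<xi> ?q *v l = 0"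
        by (simp add: linear_neg[OF matrix_vector_mul_linear] matrix_vector_mul_assoc matrix_inv_mult_right[OF inv])
    qed
    finally show ?thesis .
  qed
  then show ?thesis by auto
qed

text \<open>The second half step mirrors the first: after the change of sign the final momentum is the one that leads
back from the new position to the old one.\<close>
lemma rattle_eq: assumes "x \<in> A" shows "\<Psi> x = (step x, momentum (step x) (fst x))"
proof -
  let ?q = "step x"
  define l where "l = (THE l. rattle_multiplier M \<xi> V \<Lambda> dt x l)"
  have "rattle_multiplier M \<xi> V \<Lambda> dt x l" unfolding l_def by (rule theI'[OF multiplier_unique[OF assms]])
  then have "rattle_p1 M \<xi> V \<Lambda> dt x l \<in> cotangent_space M \<xi> ?q"
    by (simp add: rattle_multiplier_def cotangent_space_def)
  then have m: "- rattle_p1 M \<xi> V \<Lambda> dt x l \<in> cotangent_space M \<xi> ?q"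
    using cotangent_space_dim(2)[OF spd_M gram_invertible[OF step_in_S[OF assms]]] by (rule subspace_neg[rotated])
  have "- rattle_p1 M \<xi> V \<Lambda> dt x l + grads \<xi> ?q *v l = impulse ?q (fst x)"
    unfolding rattle_p1_def Let_def rattle_p_half_eq impulse_def
    by (simp add: matrix_vector_mult_diff_distrib algebra_simps)
  then have "momentum ?q (fst x) = proj ?q (- rattle_p1 M \<xi> V \<Lambda> dt x l)"
    unfolding momentum_def using proj_absorbs_normal S_U step_in_S[OF assms] by (metis subsetD)
  then show ?thesis using proj_fixes_cotangent_space[OF m] by (simp add: rattle_def l_def)
qed

lemma rattle_in_TM: assumes "x \<in> A" shows "\<Psi> x \<in> TM"
proof -
  have "momentum (step x) (fst x) \<in> cotangent_space M \<xi> (step x)"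
    unfolding momentum_def using proj_in_cotangent_space S_U step_in_S[OF assms] by blast
  then show ?thesis using rattle_eq[OF assms] step_in_S[OF assms] by (simp add: cotangent_bundle_def)
qed

lemma reversibleD: assumes "x \<in> B" shows "x \<in> A" "\<Psi> x \<in> B" "\<Psi> (\<Psi> x) = x"
  using assms by (auto simp: reversible_set_def)

lemma rev_reversible: "x \<in> B \<Longrightarrow> \<Psi>rev x = \<Psi> x" and rev_irreversible: "x \<notin> B \<Longrightarrow> \<Psi>rev x = x"
  by (simp_all add: rattle_rev_def)

lemma C1_gram: "C_k_on 1 (gram M \<xi>) X"
  unfolding gram_def by (intro C1_matrix_mult C1_transpose C1_grads smooth_\<xi> C1_const)

lemma C1_momentum: "C_k_on 1 (\<lambda>w. momentum (fst w) (snd w)) (U \<times> UNIV)"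
proof -
  have op: "open (U \<times> (UNIV :: (real^'d) set))" using open_U by (intro open_Times open_UNIV)
  have fst: "C_k_on 1 (\<lambda>w. f (fst w)) (U \<times> UNIV)" if "C_k_on 1 f UNIV" for f :: "real^'d \<Rightarrow> 'b::real_normed_vector"
    by (rule C1_compose[OF C1_linear[OF bounded_linear_fst] that]) simp
  have imp: "C_k_on 1 (\<lambda>w. impulse (fst w) (snd w)) (U \<times> UNIV)"
    unfolding impulse_def
    by (intro C1_add C1_scaleR_const C1_matrix_vector_mult C1_const C1_diff fst C1_gradient smooth_V
        C1_linear[OF bounded_linear_fst] C1_linear[OF bounded_linear_snd])
  have g: "C_k_on 1 (\<lambda>w. grads \<xi> (fst w)) (U \<times> UNIV)" by (rule fst[OF C1_grads[OF smooth_\<xi>]])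
  have t: "C_k_on 1 (\<lambda>w. transpose (grads \<xi> (fst w)) *v (Mi *v impulse (fst w) (snd w))) (U \<times> UNIV)"
    by (rule C1_matrix_vector_mult[OF C1_transpose[OF g] C1_matrix_vector_mult[OF C1_const imp]])
  have i: "C_k_on 1 (\<lambda>w. matrix_inv (gram M \<xi> (fst w)) *v (transpose (grads \<xi> (fst w)) *v (Mi *v impulse (fst w) (snd w)))) (U \<times> UNIV)"
    by (rule C1_matrix_inv_vector[OF fst[OF C1_gram] t _ op]) (auto intro: gram_U)
  show ?thesis unfolding momentum_def proj_def by (rule C1_diff[OF imp C1_matrix_vector_mult[OF g i]])
qed

lemma C1_free_step: "C_k_on 1 (free_step M V dt) X"
proof -
  have "C_k_on 1 (\<lambda>x. fst x + dt *\<^sub>R (Mi *v (snd x - (dt / 2) *\<^sub>R gradient V (fst x)))) X"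
    by (intro C1_add C1_scaleR_const C1_matrix_vector_mult C1_const C1_diff
        C1_compose[OF C1_linear[OF bounded_linear_fst] C1_gradient[OF smooth_V, of UNIV]]
        C1_linear[OF bounded_linear_fst] C1_linear[OF bounded_linear_snd]) simp
  moreover have "free_step M V dt = (\<lambda>x. fst x + dt *\<^sub>R (Mi *v (snd x - (dt / 2) *\<^sub>R gradient V (fst x))))"
    by (simp add: free_step_def fun_eq_iff)
  ultimately show ?thesis by simp
qed

text \<open>A local extension of \<open>\<Lambda>\<close> gives one of the new position; the new momentum is a continuously differentiable
function of both positions near the constraint set, where the Gram matrix stays invertible.\<close>
lemma C1_on_rattle: "C1_on \<Psi> A"
  unfolding C1_on_def
proof
  fix x0 assume x0: "x0 \<in> A"
  let ?e = "\<lambda>x. (fst x, free_step M V dt x)"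
  have eC1: "C_k_on 1 ?e X" for X by (rule C1_Pair[OF C1_linear[OF bounded_linear_fst] C1_free_step])
  have "C1_on \<Lambda> D" using admissible by (simp add: admissible_multiplier_def)
  then obtain O' L where L: "open O'" "?e x0 \<in> O'" "C_k_on 1 L O'" "\<forall>y\<in>D \<inter> O'. L y = \<Lambda> y"
    using rattle_domainD[OF x0] unfolding C1_on_def by blast
  define P where "P = ?e -` O'"
  have oP: "open P" unfolding P_def
    by (rule open_vimage[OF L(1)]) (rule C1_imp_continuous_on[OF eC1])
  \<comment> \<open>The formula for the new position with the local extension \<open>L\<close> in place of \<open>\<Lambda>\<close>.\<close>
  define Q where "Q x = free_step M V dt x + Mi *v (grads \<xi> (fst x) *v L (?e x))" for x
  have QC1: "C_k_on 1 Q P" unfolding Q_def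
    by (intro C1_add C1_free_step C1_matrix_vector_mult C1_const
        C1_compose[OF C1_linear[OF bounded_linear_fst] C1_grads[OF smooth_\<xi>, of UNIV]] C1_compose[OF eC1 L(3)])
       (auto simp: P_def)
  have Q: "Q x = step x" if "x \<in> A \<inter> P" for x
    using that L(4) rattle_domainD[of x] unfolding Q_def step_eq P_def by auto
  define R where "R = P \<inter> Q -` U"
  have oR: "open R" unfolding R_def by (rule continuous_open_preimage[OF C1_imp_continuous_on[OF QC1] oP open_U])
  have QR: "C_k_on 1 Q R" by (rule C1_subset[OF QC1]) (simp add: R_def)
  have "C_k_on 1 (\<lambda>x. momentum (fst (Q x, fst x)) (snd (Q x, fst x))) R"
    by (rule C1_compose[OF C1_Pair[OF QR C1_linear[OF bounded_linear_fst]] C1_momentum]) (auto simp: R_def)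
  then have "C_k_on 1 (\<lambda>x. momentum (Q x) (fst x)) R" by (simp only: fst_conv snd_conv)
  from C1_Pair[OF QR this]
  have F: "C_k_on 1 (\<lambda>x. (Q x, momentum (Q x) (fst x))) R" .
  have "x0 \<in> A \<inter> P" using x0 L(2) by (simp add: P_def)
  then have "x0 \<in> R" using Q[of x0] step_in_S[OF x0] S_U by (auto simp: R_def)
  moreover have "\<forall>y\<in>A \<inter> R. (Q y, momentum (Q y) (fst y)) = \<Psi> y"
    using Q rattle_eq by (auto simp: R_def)
  ultimately show "\<exists>U F. open U \<and> x0 \<in> U \<and> C_k_on 1 F U \<and> (\<forall>y\<in>A \<inter> U. F y = \<Psi> y)"
    using oR F by blast
qed

lemma continuous_on_rattle: "continuous_on A \<Psi>" by (rule C1_on_imp_continuous_on[OF C1_on_rattle])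

lemma continuous_on_step: "continuous_on A step"
proof -
  have "continuous_on A (\<lambda>x. fst (\<Psi> x))" by (intro continuous_intros continuous_on_rattle)
  then show ?thesis by (rule continuous_on_eq) (simp add: rattle_eq)
qed

lemma A_borel: "A \<in> sets borel"
proof -
  let ?e = "\<lambda>x. (fst x, free_step M V dt x)"
  have "continuous_on TM ?e" by (rule C1_imp_continuous_on[OF C1_Pair[OF C1_linear[OF bounded_linear_fst] C1_free_step]])
  moreover obtain O' where O': "open O'" "D = (S \<times> UNIV) \<inter> O'"
    using admissible by (auto simp: admissible_multiplier_def openin_open)
  ultimately have "{x \<in> TM. ?e x \<in> O'} \<in> sets borel" by (intro borel_preimage[OF TM_borel]) auto
  moreover have "{x \<in> TM. ?e x \<in> O'} = A"
    using O'(2) by (auto simp: rattle_domain_def cotangent_bundle_def)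
  ultimately show ?thesis by simp
qed

lemma B_borel: "B \<in> sets borel"
proof -
  define A' where "A' = {x \<in> A. \<Psi> x \<in> A}"
  have A': "A' \<in> sets borel" unfolding A'_def by (rule borel_preimage[OF A_borel continuous_on_rattle A_borel])
  have "continuous_on A' (\<lambda>x. \<Psi> (\<Psi> x) - x)"
    by (intro continuous_intros continuous_on_compose2[OF continuous_on_rattle] continuous_on_subset[OF continuous_on_rattle])
       (auto simp: A'_def)
  then have "{x \<in> A'. \<Psi> (\<Psi> x) - x \<in> {0}} \<in> sets borel" by (intro borel_preimage[OF A']) auto
  moreover have "{x \<in> A'. \<Psi> (\<Psi> x) - x \<in> {0}} = B" by (auto simp: A'_def reversible_set_def)
  ultimately show ?thesis by simp
qed

text \<open>The phase space points of \<open>X\<close> described by their initial and final positions. The last conjunct excludes the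
pairs from which the multiplier function would lead to another position.\<close>
definition position_pairs :: "((real^'d) \<times> (real^'d)) set \<Rightarrow> ((real^'d) \<times> (real^'d)) set" where
  "position_pairs X = {(q, q'). q \<in> S \<and> q' \<in> S \<and> (q, momentum q q') \<in> X \<and> step (q, momentum q q') = q'}"

lemma position_pairs_borel:
  assumes "X \<in> sets borel" "X \<subseteq> A" shows "position_pairs X \<in> sets borel"
proof -
  let ?g = "\<lambda>w. (fst w, momentum (fst w) (snd w))"
  have SS: "S \<times> S \<in> sets borel" using closed_constraint_set[OF smooth_\<xi>] by (intro borel_closed closed_Times)
  have "continuous_on (S \<times> S) (\<lambda>w. momentum (fst w) (snd w))"
    by (rule continuous_on_subset[OF C1_imp_continuous_on[OF C1_momentum]]) (use S_U in auto)
  then have g: "continuous_on (S \<times> S) ?g" by (intro continuous_intros)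
  define G where "G = {w \<in> S \<times> S. ?g w \<in> X}"
  have Gb: "G \<in> sets borel" unfolding G_def by (rule borel_preimage[OF SS g assms(1)])
  have "continuous_on G (\<lambda>w. step (?g w) - snd w)"
    by (intro continuous_intros continuous_on_compose2[OF continuous_on_step continuous_on_subset[OF g]])
       (use assms(2) in \<open>auto simp: G_def\<close>)
  then have "{w \<in> G. step (?g w) - snd w \<in> {0}} \<in> sets borel" by (intro borel_preimage[OF Gb]) auto
  moreover have "{w \<in> G. step (?g w) - snd w \<in> {0}} = position_pairs X" by (auto simp: G_def position_pairs_def)
  ultimately show ?thesis by simp
qed

text \<open>On the reversible set RATTLE exchanges the two positions.\<close>
lemma position_pairs_preimage:
  assumes "X \<subseteq> B"
  shows "(q', q) \<in> position_pairs {x \<in> B. \<Psi> x \<in> X} \<longleftrightarrow> (q, q') \<in> position_pairs X"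
proof -
  have half: "(q', q) \<in> position_pairs {x \<in> B. \<Psi> x \<in> Y}"
    if qq: "(q, q') \<in> position_pairs Y" and Y: "Y \<subseteq> B" for q q' Y
  proof -
    let ?y = "(q, momentum q q')"
    have y: "?y \<in> Y" "?y \<in> B" "step ?y = q'" "q \<in> S" "q' \<in> S" using qq Y by (auto simp: position_pairs_def)
    have \<Psi>y: "\<Psi> ?y = (q', momentum q' q)" using rattle_eq[OF reversibleD(1)[OF y(2)]] y(3) by simp
    then have "(q', momentum q' q) \<in> B" "\<Psi> (q', momentum q' q) = ?y" using reversibleD(2,3)[OF y(2)] by simp_all
    moreover from this have "step (q', momentum q' q) = q" using rattle_eq[OF reversibleD(1)] by (metis fst_conv)
    ultimately show ?thesis using y by (auto simp: position_pairs_def)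
  qed
  let ?X' = "{x \<in> B. \<Psi> x \<in> X}"
  have "{x \<in> B. \<Psi> x \<in> ?X'} = X" using assms reversibleD by auto
  \<comment> \<open>RATTLE is an involution on the reversible set, so \<open>half\<close> applied to the preimage is the converse.\<close>
  then show ?thesis using half[of q q' X] half[of q' q ?X'] assms by auto
qed

text \<open>At a fixed initial position the momentum in frame coordinates is the affine function \<open>?h\<close> of the final
position, with linear part \<open>(1 / dt) *\<^sub>R transpose ?F\<close>, and the final position is recovered from it by a RATTLE
step. The area formula gives the measure of the fibre, and the factor \<open>dens M z\<close>, a determinant, replaces
the frame by the tangent vectors of the chart at the initial position.\<close>
lemma fibre_measure_position_pairs:
  assumes X: "X \<in> sets borel" "X \<subseteq> A" and z: "z \<in> cells"
  shows "ennreal (dens M z) * fibre_measure X (pt z) =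
    (\<integral>\<^sup>+z'. indicator cells z' * (indicator (position_pairs X) (pt z, pt z') *
       ennreal \<bar>det ((1 / dt) *\<^sub>R (transpose (tangent z) ** M ** tangent z'))\<bar>) \<partial>base)"
proof -
  let ?q = "pt z" and ?F = "frame (pt z)" and ?R = "tangent_coordinates z"
  have q: "?q \<in> S" by (rule pt_in_S[OF z])
  let ?L = "(1 / dt) *\<^sub>R transpose ?F"
  \<comment> \<open>The part of \<open>transpose F ** Mi *v impulse q q'\<close> that does not depend on \<open>q'\<close>.\<close>
  define c where "c = (transpose ?F ** Mi) *v ((dt / 2) *\<^sub>R gradient V ?q) - ?L *v ?q"
  let ?h = "\<lambda>q'. ?L *v q' + c"
  define Y where "Y = {q'. (?q, q') \<in> position_pairs X}"
  have h: "?h q' = (transpose ?F ** Mi) *v momentum ?q q'" for q'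
  proof -
    have "transpose ?F ** Mi ** M = transpose ?F" by (simp add: matrix_mul_assoc[symmetric] Mi_M)
    then show ?thesis
      by (simp add: momentum_def frame_proj[OF q] impulse_def c_def matrix_vector_right_distrib
          matrix_vector_mult_scaleR matrix_vector_mul_assoc matrix_vector_mult_diff_distrib
          scaleR_matrix_vector_assoc[symmetric] scaleR_diff_right del: transpose_matrix_vector)
  qed
  have Yb: "Y \<in> sets borel" "Y \<subseteq> S"
    using slice_borel[OF position_pairs_borel[OF X]] by (auto simp: Y_def position_pairs_def)
  have hY: "?h ` Y = {y. (?q, ?F *v y) \<in> X}"
  proof (intro set_eqI iffI)
    fix y assume "y \<in> ?h ` Y"
    then obtain q' where q': "(?q, q') \<in> position_pairs X" "y = ?h q'" by (auto simp: Y_def)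
    have "momentum ?q q' \<in> cotangent_space M \<xi> ?q" unfolding momentum_def using proj_in_cotangent_space q S_U by blast
    then have "?F *v y = momentum ?q q'" unfolding q'(2) h by (rule frame_coordinates'[OF q])
    then show "y \<in> {y. (?q, ?F *v y) \<in> X}" using q' by (simp add: position_pairs_def)
  next
    fix y assume "y \<in> {y. (?q, ?F *v y) \<in> X}"
    then have x: "(?q, ?F *v y) \<in> X" "(?q, ?F *v y) \<in> A" using X(2) by auto
    let ?q' = "step (?q, ?F *v y)"
    have m: "?F *v y = momentum ?q ?q'" using momentum_step[OF x(2)] by simp
    then have "?q' \<in> Y" using x step_in_S[OF x(2)] q by (simp add: Y_def position_pairs_def)
    moreover have "y = ?h ?q'" unfolding h m[symmetric] by (rule frame_coordinates[OF q, symmetric])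
    ultimately show "y \<in> ?h ` Y" by (rule rev_image_eqI)
  qed
  have Fc: "continuous_on UNIV (\<lambda>y. (?q, ?F *v y))"
    by (intro continuous_intros linear_continuous_on matrix_vector_mul_bounded_linear)
  have "fibre_measure X ?q = emeasure lborel (?h ` Y)"
    unfolding hY by (rule fibre_measure_eq(1)[OF X(1)])
  also have "\<dots> = (\<integral>\<^sup>+z'. indicator cells z' * (indicator Y (pt z') * ennreal \<bar>det (?L ** tangent z')\<bar>) \<partial>base)"
  proof (rule lborel_affine_image[OF Yb])
    show "?h ` Y \<in> sets borel" unfolding hY by (rule fibre_measure_eq(2)[OF X(1)])
    show "(\<lambda>y. step (?q, ?F *v y)) \<in> borel_measurable (restrict_space borel (?h ` Y))"
      unfolding hY by (rule borel_measurable_continuous_on_restrict,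
         rule continuous_on_compose2[OF continuous_on_step continuous_on_subset[OF Fc]]) (use X(2) in auto)
    fix q' assume q': "q' \<in> Y"
    have "momentum ?q q' \<in> cotangent_space M \<xi> ?q" unfolding momentum_def using proj_in_cotangent_space q S_U by blast
    then have "?F *v ?h q' = momentum ?q q'" unfolding h by (rule frame_coordinates'[OF q])
    then show "step (?q, ?F *v ?h q') = q'" using q' by (simp add: Y_def position_pairs_def)
  qed
  finally have 1: "ennreal (dens M z) * fibre_measure X ?q =
    ennreal (dens M z) * (\<integral>\<^sup>+z'. indicator cells z' * (indicator Y (pt z') * ennreal \<bar>det (?L ** tangent z')\<bar>) \<partial>base)"
    by simp
  have Lm: "(\<lambda>D::real^'k^'d. \<bar>det (?L ** D)\<bar>) \<in> borel_measurable borel"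
    by (rule borel_measurable_abs, rule borel_measurable_continuous_onI, rule C1_imp_continuous_on)
       (intro C1_det C1_matrix_mult C1_const C1_linear bounded_linear_ident)
  have tm: "(\<lambda>z. \<bar>det (?L ** tangent z)\<bar>) \<in> borel_measurable base"
    by (rule measurable_compose[OF measurable_tangent Lm])
  have d: "dens M z * \<bar>det (?L ** tangent z')\<bar> = \<bar>det ((1 / dt) *\<^sub>R (transpose (tangent z) ** M ** tangent z'))\<bar>" for z'
  proof -
    have "transpose ?R ** (?L ** tangent z') = (1 / dt) *\<^sub>R (transpose ?R ** transpose ?F ** tangent z')"
      by (simp add: matrix_scalar_ac scalar_matrix_assoc matrix_mul_assoc)
    also have "transpose ?R ** transpose ?F = transpose (tangent z) ** M"
      using arg_cong[OF tangent_factor(1)[OF z], of transpose] by (simp add: matrix_transpose_mul transpose_M)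
    finally show ?thesis using tangent_factor(2)[OF z] by (metis abs_mult det_mul det_transpose)
  qed
  have eq: "ennreal (dens M z) * (indicator cells z' * (indicator Y (pt z') * ennreal \<bar>det (?L ** tangent z')\<bar>)) =
    indicator cells z' * (indicator (position_pairs X) (?q, pt z') *
       ennreal \<bar>det ((1 / dt) *\<^sub>R (transpose (tangent z) ** M ** tangent z'))\<bar>)" for z'
    unfolding d[symmetric] by (simp add: indicator_def Y_def ennreal_mult'')
  have "(\<lambda>z'. indicator cells z' * (indicator Y (pt z') * ennreal \<bar>det (?L ** tangent z')\<bar>)) \<in> borel_measurable base"
    using tm cells_sets Yb(1) by measurable
  then show ?thesis unfolding 1 eq[symmetric] by (rule nn_integral_cmult[symmetric])
qed

text \<open>Up to sign the matrix is the mixed second derivative, in charts, of the discrete action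
\<open>(q' - q) \<bullet> M (q' - q) / (2 dt) - (dt / 2) (V q + V q')\<close>, which is a generating function of the scheme.\<close>
definition pair_density :: "((real^'d) \<times> (real^'d)) set \<Rightarrow> (nat \<times> (real^'k)) \<times> (nat \<times> (real^'k)) \<Rightarrow> ennreal" where
  "pair_density X = (\<lambda>(z, z'). indicator cells z * (indicator cells z' * (indicator (position_pairs X) (pt z, pt z') *
       ennreal \<bar>det ((1 / dt) *\<^sub>R (transpose (tangent z) ** M ** tangent z'))\<bar>)))"

lemma pair_density_measurable:
  assumes X: "X \<in> sets borel" "X \<subseteq> A"
  shows "pair_density X \<in> borel_measurable (base \<Otimes>\<^sub>M base)"
proof -
  have "(\<lambda>w::(real^'k^'d)\<times>(real^'k^'d). \<bar>det ((1 / dt) *\<^sub>R (transpose (fst w) ** M ** snd w))\<bar>) \<in> borel_measurable borel"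
    by (rule borel_measurable_abs, rule borel_measurable_continuous_onI, rule C1_imp_continuous_on)
       (intro C1_det C1_scaleR_const C1_matrix_mult C1_const C1_transpose C1_linear bounded_linear_fst bounded_linear_snd)
  then have K: "(\<lambda>w::(real^'k^'d)\<times>(real^'k^'d). \<bar>det ((1 / dt) *\<^sub>R (transpose (fst w) ** M ** snd w))\<bar>) \<in> borel_measurable (borel \<Otimes>\<^sub>M borel)"
    by (simp add: borel_prod)
  have 1: "(\<lambda>w. \<bar>det ((1 / dt) *\<^sub>R (transpose (tangent (fst w)) ** M ** tangent (snd w)))\<bar>) \<in> borel_measurable (base \<Otimes>\<^sub>M base)"
    using measurable_compose[OF _ K, of "\<lambda>w. (tangent (fst w), tangent (snd w))"] by simp
  have "(\<lambda>w. (pt (fst w), pt (snd w))) \<in> measurable (base \<Otimes>\<^sub>M base) (borel \<Otimes>\<^sub>M borel)" by measurable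
  then have 2: "(\<lambda>w. (pt (fst w), pt (snd w))) \<in> borel_measurable (base \<Otimes>\<^sub>M base)" by (simp add: borel_prod)
  note [measurable] = cells_sets position_pairs_borel[OF X]
  show ?thesis unfolding pair_density_def case_prod_beta using 1 2 by measurable
qed

lemma emeasure_position_pairs:
  assumes X: "X \<in> sets borel" "X \<subseteq> A"
  shows "emeasure (liouville_measure TYPE('k) M \<xi>) X = (\<integral>\<^sup>+z. \<integral>\<^sup>+z'. pair_density X (z, z') \<partial>base \<partial>base)"
proof -
  have "emeasure (liouville_measure TYPE('k) M \<xi>) X = (\<integral>\<^sup>+z. indicator cells z * (ennreal (dens M z) * fibre_measure X (pt z)) \<partial>base)"
    using emeasure_liouville[OF X(1)] X(2) rattle_domain_subset nn_integral_vol[OF measurable_fibre_measure[OF X(1)]] by auto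
  also have "\<dots> = (\<integral>\<^sup>+z. \<integral>\<^sup>+z'. pair_density X (z, z') \<partial>base \<partial>base)"
  proof (rule nn_integral_cong)
    fix z
    show "indicator cells z * (ennreal (dens M z) * fibre_measure X (pt z)) = (\<integral>\<^sup>+z'. pair_density X (z, z') \<partial>base)"
      using fibre_measure_position_pairs[OF X, of z] by (cases "z \<in> cells") (simp_all add: pair_density_def)
  qed
  finally show ?thesis .
qed

text \<open>The density over pairs of positions is the absolute value of a determinant that is transposed when the
positions are exchanged, and the order of integration is exchanged by Tonelli's theorem.\<close>
lemma emeasure_rattle_preimage:
  assumes X: "X \<in> sets borel" "X \<subseteq> B"
  shows "emeasure (liouville_measure TYPE('k) M \<xi>) {x \<in> B. \<Psi> x \<in> X} = emeasure (liouville_measure TYPE('k) M \<xi>) X"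
proof -
  interpret pair_sigma_finite base base by (intro pair_sigma_finite.intro sigma_finite_base)
  let ?X' = "{x \<in> B. \<Psi> x \<in> X}"
  have XA: "X \<subseteq> A" using X reversible_subset by blast
  have X': "?X' \<in> sets borel" "?X' \<subseteq> A"
    using borel_preimage[OF B_borel continuous_on_subset[OF continuous_on_rattle reversible_subset] X(1)] reversible_subset by auto
  have sym: "pair_density ?X' (z, z') = pair_density X (z', z)" for z z'
  proof -
    have "transpose ((1 / dt) *\<^sub>R (transpose (tangent z) ** M ** tangent z')) = (1 / dt) *\<^sub>R (transpose (tangent z') ** M ** tangent z)"
      by (simp add: matrix_transpose_mul transpose_M matrix_mul_assoc transpose_scalar)
    then have "det ((1 / dt) *\<^sub>R (transpose (tangent z) ** M ** tangent z')) = det ((1 / dt) *\<^sub>R (transpose (tangent z') ** M ** tangent z))"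
      by (metis det_transpose)
    then show ?thesis
      by (auto simp: pair_density_def position_pairs_preimage[OF X(2)] indicator_def)
  qed
  have "emeasure (liouville_measure TYPE('k) M \<xi>) ?X' = (\<integral>\<^sup>+z. \<integral>\<^sup>+z'. pair_density X (z', z) \<partial>base \<partial>base)"
    unfolding emeasure_position_pairs[OF X'] sym ..
  also have "\<dots> = (\<integral>\<^sup>+z'. \<integral>\<^sup>+z. pair_density X (z', z) \<partial>base \<partial>base)"
    by (rule Fubini[OF pair_density_measurable[OF X(1) XA]])
  also have "\<dots> = emeasure (liouville_measure TYPE('k) M \<xi>) X" by (rule emeasure_position_pairs[OF X(1) XA, symmetric])
  finally show ?thesis .
qed

end

section \<open>The map with reverse projection check\<close>

context rattle_system
begin

lemma rev_in_TM: "x \<in> TM \<Longrightarrow> \<Psi>rev x \<in> TM"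
  using rev_reversible rev_irreversible rattle_in_TM reversible_subset by (metis subsetD)

lemma rev_in_B_iff: "\<Psi>rev x \<in> B \<longleftrightarrow> x \<in> B"
  using rev_reversible rev_irreversible reversibleD(2) by metis

lemma rev_rev: "\<Psi>rev (\<Psi>rev x) = x"
  using rev_reversible rev_irreversible reversibleD by metis

lemma C1_diffeomorphism_rev: "C1_diffeomorphism \<Psi>rev B B" "C1_diffeomorphism \<Psi>rev (TM - B) (TM - B)"
proof -
  have "C1_on \<Psi>rev B"
    by (rule C1_on_subset_cong[OF C1_on_rattle reversible_subset]) (simp add: rev_reversible)
  then show "C1_diffeomorphism \<Psi>rev B B"
    by (rule involution_C1_diffeomorphism) (simp_all add: rev_in_B_iff rev_rev)
  have "C_k_on 1 (\<lambda>x::(real^'d)\<times>(real^'d). x) UNIV" by (rule C1_linear[OF bounded_linear_ident])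
  then have "C1_on (\<lambda>x::(real^'d)\<times>(real^'d). x) (TM - B)"
    unfolding C1_on_def using open_UNIV by blast
  then have "C1_on \<Psi>rev (TM - B)" by (rule C1_on_subset_cong) (simp_all add: rev_irreversible)
  then show "C1_diffeomorphism \<Psi>rev (TM - B) (TM - B)"
    by (rule involution_C1_diffeomorphism) (simp_all add: rev_irreversible)
qed

lemma rev_preimage:
  assumes "X \<in> sets borel" "X \<subseteq> TM"
  shows "\<Psi>rev -` X \<inter> TM = {x \<in> B. \<Psi> x \<in> X \<inter> B} \<union> (X - B)" "\<Psi>rev -` X \<inter> TM \<in> sets borel"
proof -
  show eq: "\<Psi>rev -` X \<inter> TM = {x \<in> B. \<Psi> x \<in> X \<inter> B} \<union> (X - B)"
  proof (rule set_eqI)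
    fix x
    have "x \<in> B \<Longrightarrow> x \<in> TM" using reversible_subset rattle_domain_subset by blast
    then show "x \<in> \<Psi>rev -` X \<inter> TM \<longleftrightarrow> x \<in> {x \<in> B. \<Psi> x \<in> X \<inter> B} \<union> (X - B)"
      using assms(2) rev_reversible[of x] rev_irreversible[of x] reversibleD(2)[of x] by (cases "x \<in> B") auto
  qed
  have "{x \<in> B. \<Psi> x \<in> X \<inter> B} \<in> sets borel"
    by (rule borel_preimage[OF B_borel continuous_on_subset[OF continuous_on_rattle reversible_subset]]) (use assms B_borel in auto)
  then show "\<Psi>rev -` X \<inter> TM \<in> sets borel" unfolding eq using assms B_borel by auto
qed

lemma emeasure_rev_preimage:
  assumes "X \<in> sets (liouville_measure TYPE('k) M \<xi>)"
  shows "emeasure (liouville_measure TYPE('k) M \<xi>) (\<Psi>rev -` X \<inter> TM) = emeasure (liouville_measure TYPE('k) M \<xi>) X"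
proof -
  let ?\<sigma> = "liouville_measure TYPE('k) M \<xi>"
  have X: "X \<in> sets borel" "X \<subseteq> TM" using assms by (auto simp: sets_liouville_iff)
  have XB: "X \<inter> B \<in> sets borel" "X \<inter> B \<subseteq> B" using X B_borel by auto
  have s: "{x \<in> B. \<Psi> x \<in> X \<inter> B} \<in> sets ?\<sigma>" "X \<inter> B \<in> sets ?\<sigma>" "X - B \<in> sets ?\<sigma>"
    using borel_preimage[OF B_borel continuous_on_subset[OF continuous_on_rattle reversible_subset] XB(1)] X XB B_borel reversible_subset rattle_domain_subset
    by (auto simp: sets_liouville_iff)
  have "emeasure ?\<sigma> (\<Psi>rev -` X \<inter> TM) = emeasure ?\<sigma> {x \<in> B. \<Psi> x \<in> X \<inter> B} + emeasure ?\<sigma> (X - B)"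
    unfolding rev_preimage(1)[OF X] by (rule plus_emeasure[symmetric]) (use s in auto)
  also have "\<dots> = emeasure ?\<sigma> (X \<inter> B) + emeasure ?\<sigma> (X - B)"
    by (simp only: emeasure_rattle_preimage[OF XB])
  also have "\<dots> = emeasure ?\<sigma> ((X \<inter> B) \<union> (X - B))"
    by (rule plus_emeasure) (use s in auto)
  also have "(X \<inter> B) \<union> (X - B) = X" by blast
  finally show ?thesis .
qed

lemma measurable_rev: "\<Psi>rev \<in> measurable (liouville_measure TYPE('k) M \<xi>) (liouville_measure TYPE('k) M \<xi>)"
  by (rule measurableI) (use rev_in_TM rev_preimage(2) in \<open>auto simp: space_liouville sets_liouville_iff\<close>)

lemma measure_preserving_rev:
  assumes T: "T \<in> sets borel" "T \<subseteq> TM" "\<And>x. x \<in> TM \<Longrightarrow> \<Psi>rev x \<in> T \<longleftrightarrow> x \<in> T"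
  shows "measure_preserving_on (liouville_measure TYPE('k) M \<xi>) \<Psi>rev T"
proof -
  let ?\<sigma> = "liouville_measure TYPE('k) M \<xi>"
  have T\<sigma>: "T \<in> sets ?\<sigma>" using T by (simp add: sets_liouville_iff)
  have "\<Psi>rev \<in> measurable (restrict_space ?\<sigma> T) (restrict_space ?\<sigma> T)"
    by (rule measurable_restrict_space2)
       (use T in \<open>auto simp: space_restrict_space intro: measurable_restrict_space1[OF measurable_rev]\<close>)
  moreover have "emeasure ?\<sigma> (\<Psi>rev -` E \<inter> T) = emeasure ?\<sigma> E" if "E \<in> sets ?\<sigma>" "E \<subseteq> T" for E
  proof -
    have "\<Psi>rev -` E \<inter> T = \<Psi>rev -` E \<inter> TM" using that(2) T by blast
    then show ?thesis using emeasure_rev_preimage[OF that(1)] by simp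
  qed
  ultimately show ?thesis unfolding measure_preserving_on_def using T\<sigma> by blast
qed

end

theorem proposition2p4:
  fixes M :: "real^'d^'d"
    and \<xi> :: "real^'d \<Rightarrow> real^'m"
    and V :: "real^'d \<Rightarrow> real"
    and D :: "((real^'d) \<times> (real^'d)) set"
    and \<Lambda> :: "(real^'d) \<times> (real^'d) \<Rightarrow> real^'m"
    and dt :: real
  assumes "CARD('m) < CARD('d)"
    and "CARD('k::finite) = CARD('d) - CARD('m)"
    and "spd M"
    and "smooth \<xi>"
    and "\<exists>U. open U \<and> constraint_set \<xi> \<subseteq> U \<and> (\<forall>q\<in>U. invertible (gram M \<xi> q))"
    and "smooth V"
    and "admissible_multiplier M \<xi> D \<Lambda>"
    and "dt > 0"
  defines "TM \<equiv> cotangent_bundle M \<xi>"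
    and "\<sigma> \<equiv> liouville_measure TYPE('k) M \<xi>"
    and "A \<equiv> rattle_domain M \<xi> V D dt"
    and "\<Psi> \<equiv> rattle M \<xi> V \<Lambda> dt"
    and "B \<equiv> reversible_set M \<xi> V D \<Lambda> dt"
    and "\<Psi>rev \<equiv> rattle_rev M \<xi> V D \<Lambda> dt"
  shows "(\<forall>x\<in>A. (\<exists>!l. rattle_multiplier M \<xi> V \<Lambda> dt x l) \<and> \<Psi> x \<in> TM) \<and>
         \<Psi>rev \<in> TM \<rightarrow> TM \<and>
         (\<forall>x\<in>TM. \<Psi>rev (\<Psi>rev x) = x) \<and>
         C1_diffeomorphism \<Psi>rev B B \<and> measure_preserving_on \<sigma> \<Psi>rev B \<and>
         C1_diffeomorphism \<Psi>rev (TM - B) (TM - B) \<and> measure_preserving_on \<sigma> \<Psi>rev (TM - B) \<and>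
         \<Psi>rev \<in> measurable \<sigma> \<sigma> \<and>
         (\<forall>S\<in>sets \<sigma>. emeasure \<sigma> (\<Psi>rev -` S \<inter> TM) = emeasure \<sigma> S)"
proof -
  obtain U where U: "open U" "constraint_set \<xi> \<subseteq> U" "\<And>q. q \<in> U \<Longrightarrow> invertible (gram M \<xi> q)"
    using assms(5) by blast
  have "\<exists>W (\<phi> :: real^'k \<Rightarrow> real^'d). local_parametrization (constraint_set \<xi>) W \<phi> \<and> q \<in> \<phi> ` W"
    if "q \<in> constraint_set \<xi>" for q
    using constraint_chart_exists[OF assms(3,4) that U(3) assms(2)] U(2) that by blast
  with borel_closed[OF closed_constraint_set[OF assms(4)]]
  obtain W and \<phi> :: "nat \<Rightarrow> real^'k \<Rightarrow> real^'d" where at: "atlas (constraint_set \<xi>) W \<phi>"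
    using atlas_exists by blast
  interpret r: rattle_system \<xi> W \<phi> M V D \<Lambda> dt U
    by (intro rattle_system.intro constrained_space.intro constrained_space_axioms.intro rattle_system_axioms.intro at assms U)
       (use U in blast)
  have B: "B \<in> sets borel" "B \<subseteq> TM" "TM \<in> sets borel"
    unfolding B_def TM_def using r.B_borel r.reversible_subset r.rattle_domain_subset r.TM_borel by blast+
  show ?thesis
  proof (intro conjI)
    show "\<forall>x\<in>A. (\<exists>!l. rattle_multiplier M \<xi> V \<Lambda> dt x l) \<and> \<Psi> x \<in> TM"
      unfolding A_def \<Psi>_def TM_def using r.multiplier_unique r.rattle_in_TM by blast
    show "\<Psi>rev \<in> TM \<rightarrow> TM" unfolding \<Psi>rev_def TM_def using r.rev_in_TM by blast
    show "\<forall>x\<in>TM. \<Psi>rev (\<Psi>rev x) = x" unfolding \<Psi>rev_def using r.rev_rev by blast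
    show "C1_diffeomorphism \<Psi>rev B B" "C1_diffeomorphism \<Psi>rev (TM - B) (TM - B)"
      unfolding \<Psi>rev_def B_def TM_def by (rule r.C1_diffeomorphism_rev)+
    show "measure_preserving_on \<sigma> \<Psi>rev B" "measure_preserving_on \<sigma> \<Psi>rev (TM - B)"
      unfolding \<sigma>_def \<Psi>rev_def
      by (rule r.measure_preserving_rev; use B r.rev_in_B_iff r.rev_in_TM in \<open>auto simp: B_def TM_def\<close>)+
    show "\<Psi>rev \<in> measurable \<sigma> \<sigma>" unfolding \<sigma>_def \<Psi>rev_def by (rule r.measurable_rev)
    show "\<forall>S\<in>sets \<sigma>. emeasure \<sigma> (\<Psi>rev -` S \<inter> TM) = emeasure \<sigma> S"
      unfolding \<sigma>_def \<Psi>rev_def TM_def using r.emeasure_rev_preimage by blast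
  qed
qed

end
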